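(* Let $G$ be a simple, connected graph on at least two vertices which contains neither a 2-necklace nor a 2-blossom. Then $G$ has a spanning tree $T$ with \[ \ell(T) \geq \frac{n_{\geq 3}(G)}{3}+ \begin{cases} 4/3 & \text{if } \delta(G)\geq 3, \\ 2 & \text{if } \delta(G)\leq 2. \end{cases} \]
   Context: For a graph $T$, $\ell(T)$ denotes the number of leaves (vertices of degree 1) of $T$. $\delta(G)$ is the minimum degree of $G$, and $n_{\geq 3}(G)$ is the number of vertices of $G$ of degree at least 3. For a subgraph $H$ of $G$, a vertex $v$ of $H$ with $d_H(v)<d_G(v)$ is called a terminal of $H$. Diamond necklaces: the diamond $N_1$ is $K_4$ minus one edge; it has two vertices of degree 2. For $k\geq 2$, $N_k$ is obtained from $N_{k-1}$ and a vertex-disjoint copy of $N_1$ by identifying a degree-2 vertex of $N_1$ with a degree-2 vertex of $N_{k-1}$; thus $N_k$ again has exactly two degree-2 vertices, denoted $c_1,c_2$. A subgraph of $G$ isomorphic to $N_k$ (for some $k\geq 1$) is a 2-necklace if its only terminals are $c_1$ and $c_2$, and both $c_1$ and $c_2$ have degree 3 in $G$. Blossoms: the blossom graph has seven vertices $b, x_1,y_1,x_2,y_2,c_1,c_2$ and the ten edges $bx_1, by_1, bx_2, by_2, x_1y_1, x_2y_2, c_1x_1, c_1x_2, c_2y_1, c_2y_2$ (so $b$ has degree 4, $x_1,y_1,x_2,y_2$ have degree 3, and $c_1,c_2$ have degree 2). A subgraph of $G$ isomorphic to the blossom graph is a 2-blossom if its only terminals are $c_1$ and $c_2$ and both have degree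 3 in $G$. *)

theory Defs
  imports Complex_Main "Graph_Theory.Digraph_Isomorphism"
begin

text \<open>
  A finite simple graph is a \<open>pair_graph\<close>: a finite vertex set with a symmetric and
  irreflexive set of arcs, so that an undirected edge \<open>uv\<close> is the pair of arcs \<open>(u,v)\<close>, \<open>(v,u)\<close>.
\<close>

abbreviation vdegree :: "'a pair_pre_digraph \<Rightarrow> 'a \<Rightarrow> nat" where
  "vdegree G v \<equiv> out_degree (with_proj G) v"

definition min_degree :: "'a pair_pre_digraph \<Rightarrow> nat" where
  "min_degree G = Min (vdegree G ` pverts G)"

definition num_deg_ge3 :: "'a pair_pre_digraph \<Rightarrow> nat" where
  "num_deg_ge3 G = card {v \<in> pverts G. vdegree G v \<ge> 3}"

definition num_leaves :: "'a pair_pre_digraph \<Rightarrow> nat" where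
  "num_leaves T = card {v \<in> pverts T. vdegree T v = 1}"


subsection \<open>Trees\<close>

text \<open>
  The constants \<open>forest\<close>, \<open>tree\<close> and \<open>spanning_tree\<close> of \<open>Digraph_Component\<close> are not usable for
  undirected graphs: \<open>forest\<close> forbids directed cycles only, and among these it forbids the closed
  walk \<open>u, v, u\<close> along a single undirected edge. The cycles of an undirected graph are the
  directed cycles of length at least 3.
\<close>

definition undirected_tree :: "'a pair_pre_digraph \<Rightarrow> bool" where
  "undirected_tree T \<longleftrightarrow>
     pair_graph T \<and> Digraph_Component.connected (with_proj T) \<and>
     \<not> (\<exists>p. pre_digraph.cycle (with_proj T) p \<and> length p \<ge> 3)"

definition undirected_spanning_tree :: "'a pair_pre_digraph \<Rightarrow> 'a pair_pre_digraph \<Rightarrow> bool" where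
  "undirected_spanning_tree T G \<longleftrightarrow>
     undirected_tree T \<and> Digraph_Component.spanning (with_proj T) (with_proj G)"


subsection \<open>Diamond necklaces and blossoms\<close>

text \<open>The diamond on \<open>{3i, \<dots>, 3i+3}\<close>, with missing edge between \<open>3i\<close> and \<open>3i+3\<close>.\<close>

definition diamond :: "nat \<Rightarrow> nat pair_pre_digraph" where
  "diamond i = \<lparr> pverts = {3*i, 3*i+1, 3*i+2, 3*i+3},
     parcs = symcl {(3*i, 3*i+1), (3*i, 3*i+2), (3*i+1, 3*i+2), (3*i+1, 3*i+3), (3*i+2, 3*i+3)} \<rparr>"

text \<open>
  The union identifies the degree-2 vertex \<open>3k\<close> of \<open>necklace k\<close> with that of \<open>diamond k\<close>; these
  graphs share no other vertex. Only \<open>k \<ge> 1\<close> is meaningful: \<open>necklace 0\<close> is a dummy.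
\<close>

fun necklace :: "nat \<Rightarrow> nat pair_pre_digraph" where
  "necklace 0 = \<lparr> pverts = {}, parcs = {} \<rparr>"
| "necklace (Suc k) = \<lparr> pverts = pverts (necklace k) \<union> pverts (diamond k),
                         parcs = parcs (necklace k) \<union> parcs (diamond k) \<rparr>"

datatype blossom_vertex = Vb | Vx1 | Vy1 | Vx2 | Vy2 | Vc1 | Vc2

definition blossom :: "blossom_vertex pair_pre_digraph" where
  "blossom = \<lparr> pverts = UNIV,
     parcs = symcl {(Vb, Vx1), (Vb, Vy1), (Vb, Vx2), (Vb, Vy2), (Vx1, Vy1), (Vx2, Vy2),
                    (Vc1, Vx1), (Vc1, Vx2), (Vc2, Vy1), (Vc2, Vy2)} \<rparr>"

definition terminals :: "'a pair_pre_digraph \<Rightarrow> 'a pair_pre_digraph \<Rightarrow> 'a set" where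
  "terminals G H = {v \<in> pverts H. vdegree H v < vdegree G v}"

text \<open>
  In a copy \<open>H\<close> of a necklace or of the blossom, the vertices \<open>c\<^sub>1\<close> and \<open>c\<^sub>2\<close> are the two vertices
  of degree 2 in \<open>H\<close> (see \<open>necklace_ends\<close> and \<open>blossom_ends\<close> below).
\<close>

definition ends :: "'a pair_pre_digraph \<Rightarrow> 'a set" where
  "ends H = {v \<in> pverts H. vdegree H v = 2}"

definition two_necklace :: "'a pair_pre_digraph \<Rightarrow> 'a pair_pre_digraph \<Rightarrow> bool" where
  "two_necklace G H \<longleftrightarrow>
     Digraph_Component.subgraph (with_proj H) (with_proj G) \<and>
     (\<exists>k\<ge>1. digraph_iso (with_proj (necklace k)) (with_proj H)) \<and>
     terminals G H = ends H \<and> (\<forall>c \<in> ends H. vdegree G c = 3)"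

definition two_blossom :: "'a pair_pre_digraph \<Rightarrow> 'a pair_pre_digraph \<Rightarrow> bool" where
  "two_blossom G H \<longleftrightarrow>
     Digraph_Component.subgraph (with_proj H) (with_proj G) \<and>
     digraph_iso (with_proj blossom) (with_proj H) \<and>
     terminals G H = ends H \<and> (\<forall>c \<in> ends H. vdegree G c = 3)"


subsection \<open>Basic facts about the model graphs\<close>

lemma vdegree_eq: "vdegree G v = card {w. (v, w) \<in> parcs G}"
proof -
  have "out_arcs (with_proj G) v = Pair v ` {w. (v, w) \<in> parcs G}"
    by (auto simp: out_arcs_def)
  then show ?thesis
    by (simp add: out_degree_def card_image inj_on_def)
qed

lemma necklace_1: "necklace 1 = diamond 0"
  by (simp add: diamond_def)

lemma pverts_necklace: "k \<ge> 1 \<Longrightarrow> pverts (necklace k) = {..3*k}"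
proof (induction k rule: nat_induct_at_least)
  case base
  show ?case by (auto simp: diamond_def)
next
  case (Suc k)
  have "{..3 * Suc k} = {..3*k} \<union> {3*k, 3*k+1, 3*k+2, 3*k+3}" by auto
  with Suc show ?case by (simp add: diamond_def)
qed

lemma necklace_diamond_disjoint:
  "k \<ge> 1 \<Longrightarrow> pverts (necklace k) \<inter> pverts (diamond k) = {3*k}"
  by (auto simp: pverts_necklace diamond_def)

lemma parcs_necklace_le: "(u, w) \<in> parcs (necklace k) \<Longrightarrow> u \<le> 3*k \<and> w \<le> 3*k"
  by (induction k) (auto simp: diamond_def symcl_def)

lemma pair_graph_necklace: "pair_graph (necklace k)"
proof -
  have sym: "sym (symcl R)" for R :: "nat rel"
    by (auto simp: symcl_def sym_def)
  have d: "finite (pverts (diamond i))" "finite (parcs (diamond i))" "sym (parcs (diamond i))"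
      "parcs (diamond i) \<subseteq> pverts (diamond i) \<times> pverts (diamond i)"
      "(u, u) \<notin> parcs (diamond i)" for i u
    by (simp_all add: diamond_def sym) (auto simp: symcl_def)
  have "finite (pverts (necklace k))" "finite (parcs (necklace k))"
    by (induction k) (simp_all add: d)
  moreover have "sym (parcs (necklace k))"
    by (induction k) (simp_all add: d sym_Un)
  moreover have "parcs (necklace k) \<subseteq> pverts (necklace k) \<times> pverts (necklace k)"
  proof (induction k)
    case (Suc k)
    with d(4)[of k] show ?case by auto
  qed simp
  moreover have "(u, u) \<notin> parcs (necklace k)" for u
    by (induction k) (simp_all add: d)
  moreover have "symmetric (with_proj (necklace k)) \<longleftrightarrow> sym (parcs (necklace k))"
    by (simp add: symmetric_def)
  ultimately show ?thesis
    by unfold_locales auto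
qed

lemma pair_graph_blossom: "pair_graph blossom"
proof -
  have "UNIV = {Vb, Vx1, Vy1, Vx2, Vy2, Vc1, Vc2}"
    using blossom_vertex.exhaust by blast
  then have "finite (UNIV :: blossom_vertex set)"
    by (metis finite.emptyI finite.insertI)
  then show ?thesis
    by unfold_locales (auto simp: blossom_def symcl_def symmetric_def arcs_ends_conv sym_def)
qed

lemma vdegree_necklace:
  "k \<ge> 1 \<Longrightarrow> v \<le> 3*k \<Longrightarrow>
     vdegree (necklace k) v =
       (if v = 0 \<or> v = 3*k then 2 else if v mod 3 = 0 then 4 else 3)"
proof (induction k arbitrary: v rule: nat_induct_at_least)
  case base
  then have "v = 0 \<or> v = 1 \<or> v = 2 \<or> v = 3" by auto
  then show ?case
    by (auto simp: vdegree_eq diamond_def symcl_def Collect_disj_eq)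
next
  case (Suc k)
  let ?O = "{w. (v, w) \<in> parcs (necklace k)}"
  let ?D = "{w. (v, w) \<in> parcs (diamond k)}"
  have O_le: "?O \<subseteq> {..3*k}" and O_empty: "3*k < v \<Longrightarrow> ?O = {}"
    by (auto dest: parcs_necklace_le)
  have fin: "finite ?O" using O_le finite_subset by blast
  have deg: "vdegree (necklace (Suc k)) v = card (?O \<union> ?D)"
    by (simp add: vdegree_eq Collect_disj_eq)
  have O_card: "card ?O = (if v = 0 \<or> v = 3*k then 2 else if v mod 3 = 0 then 4 else 3)"
    if "v \<le> 3*k" using Suc.IH[OF that] by (simp add: vdegree_eq)
  consider "v < 3*k" | "v = 3*k" | "v = 3*k+1" | "v = 3*k+2" | "v = 3*k+3"
    using Suc.prems by (auto simp: less_Suc_eq_le) linarith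
  then show ?case
  proof cases
    case 1
    then have "?D = {}" by (auto simp: diamond_def symcl_def)
    then have "card (?O \<union> ?D) = card ?O" by (simp only: Un_empty_right)
    with 1 deg O_card show ?thesis by simp
  next
    case 2
    then have D: "?D = {3*k+1, 3*k+2}" by (auto simp: diamond_def symcl_def)
    moreover have "?O \<inter> {3*k+1, 3*k+2} = {}" using O_le by auto
    ultimately have "card (?O \<union> ?D) = card ?O + 2"
      using fin by (simp add: card_Un_disjoint)
    with 2 deg O_card Suc.hyps show ?thesis by simp
  next
    case 3
    then have "?D = {3*k, 3*k+2, 3*k+3}" by (auto simp: diamond_def symcl_def)
    with 3 deg O_empty have "vdegree (necklace (Suc k)) v = 3" by simp
    with 3 show ?thesis by (simp add: mod_simps)
  next
    case 4
    then have "?D = {3*k, 3*k+1, 3*k+3}" by (auto simp: diamond_def symcl_def)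
    with 4 deg O_empty have "vdegree (necklace (Suc k)) v = 3" by simp
    moreover have "v mod 3 = 2" using 4 by presburger
    ultimately show ?thesis using 4 by simp
  next
    case 5
    then have "?D = {3*k+1, 3*k+2}" by (auto simp: diamond_def symcl_def)
    with 5 deg O_empty have "vdegree (necklace (Suc k)) v = 2" by simp
    with 5 show ?thesis by simp
  qed
qed

lemma necklace_ends:
  assumes "k \<ge> 1"
  shows "ends (necklace k) = {0, 3*k}"
proof -
  have "v \<in> ends (necklace k) \<longleftrightarrow> v \<le> 3*k \<and> vdegree (necklace k) v = 2" for v
    using assms by (simp add: ends_def pverts_necklace)
  then have "v \<in> ends (necklace k) \<longleftrightarrow> v = 0 \<or> v = 3*k" for v
    using assms by (cases "v \<le> 3*k") (simp_all add: vdegree_necklace)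
  then show ?thesis by blast
qed

lemma vdegree_blossom:
  "vdegree blossom v = (case v of Vb \<Rightarrow> 4 | Vc1 \<Rightarrow> 2 | Vc2 \<Rightarrow> 2 | _ \<Rightarrow> 3)"
proof (cases v)
  case Vb
  have "{w. (Vb, w) \<in> parcs blossom} = {Vx1, Vy1, Vx2, Vy2}"
    by (auto simp: blossom_def symcl_def)
  with Vb show ?thesis by (simp add: vdegree_eq)
next
  case Vx1
  have "{w. (Vx1, w) \<in> parcs blossom} = {Vb, Vy1, Vc1}"
    by (auto simp: blossom_def symcl_def)
  with Vx1 show ?thesis by (simp add: vdegree_eq)
next
  case Vy1
  have "{w. (Vy1, w) \<in> parcs blossom} = {Vb, Vx1, Vc2}"
    by (auto simp: blossom_def symcl_def)
  with Vy1 show ?thesis by (simp add: vdegree_eq)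
next
  case Vx2
  have "{w. (Vx2, w) \<in> parcs blossom} = {Vb, Vy2, Vc1}"
    by (auto simp: blossom_def symcl_def)
  with Vx2 show ?thesis by (simp add: vdegree_eq)
next
  case Vy2
  have "{w. (Vy2, w) \<in> parcs blossom} = {Vb, Vx2, Vc2}"
    by (auto simp: blossom_def symcl_def)
  with Vy2 show ?thesis by (simp add: vdegree_eq)
next
  case Vc1
  have "{w. (Vc1, w) \<in> parcs blossom} = {Vx1, Vx2}"
    by (auto simp: blossom_def symcl_def)
  with Vc1 show ?thesis by (simp add: vdegree_eq)
next
  case Vc2
  have "{w. (Vc2, w) \<in> parcs blossom} = {Vy1, Vy2}"
    by (auto simp: blossom_def symcl_def)
  with Vc2 show ?thesis by (simp add: vdegree_eq)
qed

lemma blossom_ends: "ends blossom = {Vc1, Vc2}"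
proof -
  have "pverts blossom = UNIV" by (simp add: blossom_def)
  then have "v \<in> ends blossom \<longleftrightarrow> v \<in> {Vc1, Vc2}" for v
    unfolding ends_def by (cases v) (simp_all add: vdegree_blossom)
  then show ?thesis by blast
qed

end

theory Submission
  imports Defs
begin

text \<open>
  A spanning tree has \<open>2 + \<Sum>(deg v - 2)\<close> leaves, the sum taken over its vertices of degree at
  least 3, and every forest of a connected graph extends to a spanning tree. So it suffices to
  find a forest whose excess \<open>\<Sum>(deg v - 2)\<close> is large; it need not be connected. The statement is
  generalised to a graph in which only a set \<open>W\<close> of vertices of degree at least 3 is counted, the
  remaining, free, vertices having degree at most 3, and is proved by induction on the number of
  vertices.

  A triangle of counted vertices of degree 3 with three distinct outer neighbours contains a
  third of its size in excess, however the rest of the forest meets it. It is therefore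
  contracted to a free vertex, and so are a triangle behind a chain of diamonds and a blossom
  whose vertex \<open>c\<^sub>2\<close> is split in two.

  In a graph without such clusters a vertex set \<open>X\<close> spanned by a forest is grown, and \<open>6m - 2|X \<inter> W| -
  L\<close> is watched, where \<open>m\<close> is the excess and \<open>L\<close> the number of live leaves. It can be kept from
  decreasing, except when each counted vertex outside \<open>X\<close> has no or two neighbours in \<open>X\<close>; it may
  then drop by 1, but it is even at this moment and at the end, so nothing is lost. When no
  counted vertex is adjacent to \<open>X\<close> any more, \<open>X\<close> is removed; the free vertices adjacent to it lose
  an edge and serve as starting points for the remaining components.
\<close>

subsection \<open>Forests as symmetric relations\<close>

text \<open>The goal \<open>card W \<le> 3 * excess\<close> lets one unit of excess pay for three
  counted vertices. The doubled weights, 6 against 2, leave room for the surcharge of 1 on a live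
  leaf. If \<open>X\<close> has no counted neighbour outside, the potential is twice an integer, so
  a start at -1 is as good as one at 0. A star around a counted vertex guarantees only -5; this
  costs 2 in the inequality and turns the summand 2 into 4/3. A free vertex of degree at most 2
  leads to a start at -1 or better.

  Free vertices are forced by contraction: the vertex that replaces a cluster is already paid for,
  but it must keep an edge to each outer neighbour, so that counted vertices keep their degrees.
  Degree at most 3 makes it cheap: once entered it has at most two edges left, so it costs no more
  than a dead counted vertex.

  What blocks growth is a triangle entered through a single edge. If its two exits coincide in a
  vertex of degree 3, the diamonds passed so far form a 2-necklace, and the loss could never be
  repaired; this is where the hypothesis enters. The blossom plays the same part at the very start,
  at a free vertex of degree 2.\<close>

text \<open>Both orientations are stored, so \<open>card F\<close> is twice the number of edges.
  Each insertion joins two different components, so acyclicity is expressed without cycles.\<close>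

inductive uforest :: "'a rel \<Rightarrow> bool" where
  empty: "uforest {}"
| edge: "uforest F \<Longrightarrow> (u, v) \<notin> F\<^sup>* \<Longrightarrow> uforest (insert (u, v) (insert (v, u) F))"

lemma uforest_sym: "uforest F \<Longrightarrow> sym F"
  by (induction rule: uforest.induct) (auto simp: sym_def)

lemma uforest_finite: "uforest F \<Longrightarrow> finite F"
  by (induction rule: uforest.induct) auto

lemma uforest_irrefl: "uforest F \<Longrightarrow> (u, u) \<notin> F"
  by (induction rule: uforest.induct) auto

lemma rtrancl_insert_edge:
  assumes "(x, y) \<in> (insert (p, q) (insert (q, p) R))\<^sup>*"
  shows "(x, y) \<in> R\<^sup>* \<or> (x, p) \<in> R\<^sup>* \<and> (q, y) \<in> R\<^sup>* \<or> (x, q) \<in> R\<^sup>* \<and> (p, y) \<in> R\<^sup>*"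
  using assms
proof (induction rule: rtrancl_induct)
  case (step y z)
  from step.hyps(2) consider "(y, z) \<in> R" | "y = p" "z = q" | "y = q" "z = p" by auto
  then show ?case
  proof cases
    case 1
    have ext: "(w, y) \<in> R\<^sup>* \<Longrightarrow> (w, z) \<in> R\<^sup>*" for w using 1 by (rule rtrancl_into_rtrancl[rotated])
    from step.IH ext[of x] ext[of q] ext[of p] show ?thesis by blast
  qed (use step.IH in blast)+
qed blast

lemma sym_rtranclD: "sym R \<Longrightarrow> (x, y) \<in> R\<^sup>* \<Longrightarrow> (y, x) \<in> R\<^sup>*"
  by (meson sym_rtrancl symD)

lemma uforest_attach:
  assumes "uforest F" "F \<subseteq> X \<times> X" "z \<notin> X" "v \<noteq> z"
  shows "uforest (insert (v, z) (insert (z, v) F))"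
proof (rule uforest.edge[OF assms(1)])
  show "(v, z) \<notin> F\<^sup>*"
  proof
    assume "(v, z) \<in> F\<^sup>*"
    with assms(4) obtain y where "(y, z) \<in> F" by (meson rtranclE)
    with assms show False by auto
  qed
qed

lemma uforest_attach_set:
  assumes F: "uforest F" "F \<subseteq> X \<times> X" and v: "v \<in> X" and S: "finite S" "S \<inter> X = {}"
  shows "uforest (F \<union> {v} \<times> S \<union> S \<times> {v})"
  using S
proof (induction S rule: finite_induct)
  case (insert z S)
  have "uforest (insert (v, z) (insert (z, v) (F \<union> {v} \<times> S \<union> S \<times> {v})))"
    by (rule uforest_attach[where X = "X \<union> S"]) (use insert F v in auto)
  then show ?case by (rule back_subst[of uforest]) auto
qed (use F in simp)

lemma uforest_Un:
  assumes "uforest F" "uforest F'" "F \<subseteq> X \<times> X" "F' \<subseteq> Y \<times> Y" "X \<inter> Y = {}"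
  shows "uforest (F \<union> F')"
  using assms(2,4)
proof (induction rule: uforest.induct)
  case (edge F' u v)
  have "(u, w) \<in> F'\<^sup>* \<and> w \<notin> X" if "(u, w) \<in> (F \<union> F')\<^sup>*" for w
    using that
  proof (induction rule: rtrancl_induct)
    case base
    with edge.prems assms(5) show ?case by auto
  next
    case (step y z)
    then have "(y, z) \<in> F'" "z \<notin> X" using edge.prems assms(3,5) by auto
    with step.IH show ?case by (metis rtrancl_into_rtrancl)
  qed
  with edge.hyps have "(u, v) \<notin> (F \<union> F')\<^sup>*" by blast
  from uforest.edge[OF edge.IH this] edge.prems show ?case by simp
qed (use assms(1) in simp)

lemma uforest_extend:
  assumes "finite E" "sym E" "uforest F" "F \<subseteq> E"
  shows "\<exists>F'. uforest F' \<and> F \<subseteq> F' \<and> F' \<subseteq> E \<and> E \<subseteq> F'\<^sup>*"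
  using assms(3,4)
proof (induction "card (E - F)" arbitrary: F rule: less_induct)
  case less
  show ?case
  proof (cases "E \<subseteq> F\<^sup>*")
    case False
    then obtain u v where uv: "(u, v) \<in> E" "(u, v) \<notin> F\<^sup>*" by auto
    let ?F = "insert (u, v) (insert (v, u) F)"
    have sub: "?F \<subseteq> E" using uv(1) less.prems(2) assms(2) by (auto dest: symD)
    have "E - ?F \<subset> E - F" using uv by auto
    then have "card (E - ?F) < card (E - F)" using assms(1) by (intro psubset_card_mono) auto
    from less.hyps[OF this uforest.edge[OF less.prems(1) uv(2)] sub]
    obtain F' where "uforest F' \<and> ?F \<subseteq> F' \<and> F' \<subseteq> E \<and> E \<subseteq> F'\<^sup>*" by (rule exE)
    then show ?thesis by (intro exI[of _ F']) simp
  next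
    case True
    with less.prems show ?thesis by (intro exI[of _ F]) simp
  qed
qed

text \<open>The induction carries a set \<open>A\<close> with one representative per component. Each
  insertion uses up one representative and adds two arcs, so \<open>card F + 2 * card A\<close> is
  constant.\<close>

lemma uforest_card:
  assumes "uforest F" "F \<subseteq> V \<times> V" "finite V" "V \<noteq> {}"
  shows "card F + 2 \<le> 2 * card V"
proof -
  have "\<exists>A \<subseteq> V. (\<forall>v\<in>V. \<exists>a\<in>A. (v, a) \<in> F\<^sup>*) \<and> (\<forall>a\<in>A. \<forall>b\<in>A. (a, b) \<in> F\<^sup>* \<longrightarrow> a = b) \<and>
      card F + 2 * card A = 2 * card V"
    using assms(1,2)
  proof (induction rule: uforest.induct)
    case empty
    show ?case by (rule exI[of _ V]) auto
  next
    case (edge F u v)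
    let ?F = "insert (u, v) (insert (v, u) F)"
    from edge.IH edge.prems obtain A where A: "A \<subseteq> V" "\<And>v. v \<in> V \<Longrightarrow> \<exists>a\<in>A. (v, a) \<in> F\<^sup>*"
        "\<And>a b. a \<in> A \<Longrightarrow> b \<in> A \<Longrightarrow> (a, b) \<in> F\<^sup>* \<Longrightarrow> a = b" "card F + 2 * card A = 2 * card V"
      by (metis (no_types, lifting) insert_subset)
    have sF: "sym F" using edge.hyps(1) by (rule uforest_sym)
    note symF = sym_rtranclD[OF sF]
    obtain p q where p: "p \<in> A" "(u, p) \<in> F\<^sup>*" and q: "q \<in> A" "(v, q) \<in> F\<^sup>*"
      using A(2)[of u] A(2)[of v] edge.prems by auto
    have uvF: "(u, v) \<notin> F" "(v, u) \<notin> F" "u \<noteq> v" using edge.hyps(2) symF by blast+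
    have pq: "p \<noteq> q" using p q edge.hyps(2) symF by (meson rtrancl_trans)
    have mono: "F\<^sup>* \<subseteq> ?F\<^sup>*" by (rule rtrancl_mono) auto
    have "card ?F = card F + 2" using uvF uforest_finite[OF edge.hyps(1)] by simp
    moreover have "card A = Suc (card (A - {q}))"
      using q A(1) assms(3) by (metis card_Suc_Diff1 finite_subset)
    ultimately have "card ?F + 2 * card (A - {q}) = 2 * card V" using A(4) by simp
    moreover have "\<exists>a\<in>A - {q}. (w, a) \<in> ?F\<^sup>*" if w: "w \<in> V" for w
    proof -
      obtain a where a: "a \<in> A" "(w, a) \<in> F\<^sup>*" using A(2)[OF w] by blast
      show ?thesis
      proof (cases "a = q")
        case True
        have "(w, v) \<in> F\<^sup>*" using a q True symF by (meson rtrancl_trans)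
        then have "(w, v) \<in> ?F\<^sup>*" using mono by blast
        also have "(v, u) \<in> ?F" by simp
        also have "(u, p) \<in> ?F\<^sup>*" using p mono by blast
        finally show ?thesis using p pq by blast
      qed (use a mono in blast)
    qed
    moreover have "a = b" if "a \<in> A - {q}" "b \<in> A - {q}" "(a, b) \<in> ?F\<^sup>*" for a b
    proof -
      have "(a, b) \<in> F\<^sup>* \<or> (a, v) \<in> F\<^sup>* \<or> (v, b) \<in> F\<^sup>*"
        using rtrancl_insert_edge[OF that(3)] by blast
      then have "(a, b) \<in> F\<^sup>* \<or> (a, q) \<in> F\<^sup>* \<or> (q, b) \<in> F\<^sup>*"
        using q symF by (meson rtrancl_trans)
      then show ?thesis using A(3)[of a b] A(3)[of a q] A(3)[of q b] that q by blast
    qed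
    ultimately show ?case using A(1) by (intro exI[of _ "A - {q}"]) blast
  qed
  then obtain A where A: "A \<subseteq> V" "\<forall>v\<in>V. \<exists>a\<in>A. (v, a) \<in> F\<^sup>*" "card F + 2 * card A = 2 * card V" by blast
  from A(2) assms(4) have "A \<noteq> {}" by blast
  with A(1) assms(3) have "card A \<ge> 1" by (simp add: Suc_leI card_gt_0_iff finite_subset)
  with A(3) show ?thesis by simp
qed

text \<open>If \<open>uv\<close> is not the edge inserted last, a walk around it either avoids the
  last edge, against the induction hypothesis, or together with \<open>uv\<close> connects the ends
  \<open>p\<close> and \<open>q\<close> of the last edge within \<open>F\<close>.\<close>

lemma uforest_bridge:
  assumes "uforest F" "(u, v) \<in> F"
  shows "(u, v) \<notin> (F - {(u, v), (v, u)})\<^sup>*"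
  using assms
proof (induction rule: uforest.induct)
  case (edge F p q)
  note symF = sym_rtranclD[OF uforest_sym[OF edge.hyps(1)]]
  show ?case
  proof (cases "{(u, v), (v, u)} \<inter> {(p, q), (q, p)} = {}")
    case True
    then have uvF: "(u, v) \<in> F" using edge.prems by auto
    let ?R = "F - {(u, v), (v, u)}"
    have eq: "insert (p, q) (insert (q, p) F) - {(u, v), (v, u)} = insert (p, q) (insert (q, p) ?R)"
      using True by auto
    have sub: "?R\<^sup>* \<subseteq> F\<^sup>*" by (rule rtrancl_mono) auto
    show ?thesis
    proof
      assume "(u, v) \<in> (insert (p, q) (insert (q, p) F) - {(u, v), (v, u)})\<^sup>*"
      from rtrancl_insert_edge[OF this[unfolded eq]]
      have "(u, p) \<in> F\<^sup>* \<and> (q, v) \<in> F\<^sup>* \<or> (u, q) \<in> F\<^sup>* \<and> (p, v) \<in> F\<^sup>*"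
        using edge.IH[OF uvF] sub by blast
      then have "(p, q) \<in> F\<^sup>*"
        using uvF symF by (meson r_into_rtrancl rtrancl_trans)
      with edge.hyps show False by blast
    qed
  next
    case False
    then have eq: "insert (p, q) (insert (q, p) F) - {(u, v), (v, u)} \<subseteq> F" by auto
    from False have "(u, v) = (p, q) \<or> (u, v) = (q, p)" by auto
    then show ?thesis using edge.hyps(2) symF rtrancl_mono[OF eq] by blast
  qed
qed simp

section \<open>Excess and the number of leaves\<close>

text \<open>Truncated subtraction lets isolated vertices and leaves count 0, which makes the excess
  monotone in the forest.\<close>

definition excess :: "'a set \<Rightarrow> 'a rel \<Rightarrow> nat" where
  "excess W F = (\<Sum>v\<in>W. card (F `` {v}) - 2)"

lemma excess_mono:
  assumes "F \<subseteq> F'" "finite F'"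
  shows "excess W F \<le> excess W F'"
  unfolding excess_def
proof (rule sum_mono)
  fix v
  have "card (F `` {v}) \<le> card (F' `` {v})"
    by (rule card_mono) (use assms in \<open>auto intro: finite_Image\<close>)
  then show "card (F `` {v}) - 2 \<le> card (F' `` {v}) - 2" by simp
qed

lemma card_eq_sum_degrees:
  assumes "F \<subseteq> V \<times> V" "finite V"
  shows "card F = (\<Sum>v\<in>V. card (F `` {v}))"
proof -
  have eq: "F = (SIGMA v:V. F `` {v})" using assms by auto
  have "finite F" using assms by (meson finite_SigmaI finite_subset)
  then have "\<forall>v\<in>V. finite (F `` {v})" by (simp add: finite_Image)
  have "card F = card (SIGMA v:V. F `` {v})" by (rule arg_cong[OF eq])
  also have "\<dots> = (\<Sum>v\<in>V. card (F `` {v}))" by (rule card_SigmaI) fact+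
  finally show ?thesis .
qed

text \<open>Handshaking: for degree at least 1, \<open>(deg - 2) + 2\<close> is at most
  \<open>deg\<close>, plus 1 at a leaf, and the degrees add up to at most
  \<open>2 * card V - 2\<close>.\<close>

lemma uforest_leaves:
  assumes "uforest F" "F \<subseteq> V \<times> V" "finite V" "V \<noteq> {}" "W \<subseteq> V"
    and deg: "\<And>v. v \<in> V \<Longrightarrow> F `` {v} \<noteq> {}"
  shows "excess W F + 2 \<le> card {v \<in> V. card (F `` {v}) = 1}"
proof -
  have fin: "finite (F `` {v})" for v using uforest_finite[OF assms(1)] by (auto intro: finite_Image)
  have "excess W F \<le> (\<Sum>v\<in>V. card (F `` {v}) - 2)"
    unfolding excess_def by (rule sum_mono2) (use assms in auto)
  then have "excess W F + 2 * card V \<le> (\<Sum>v\<in>V. (card (F `` {v}) - 2) + 2)"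
    by (simp add: sum.distrib del: add_2_eq_Suc add_2_eq_Suc')
  also have "\<dots> \<le> (\<Sum>v\<in>V. card (F `` {v}) + (if card (F `` {v}) = 1 then 1 else 0))"
  proof (rule sum_mono)
    fix v assume "v \<in> V"
    then have "card (F `` {v}) \<ge> 1" using deg fin by (simp add: Suc_leI card_gt_0_iff)
    then show "card (F `` {v}) - 2 + 2 \<le> card (F `` {v}) + (if card (F `` {v}) = 1 then 1 else 0)"
      by auto
  qed
  also have "\<dots> = card F + card {v \<in> V. card (F `` {v}) = 1}"
    using assms(3) by (simp add: sum.distrib card_eq_sum_degrees[OF assms(2,3)] sum.If_cases Int_def)
  finally show ?thesis using uforest_card[OF assms(1-4)] by linarith
qed

subsection \<open>Growing forests and their potential\<close>

locale wgraph =
  fixes V :: "'a set" and E :: "'a rel" and W :: "'a set"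
  assumes finite_V: "finite V" and E_sub: "E \<subseteq> V \<times> V" and sym_E: "sym E"
    and irrefl_E: "(v, v) \<notin> E" and W_sub: "W \<subseteq> V"
    and deg_W: "w \<in> W \<Longrightarrow> 3 \<le> card (E `` {w})"
    and deg_free: "v \<in> V - W \<Longrightarrow> card (E `` {v}) \<le> 3"
begin

lemma E_sym: "(u, v) \<in> E \<Longrightarrow> (v, u) \<in> E"
  using sym_E by (rule symD)

lemma E_V: "(u, v) \<in> E \<Longrightarrow> u \<in> V \<and> v \<in> V"
  using E_sub by auto

lemma finite_E: "finite E"
  using finite_V E_sub by (meson finite_SigmaI finite_subset)

lemma finite_N [simp]: "finite (E `` S)"
  using finite_E by (rule finite_Image)

text \<open>
  A live leaf is charged 1 more because it may still become an inner vertex of degree 2; a free vertex,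
  which never counts, is charged for its edges one by one.
\<close>

definition cost :: "'a set \<Rightarrow> 'a \<Rightarrow> int" where
  "cost X d = (if d \<in> W then if E `` {d} \<inter> W \<subseteq> X then 2 else 3 else int (card (E `` {d} \<inter> W - X)))"

definition potential :: "'a set \<Rightarrow> nat \<Rightarrow> int" where
  "potential X m = 6 * int m - (\<Sum>d\<in>X. cost X d)"

text \<open>The forest on \<open>X\<close> may be disconnected, and \<open>m\<close> is only a lower
  bound for its excess. Counted vertices of \<open>X\<close> must already have an edge, so that
  \<open>n\<close> new edges at one of them gain at least \<open>n - 1\<close>. A free vertex may be
  isolated, which allows the start \<open>{f}\<close>.\<close>

definition state :: "'a set \<Rightarrow> nat \<Rightarrow> bool" where
  "state X m \<longleftrightarrow> X \<subseteq> V \<and>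
     (\<exists>F. uforest F \<and> F \<subseteq> E \<and> F \<subseteq> X \<times> X \<and> (\<forall>v\<in>X \<inter> W. F `` {v} \<noteq> {}) \<and> m \<le> excess W F)"

lemma state_V: "state X m \<Longrightarrow> X \<subseteq> V"
  by (simp add: state_def)

lemma state_finite: "state X m \<Longrightarrow> finite X"
  using state_V finite_V finite_subset by blast

lemma finite_W: "finite W"
  using W_sub finite_V finite_subset by blast

lemma state_single: "f \<in> V - W \<Longrightarrow> state {f} 0"
  unfolding state_def by (auto intro: uforest.empty exI[of _ "{}"])

lemma state_attach:
  assumes "state X m" "v \<in> X" "(v, z) \<in> E" "z \<notin> X"
  shows "state (insert z X) m"
proof -
  obtain F where F: "uforest F" "F \<subseteq> E" "F \<subseteq> X \<times> X" "\<forall>v\<in>X \<inter> W. F `` {v} \<noteq> {}" "m \<le> excess W F"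
    using assms(1) unfolding state_def by blast
  let ?F = "insert (v, z) (insert (z, v) F)"
  have f: "uforest ?F" using assms(2,4) by (intro uforest_attach[OF F(1,3) assms(4)]) blast
  moreover have "m \<le> excess W ?F"
    using F(5) excess_mono[of F ?F W] uforest_finite[OF f] by (meson le_trans subset_insertI2 subset_refl)
  moreover have "\<forall>u\<in>insert z X \<inter> W. ?F `` {u} \<noteq> {}" using F(4) by blast
  moreover have "?F \<subseteq> E" using F(2) assms(3) E_sym by blast
  moreover have "?F \<subseteq> insert z X \<times> insert z X" using F(3) assms(2) by blast
  moreover have "insert z X \<subseteq> V" using state_V[OF assms(1)] E_V[OF assms(3)] by blast
  ultimately show ?thesis unfolding state_def by blast
qed

lemma state_expand:
  assumes "state X m" "v \<in> X" "v \<in> W" "S \<subseteq> E `` {v} - X" "S \<noteq> {}"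
  shows "state (X \<union> S) (m + card S - 1)"
proof -
  obtain F where F: "uforest F" "F \<subseteq> E" "F \<subseteq> X \<times> X" "\<forall>v\<in>X \<inter> W. F `` {v} \<noteq> {}" "m \<le> excess W F"
    using assms(1) unfolding state_def by blast
  have S: "finite S" "S \<inter> X = {}" using assms(4) finite_subset[of S "E `` {v}"] by auto
  let ?F = "F \<union> {v} \<times> S \<union> S \<times> {v}"
  have f: "uforest ?F" by (rule uforest_attach_set[OF F(1,3) assms(2) S])
  have fin: "finite (F `` {u})" for u using uforest_finite[OF F(1)] by (rule finite_Image)
  have fin': "finite (?F `` {u})" for u using uforest_finite[OF f] by (rule finite_Image)
  have "?F `` {v} = F `` {v} \<union> S" using S(2) assms(2) by auto
  moreover have "F `` {v} \<inter> S = {}" using S(2) F(3) by auto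
  ultimately have cv: "card (?F `` {v}) = card (F `` {v}) + card S"
    using fin S(1) by (simp add: card_Un_disjoint)
  have dv: "card (F `` {v}) \<ge> 1" using F(4) assms(2,3) fin by (simp add: Suc_leI card_gt_0_iff)
  have "excess W F + (card S - 1) \<le> excess W ?F"
  proof -
    have le: "card (F `` {u}) - 2 \<le> card (?F `` {u}) - 2" for u
      by (rule diff_le_mono, rule card_mono[OF fin']) auto
    have "(\<Sum>u\<in>W - {v}. card (F `` {u}) - 2) \<le> (\<Sum>u\<in>W - {v}. card (?F `` {u}) - 2)"
      by (rule sum_mono) (rule le)
    moreover have "card (F `` {v}) - 2 + (card S - 1) \<le> card (?F `` {v}) - 2" using cv dv by linarith
    ultimately show ?thesis
      unfolding excess_def using sum.remove[OF finite_W assms(3)] by (smt (verit) add.commute add.left_commute add_mono)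
  qed
  moreover have "card S \<ge> 1" using S(1) assms(5) by (simp add: Suc_leI card_gt_0_iff)
  ultimately have "m + card S - 1 \<le> excess W ?F" using F(5) by linarith
  moreover have "\<forall>u\<in>(X \<union> S) \<inter> W. ?F `` {u} \<noteq> {}" using F(4) by blast
  moreover have "?F \<subseteq> E" using F(2) assms(4) E_sym by blast
  moreover have "?F \<subseteq> (X \<union> S) \<times> (X \<union> S)" using F(3) assms(2) by blast
  moreover have "X \<union> S \<subseteq> V" using state_V[OF assms(1)] assms(4) E_V by blast
  ultimately show ?thesis unfolding state_def using f by blast
qed

lemma state_star:
  assumes "w \<in> W"
  shows "state (insert w (E `` {w})) (card (E `` {w}) - 2)"
proof -
  let ?S = "E `` {w}"
  let ?F = "{} \<union> {w} \<times> ?S \<union> ?S \<times> {w}"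
  have w: "w \<notin> ?S" using irrefl_E by auto
  have f: "uforest ?F" by (rule uforest_attach_set[where X = "{w}"]) (use w in \<open>auto intro: uforest.empty\<close>)
  have "?F `` {w} = ?S" using w by auto
  then have "card ?S - 2 = card (?F `` {w}) - 2" by simp
  also have "\<dots> \<le> excess W ?F"
    unfolding excess_def using assms finite_W by (intro member_le_sum) auto
  finally have "card ?S - 2 \<le> excess W ?F" .
  moreover have "?S \<noteq> {}" using deg_W[OF assms] by auto
  then have "\<forall>u\<in>insert w ?S \<inter> W. ?F `` {u} \<noteq> {}" by auto
  moreover have "?F \<subseteq> E" using E_sym by blast
  moreover have "?F \<subseteq> insert w ?S \<times> insert w ?S" by blast
  moreover have "insert w ?S \<subseteq> V" using assms W_sub E_V by blast
  ultimately show ?thesis unfolding state_def using f by blast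
qed

section \<open>How charges change as the set grows\<close>

lemma cost_W: "d \<in> W \<Longrightarrow> 2 \<le> cost X d \<and> cost X d \<le> 3"
  by (simp add: cost_def)

lemma cost_dead: "d \<in> W \<Longrightarrow> E `` {d} \<inter> W \<subseteq> X \<Longrightarrow> cost X d = 2"
  by (simp add: cost_def)

lemma cost_live: "d \<in> W \<Longrightarrow> \<not> E `` {d} \<inter> W \<subseteq> X \<Longrightarrow> cost X d = 3"
  by (simp add: cost_def)

lemma cost_antimono: "X \<subseteq> Z \<Longrightarrow> cost Z d \<le> cost X d"
  unfolding cost_def by (auto intro!: card_mono)

lemma cost_free:
  assumes "d \<in> V - W" "x \<in> X" "(x, d) \<in> E"
  shows "cost X d \<le> 2"
proof -
  have "card (E `` {d} \<inter> W - X) \<le> card (E `` {d} - {x})"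
    by (rule card_mono) (use assms in auto)
  also have "\<dots> = card (E `` {d}) - 1" using E_sym[OF assms(3)] by simp
  also have "\<dots> \<le> 2" using deg_free[OF assms(1)] by simp
  finally show ?thesis using assms(1) by (simp add: cost_def)
qed

lemma cost_le3: "x \<in> X \<Longrightarrow> (x, d) \<in> E \<Longrightarrow> cost X d \<le> 3"
  using cost_W[of d X] cost_free[of d x X] E_V[of x d] by fastforce

text \<open>Absorbing one counted neighbour removes one charged edge of a free vertex. For a counted
  vertex no live neighbour may be left, since its surcharge of 1 does not depend on their
  number.\<close>

lemma cost_drop:
  assumes "X \<subseteq> Z" "(d, z) \<in> E" "z \<in> W" "z \<notin> X" "z \<in> Z" "d \<in> W \<Longrightarrow> E `` {d} \<inter> W \<subseteq> Z"
  shows "cost Z d + 1 \<le> cost X d"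
proof (cases "d \<in> W")
  case True
  then show ?thesis using assms by (auto simp: cost_def)
next
  case False
  have "card (E `` {d} \<inter> W - Z) < card (E `` {d} \<inter> W - X)"
    by (rule psubset_card_mono) (use assms in auto)
  then show ?thesis using False by (simp add: cost_def)
qed

text \<open>\<open>c\<close> is the vertex from which the step is made, and \<open>K\<close>
  collects other vertices of \<open>X\<close> known to become cheaper; all remaining old charges can
  only fall.\<close>

lemma potential_step:
  assumes XZ: "X \<subseteq> Z" "finite Z" and c: "c \<in> X" and K: "K \<subseteq> X - {c}"
    and drop: "\<And>d. d \<in> K \<Longrightarrow> cost Z d + 1 \<le> cost X d"
  shows "potential Z m' \<ge> potential X m + 6 * (int m' - int m) + (cost X c - cost Z c) + int (card K)
           - (\<Sum>d\<in>Z - X. cost Z d)"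
proof -
  have finX: "finite X" using XZ finite_subset by blast
  then have finK: "finite K" using K finite_subset by blast
  have "(\<Sum>d\<in>X - {c} - K. cost Z d) \<le> (\<Sum>d\<in>X - {c} - K. cost X d)"
    by (rule sum_mono) (rule cost_antimono[OF XZ(1)])
  moreover have "(\<Sum>d\<in>K. cost Z d + 1) \<le> (\<Sum>d\<in>K. cost X d)"
    by (rule sum_mono) (rule drop)
  then have "(\<Sum>d\<in>K. cost Z d) + int (card K) \<le> (\<Sum>d\<in>K. cost X d)"
    by (simp add: sum.distrib)
  moreover have "(\<Sum>d\<in>X. g d) = g c + (\<Sum>d\<in>X - {c} - K. g d) + (\<Sum>d\<in>K. g d)" for g :: "'a \<Rightarrow> int"
    using sum.remove[OF finX c, of g] sum.subset_diff[OF K, of g] finX by simp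
  moreover have "(\<Sum>d\<in>Z. cost Z d) = (\<Sum>d\<in>Z - X. cost Z d) + (\<Sum>d\<in>X. cost Z d)"
    using XZ sum.subset_diff by metis
  ultimately show ?thesis unfolding potential_def by (smt (verit))
qed

text \<open>\<open>r\<close> is the balance with \<open>c\<close> already charged as dead, before
  its children are entered. Then \<open>s\<close> children bring \<open>6 * (s - 1)\<close>, from at
  least \<open>s - 1\<close> new units of excess, and cost their own charges.\<close>

lemma expand_step:
  assumes st: "state Y m" and c: "c \<in> Y" "c \<in> W" and S: "S = E `` {c} - Y" "S \<noteq> {}"
    and K: "K \<subseteq> Y - {c}" "\<And>d. d \<in> K \<Longrightarrow> cost (Y \<union> S) d + 1 \<le> cost Y d"
    and r: "potential Y m + cost Y c - 2 \<ge> r"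
  shows "state (Y \<union> S) (m + card S - 1)"
    and "potential (Y \<union> S) (m + card S - 1) \<ge> r + 6 * (int (card S) - 1) + int (card K)
           - (\<Sum>d\<in>S. cost (Y \<union> S) d)"
proof -
  show st': "state (Y \<union> S) (m + card S - 1)"
    by (rule state_expand[OF st c]) (use S in auto)
  have dead: "cost (Y \<union> S) c = 2" using c(2) S(1) by (intro cost_dead) auto
  have "Y \<union> S - Y = S" using S(1) by auto
  moreover have "card S \<ge> 1" using S by (simp add: Suc_leI card_gt_0_iff)
  then have "int (m + card S - 1) - int m = int (card S) - 1" by linarith
  ultimately show "potential (Y \<union> S) (m + card S - 1) \<ge> r + 6 * (int (card S) - 1) + int (card K)
           - (\<Sum>d\<in>S. cost (Y \<union> S) d)"
    using potential_step[OF _ state_finite[OF st'] c(1) K, of m "m + card S - 1"] r dead by auto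
qed

lemma sum_cost_children:
  assumes "S \<subseteq> E `` {c}" "c \<in> Z"
  shows "(\<Sum>d\<in>S. cost Z d) \<le> 3 * int (card S)"
proof -
  have "(\<Sum>d\<in>S. cost Z d) \<le> (\<Sum>d\<in>S. 3)"
    by (rule sum_mono) (use assms cost_le3 in blast)
  then show ?thesis by simp
qed

lemma expand_many:
  assumes st: "state Y m" and c: "c \<in> Y" "c \<in> W" and S: "E `` {c} - Y \<noteq> {}"
    and r: "potential Y m + cost Y c - 2 \<ge> r"
  shows "\<exists>Z m'. state Z m' \<and> Y \<subset> Z \<and> potential Z m' \<ge> r + 3 * int (card (E `` {c} - Y)) - 6"
proof -
  let ?S = "E `` {c} - Y"
  note * = expand_step[OF st c refl S, of "{}", OF _ _ r]
  have "(\<Sum>d\<in>?S. cost (Y \<union> ?S) d) \<le> 3 * int (card ?S)"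
    by (rule sum_cost_children) (use c in auto)
  with * S show ?thesis
    by (intro exI[of _ "Y \<union> ?S"] exI[of _ "m + card ?S - 1"]) auto
qed

text \<open>With children of cost at most 3, \<open>6 * (s - 1) - 3 * s = 3 * s - 6\<close>; the
  expanded leaf itself falls from 3 to 2. So two children already gain 1.\<close>

lemma grow_branching:
  assumes "state X m" "d \<in> X" "d \<in> W" "\<not> E `` {d} \<inter> W \<subseteq> X"
  shows "\<exists>Z m'. state Z m' \<and> X \<subset> Z \<and> potential Z m' \<ge> potential X m + 3 * int (card (E `` {d} - X)) - 5"
  using expand_many[OF assms(1-3), of "potential X m + 1"] assms(4) cost_live[OF assms(3,4)] by auto

text \<open>No excess is gained, but each neighbour of \<open>z\<close> in \<open>X\<close> becomes
  cheaper by at least 1; for counted ones this is due to \<open>single\<close>, as \<open>z\<close>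
  is their only exit. Three neighbours pay for \<open>z\<close>, two lose at most 1, one loses at
  most 2.\<close>

lemma attach_step:
  assumes st: "state X m" and z: "z \<in> W" "z \<notin> X" "E `` {z} \<inter> X \<noteq> {}"
    and single: "\<And>d. d \<in> X \<Longrightarrow> d \<in> W \<Longrightarrow> (d, z) \<in> E \<Longrightarrow> E `` {d} - X = {z}"
  shows "state (insert z X) m"
    and "potential (insert z X) m \<ge> potential X m + int (card (E `` {z} \<inter> X)) - cost (insert z X) z"
proof -
  obtain v where v: "v \<in> X" "(v, z) \<in> E" using z(3) E_sym by auto
  show st': "state (insert z X) m" by (rule state_attach[OF st v z(2)])
  have drop: "cost (insert z X) d + 1 \<le> cost X d" if "d \<in> E `` {z} \<inter> X" for d
    by (rule cost_drop[of _ _ _ z]) (use that z single E_sym in auto)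
  have vK: "v \<in> E `` {z} \<inter> X" using v E_sym by auto
  then have K: "card (E `` {z} \<inter> X) = Suc (card (E `` {z} \<inter> X - {v}))"
    by (subst card_Suc_Diff1) auto
  have "insert z X - X = {z}" using z(2) by auto
  then show "potential (insert z X) m \<ge> potential X m + int (card (E `` {z} \<inter> X)) - cost (insert z X) z"
    using potential_step[OF _ state_finite[OF st'] v(1), of "E `` {z} \<inter> X - {v}" m m] drop[of v] drop K vK
    by fastforce
qed

end

subsection \<open>Chains of diamonds, clusters and buds\<close>

text \<open>
  In \<open>neck E W x u c A P\<close>, the set \<open>A \<union> {c}\<close> induces a chain of diamonds from \<open>u\<close> to \<open>c\<close>, where \<open>x\<close> is the
  neighbour through which \<open>u\<close> is entered, and \<open>P\<close> are the neighbours of \<open>c\<close> on the side of \<open>u\<close>. The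
  chain may consist of \<open>u = c\<close> alone; then \<open>A = {}\<close> and \<open>P = {x}\<close>.
\<close>

inductive neck :: "'a rel \<Rightarrow> 'a set \<Rightarrow> 'a \<Rightarrow> 'a \<Rightarrow> 'a \<Rightarrow> 'a set \<Rightarrow> 'a set \<Rightarrow> bool"
  for E W x u where
  start: "u \<in> W \<Longrightarrow> (u, x) \<in> E \<Longrightarrow> x \<noteq> u \<Longrightarrow> neck E W x u u {} {x}"
| step: "neck E W x u c A P \<Longrightarrow> E `` {c} = P \<union> {a, b} \<Longrightarrow> a \<noteq> b \<Longrightarrow> a \<in> W \<Longrightarrow> b \<in> W \<Longrightarrow> g \<in> W \<Longrightarrow>
    E `` {a} = {c, b, g} \<Longrightarrow> E `` {b} = {c, a, g} \<Longrightarrow> {a, b, g} \<inter> insert x (insert c A) = {} \<Longrightarrow>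
    neck E W x u g (A \<union> {c, a, b}) {a, b}"

text \<open>A chain of diamonds (possibly none) followed by a triangle \<open>c p r\<close>, with distinct exits \<open>p'\<close> and \<open>r'\<close>.\<close>

definition cluster :: "'a rel \<Rightarrow> 'a set \<Rightarrow> 'a \<Rightarrow> 'a \<Rightarrow> 'a \<Rightarrow> 'a set \<Rightarrow> 'a set \<Rightarrow> 'a \<Rightarrow> 'a \<Rightarrow> 'a \<Rightarrow> 'a \<Rightarrow> bool" where
  "cluster E W x u c A P p r p' r' \<longleftrightarrow> neck E W x u c A P \<and> E `` {c} = P \<union> {p, r} \<and> p \<noteq> r \<and> p \<in> W \<and> r \<in> W \<and>
     E `` {p} = {c, r, p'} \<and> E `` {r} = {c, p, r'} \<and> p' \<noteq> r' \<and> p' \<noteq> r \<and> r' \<noteq> p \<and>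
     {p, r, p', r'} \<inter> insert x (insert c A) = {}"

text \<open>
  A blossom without its vertex \<open>c\<^sub>2\<close>: the names \<open>y, a, b, c, d, e\<close> stand for \<open>c\<^sub>1, x\<^sub>1, x\<^sub>2, b, y\<^sub>1, y\<^sub>2\<close>. For
  \<open>d' = e'\<close> it is a blossom.
\<close>

definition bud :: "'a rel \<Rightarrow> 'a set \<Rightarrow> 'a \<Rightarrow> 'a \<Rightarrow> 'a \<Rightarrow> 'a \<Rightarrow> 'a \<Rightarrow> 'a \<Rightarrow> 'a \<Rightarrow> 'a \<Rightarrow> 'a \<Rightarrow> bool" where
  "bud E W t y a b c d e d' e' \<longleftrightarrow> {y, a, b, c, d, e} \<subseteq> W \<and> distinct [y, a, b, c, d, e] \<and>
     E `` {y} = {t, a, b} \<and> E `` {a} = {y, c, d} \<and> E `` {b} = {y, c, e} \<and> E `` {c} = {a, b, d, e} \<and>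
     E `` {d} = {a, c, d'} \<and> E `` {e} = {b, c, e'} \<and> {t, d', e'} \<inter> {y, a, b, c, d, e} = {}"

text \<open>Both obstacles are expressed by neighbourhoods of counted vertices, so that they can be
  pulled back along contractions and deletions. The entry vertex of a nonempty chain has degree 3;
  in the given graph, an end \<open>c\<close> of degree 3 therefore makes the chain a 2-necklace. A
  bud with \<open>d' = e'\<close> of degree 3 is a 2-blossom there.\<close>

definition no_obstacle :: "'a rel \<Rightarrow> 'a set \<Rightarrow> bool" where
  "no_obstacle E W \<longleftrightarrow>
     (\<forall>x u c A P. neck E W x u c A P \<longrightarrow> A \<noteq> {} \<longrightarrow> card (E `` {c}) \<noteq> 3) \<and>
     (\<forall>t y a b c d e g. bud E W t y a b c d e g g \<longrightarrow> g \<in> W \<longrightarrow> card (E `` {g}) \<noteq> 3)"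

context wgraph
begin

text \<open>These invariants support each other in a single induction. They say that the chain meets
  the rest of the graph only in the edge \<open>ux\<close> and at its end \<open>c\<close>.\<close>

lemma neck_facts:
  assumes "neck E W x u c A P"
  shows "A \<subseteq> W" "c \<in> W" "c \<notin> A" "x \<notin> insert c A" "P \<subseteq> E `` {c}"
    "A = {} \<Longrightarrow> c = u \<and> P = {x}" "A \<noteq> {} \<Longrightarrow> P \<subseteq> A \<and> u \<in> A"
    "v \<in> A \<Longrightarrow> E `` {v} \<subseteq> insert x (insert c A)" "v \<in> A \<Longrightarrow> (v, x) \<in> E \<Longrightarrow> v = u"
    "v \<in> A \<Longrightarrow> (v, c) \<in> E \<Longrightarrow> v \<in> P" "u \<in> W" "(u, x) \<in> E"
proof -
  have "A \<subseteq> W \<and> c \<in> W \<and> c \<notin> A \<and> x \<notin> insert c A \<and> P \<subseteq> E `` {c} \<and> (A = {} \<longrightarrow> c = u \<and> P = {x}) \<and>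
    (A \<noteq> {} \<longrightarrow> P \<subseteq> A \<and> u \<in> A) \<and> (\<forall>v\<in>A. E `` {v} \<subseteq> insert x (insert c A)) \<and>
    (\<forall>v\<in>A. (v, x) \<in> E \<longrightarrow> v = u) \<and> (\<forall>v\<in>A. (v, c) \<in> E \<longrightarrow> v \<in> P) \<and> u \<in> W \<and> (u, x) \<in> E"
    using assms
  proof (induction rule: neck.induct)
    case start
    then show ?case by auto
  next
    case (step c A P a b g)
    let ?A = "A \<union> {c, a, b}"
    have gab: "g \<noteq> a" "g \<noteq> b" using step.hyps irrefl_E by (metis Image_singleton_iff insertCI)+
    have P: "P \<subseteq> insert x A" using step.IH by (cases "A = {}") auto
    have xP: "x \<in> P \<Longrightarrow> c = u" using step.IH by (cases "A = {}") auto
    have r1: "E `` {v} \<subseteq> insert x (insert g ?A)" if "v \<in> ?A" for v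
    proof -
      from that consider "v \<in> A" | "v = c" | "v = a" | "v = b" by auto
      then show ?thesis
      proof cases
        case 1
        then have "E `` {v} \<subseteq> insert x (insert c A)" using step.IH by blast
        then show ?thesis by blast
      next
        case 2
        then show ?thesis using step.hyps(2) P by blast
      qed (use step.hyps(7,8) in blast)+
    qed
    have r2: "v = u" if "v \<in> ?A" "(v, x) \<in> E" for v
    proof -
      from that(1) consider "v \<in> A" | "v = c" | "v = a" | "v = b" by auto
      then show ?thesis
      proof cases
        case 2
        then have "x \<in> P \<union> {a, b}" using that(2) step.hyps(2) by auto
        then show ?thesis using xP step.hyps(9) 2 by auto
      next
        case 3
        then have "x \<in> {c, b, g}" using that(2) step.hyps(7) by auto
        then show ?thesis using step.hyps(9) step.IH by auto
      next
        case 4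
        then have "x \<in> {c, a, g}" using that(2) step.hyps(8) by auto
        then show ?thesis using step.hyps(9) step.IH by auto
      qed (use that step.IH in blast)
    qed
    have r3: "v \<in> {a, b}" if "v \<in> ?A" "(v, g) \<in> E" for v
    proof (rule ccontr)
      assume "v \<notin> {a, b}"
      with that(1) consider "v \<in> A" | "v = c" by auto
      then show False
      proof cases
        case 1
        then have "g \<in> insert x (insert c A)" using that(2) step.IH by auto
        then show ?thesis using step.hyps(9) by auto
      next
        case 2
        then have "g \<in> P \<union> {a, b}" using that(2) step.hyps(2) by auto
        then show ?thesis using P gab step.hyps(9) by auto
      qed
    qed
    show ?case
    proof (intro conjI)
      show "{a, b} \<subseteq> E `` {g}" using step.hyps(7,8) E_sym by blast
      show "x \<notin> insert g ?A" using step.hyps(9) step.IH by blast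
      show "g \<notin> ?A" using step.hyps(9) gab by blast
      show "?A \<subseteq> W" using step.hyps(4,5) step.IH by blast
      show "u \<in> W" "(u, x) \<in> E" using step.IH by blast+
      show "g \<in> W" by (rule step.hyps(6))
      have "u \<in> ?A" using step.IH by (cases "A = {}") auto
      then show "?A \<noteq> {} \<longrightarrow> {a, b} \<subseteq> ?A \<and> u \<in> ?A" by simp
    qed (simp, intro ballI, erule r1, intro ballI impI, erule (1) r2, intro ballI impI, erule (1) r3)
  qed
  then show "A \<subseteq> W" "c \<in> W" "c \<notin> A" "x \<notin> insert c A" "P \<subseteq> E `` {c}"
    "A = {} \<Longrightarrow> c = u \<and> P = {x}" "A \<noteq> {} \<Longrightarrow> P \<subseteq> A \<and> u \<in> A"
    "v \<in> A \<Longrightarrow> E `` {v} \<subseteq> insert x (insert c A)" "v \<in> A \<Longrightarrow> (v, x) \<in> E \<Longrightarrow> v = u"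
    "v \<in> A \<Longrightarrow> (v, c) \<in> E \<Longrightarrow> v \<in> P" "u \<in> W" "(u, x) \<in> E"
    by blast+
qed

lemma N_eq_insert2:
  assumes w: "w \<in> W" and sub: "E `` {w} \<subseteq> {c, d, e}"
  shows "E `` {w} = {c, d, e} \<and> c \<noteq> d \<and> c \<noteq> e \<and> d \<noteq> e \<and> card (E `` {w}) = 3"
proof -
  have "card {c, d, e} \<le> 3" by (simp add: card_insert_if)
  then have eq: "E `` {w} = {c, d, e}"
    using card_seteq[OF _ sub] deg_W[OF w] by simp
  then have "3 \<le> card {c, d, e}" using deg_W[OF w] by simp
  then have "c \<noteq> d \<and> c \<noteq> e \<and> d \<noteq> e" by (auto simp: card_insert_if split: if_splits)
  then show ?thesis using eq by simp
qed

section \<open>Single exits and parity\<close>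

text \<open>This is the situation in which no live leaf can be expanded with a gain, for which two
  outer neighbours, counted or free, would suffice.\<close>

definition single_exits :: "'a set \<Rightarrow> bool" where
  "single_exits X \<longleftrightarrow> (\<forall>d\<in>X \<inter> W. \<not> E `` {d} \<inter> W \<subseteq> X \<longrightarrow> card (E `` {d} - X) = 1)"

lemma single_exitsD:
  assumes "single_exits X" "d \<in> X" "d \<in> W" "(d, z) \<in> E" "z \<in> W" "z \<notin> X"
  shows "E `` {d} - X = {z}"
proof -
  have "card (E `` {d} - X) = 1" using assms unfolding single_exits_def by blast
  then obtain y where y: "E `` {d} - X = {y}" by (meson card_1_singletonE)
  have "z \<in> E `` {d} - X" using assms by auto
  with y show ?thesis by auto
qed

text \<open>With single exits each vertex of \<open>X\<close> is charged, apart from an even amount,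
  exactly 1 per edge to a counted vertex outside \<open>X\<close>. Seen from outside, these edges
  come in pairs.\<close>

lemma even_potential:
  assumes X: "X \<subseteq> V" "single_exits X"
    and two: "\<And>z. z \<in> W - X \<Longrightarrow> E `` {z} \<inter> X \<noteq> {} \<Longrightarrow> card (E `` {z} \<inter> X) = 2"
  shows "even (potential X m)"
proof -
  have fin: "finite X" "finite (W - X)" using X finite_V finite_W finite_subset by auto
  have c: "cost X d = (if d \<in> W then 2 else 0) + int (card (E `` {d} \<inter> (W - X)))" if d: "d \<in> X" for d
  proof (cases "d \<in> W \<and> \<not> E `` {d} \<inter> W \<subseteq> X")
    case True
    then obtain z where z: "(d, z) \<in> E" "z \<in> W" "z \<notin> X" by auto
    have "E `` {d} \<inter> (W - X) = {z}" using single_exitsD[OF X(2) d _ z] True z by auto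
    with True show ?thesis by (simp add: cost_def)
  next
    case False
    have "E `` {d} \<inter> W - X = E `` {d} \<inter> (W - X)" by auto
    moreover have "d \<in> W \<Longrightarrow> E `` {d} \<inter> (W - X) = {}" using False by auto
    ultimately show ?thesis using False by (auto simp: cost_def)
  qed
  have cnt: "card (S \<inter> T) = (\<Sum>z\<in>T. if z \<in> S then 1 else 0)" if "finite T" for S T :: "'a set"
    using that by (simp add: sum.If_cases Int_commute)
  have "(\<Sum>d\<in>X. card (E `` {d} \<inter> (W - X))) = (\<Sum>d\<in>X. \<Sum>z\<in>W - X. if z \<in> E `` {d} then 1 else 0)"
    by (simp only: cnt[OF fin(2)])
  also have "\<dots> = (\<Sum>z\<in>W - X. \<Sum>d\<in>X. if z \<in> E `` {d} then 1 else 0)"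
    by (rule sum.swap)
  also have "\<dots> = (\<Sum>z\<in>W - X. \<Sum>d\<in>X. if d \<in> E `` {z} then 1 else 0)"
    by (intro sum.cong refl) (use E_sym in auto)
  also have "\<dots> = (\<Sum>z\<in>W - X. card (E `` {z} \<inter> X))"
    by (simp only: cnt[OF fin(1)])
  finally have swap: "(\<Sum>d\<in>X. card (E `` {d} \<inter> (W - X))) = (\<Sum>z\<in>W - X. card (E `` {z} \<inter> X))" .
  have "even (\<Sum>z\<in>W - X. card (E `` {z} \<inter> X))"
  proof (rule dvd_sum)
    fix z assume "z \<in> W - X"
    then show "even (card (E `` {z} \<inter> X))" using two[of z] by (cases "E `` {z} \<inter> X = {}") auto
  qed
  moreover have "(\<Sum>d\<in>X. cost X d) =
      (\<Sum>d\<in>X. if d \<in> W then 2 else 0) + int (\<Sum>d\<in>X. card (E `` {d} \<inter> (W - X)))"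
    by (simp add: c sum.distrib)
  moreover have "even (\<Sum>d\<in>X. if d \<in> W then 2 else 0 :: int)" by (rule dvd_sum) auto
  ultimately have "even (\<Sum>d\<in>X. cost X d)" by (simp only: swap even_add even_of_nat)
  then show ?thesis by (simp add: potential_def)
qed

end

text \<open>Neither contraction applies any more. Buds in which two of \<open>t\<close>,
  \<open>d'\<close>, \<open>e'\<close> coincide remain possible, since contracting them would create
  parallel edges; clusters have distinct outer neighbours by definition.\<close>

locale irreducible = wgraph +
  assumes no_cluster: "\<not> cluster E W x u c A P p r p' r'"
    and no_bud: "bud E W t y a b c d e d' e' \<Longrightarrow> d' = e' \<or> t = d' \<or> t = e'"
    and no_obstacle: "no_obstacle E W"
begin

text \<open>
  Entering a triangle costs 1. With distinct exits it would be a cluster, so it is half of a diamond,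
  whose far end has degree at least 4 and is entered next; this cannot stop at an end of degree 3.
\<close>

lemma neck_extend:
  assumes xX: "x \<in> X" and single: "single_exits X"
    and att: "\<And>z v. z \<in> W \<Longrightarrow> z \<notin> X \<Longrightarrow> v \<in> X \<Longrightarrow> (v, z) \<in> E \<Longrightarrow> card (E `` {z}) = 3"
    and nk: "neck E W x u c A P" and disj: "insert c A \<inter> X = {}"
    and st: "state (X \<union> A \<union> {c}) m" and Nc: "E `` {c} = P \<union> {a, b}" and ab: "a \<noteq> b"
    and abY: "{a, b} \<inter> (X \<union> A \<union> {c}) = {}"
    and pot: "potential (X \<union> A \<union> {c}) m + cost (X \<union> A \<union> {c}) c - 2 \<ge> r - 1"
  shows "\<exists>Z m'. state Z m' \<and> X \<subset> Z \<and> potential Z m' \<ge> r"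
  using nk disj st Nc ab abY pot
\<comment> \<open>The chain grows inside a finite graph, so the passage from diamond to diamond
  ends.\<close>
proof (induction "card (V - A)" arbitrary: c A P a b m rule: less_induct)
  case less
  note nk = less.prems(1) and disj = less.prems(2) and st = less.prems(3) and Nc = less.prems(4)
    and ab = less.prems(5) and abY = less.prems(6) and pot = less.prems(7)
  note nf = neck_facts[OF nk]
  define Y where "Y = X \<union> A \<union> {c}"
  define Z where "Z = Y \<union> {a, b}"
  have P: "P \<subseteq> Y" using nf(6,7) xX unfolding Y_def by (cases "A = {}") auto
  have S: "{a, b} = E `` {c} - Y" using P abY Nc unfolding Y_def by auto
  have cY: "c \<in> Y" unfolding Y_def by simp
  have YZ: "Y \<subseteq> Z" and XZ: "X \<subset> Z" using disj unfolding Z_def Y_def by auto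
  have stY: "state Y m" and potY: "potential Y m + cost Y c - 2 \<ge> r - 1"
    using st pot unfolding Y_def by simp_all
  show ?case
  proof (rule ccontr)
    assume no: "\<not> ?case"
    have small: "potential Z' m' < r" if "state Z' m'" "X \<subset> Z'" for Z' m'
      using that no by (meson not_less)
    \<comment> \<open>Two children give \<open>r - 1 + 6\<close> minus their charges, so anything
      below two full charges of 3 already reaches \<open>r\<close>.\<close>
    have ex: "state Z (m + 1)" "potential Z (m + 1) \<ge> r + 5 + int (card K) - cost Z a - cost Z b"
      if "K \<subseteq> Y - {c}" "\<And>d. d \<in> K \<Longrightarrow> cost Z d + 1 \<le> cost Y d" for K
      using expand_step[OF stY cY nf(2) S _ that(1) _ potY] that(2) ab unfolding Z_def by auto
    have stZ: "state Z (m + 1)" by (rule ex(1)[of "{}"]) auto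
    have le3: "cost Z a \<le> 3" "cost Z b \<le> 3"
      using cost_le3[of c Z] Nc cY YZ by auto
    have c3: "cost Z a = 3" "cost Z b = 3"
      using ex(2)[of "{}"] small[OF stZ XZ] le3 by auto
    have potZ: "potential Z (m + 1) \<ge> r - 1" using ex(2)[of "{}"] c3 by simp
    have nokill: "\<not> cost Z d + 1 \<le> cost Y d" if "d \<in> Y - {c}" for d
      using ex(2)[of "{d}"] small[OF stZ XZ] c3 that by auto
    \<comment> \<open>A child of cost 3 is counted and live. A second exit would gain by branching,
      and a further neighbour in \<open>Y\<close> would become cheaper; so degree at least 3 forces
      it to be adjacent to its sibling.\<close>
    have child: "o1 \<in> W \<and> (\<exists>z. E `` {o1} = {c, o2, z} \<and> z \<notin> Z \<and> z \<in> W)"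
      if o: "{o1, o2} = {a, b}" for o1 o2
    proof -
      have co: "(c, o1) \<in> E" "o1 \<notin> Y" "o1 \<in> Z" "cost Z o1 = 3" using o Nc abY c3 unfolding Y_def Z_def by auto
      have oW: "o1 \<in> W" using cost_free[of o1 c Z] co E_V cY YZ by force
      have live: "\<not> E `` {o1} \<inter> W \<subseteq> Z" using cost_dead[OF oW, of Z] co by auto
      have "d = c" if d: "d \<in> Y" "(d, o1) \<in> E" for d
      proof (rule ccontr)
        assume "d \<noteq> c"
        have "E `` {d} \<inter> W \<subseteq> Z" if "d \<in> W"
        proof (cases "d \<in> X")
          case True
          then have "E `` {d} - X = {o1}"
            using single_exitsD[OF single True that d(2) oW] co unfolding Y_def by blast
          then have "E `` {d} \<subseteq> insert o1 X" by blast
          then show ?thesis using co(3) XZ by auto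
        next
          case False
          then have "d \<in> A" using d \<open>d \<noteq> c\<close> unfolding Y_def by auto
          then have "o1 \<in> Y" using nf(8)[of d] d xX unfolding Y_def by auto
          then show ?thesis using co by simp
        qed
        then have "cost Z d + 1 \<le> cost Y d" by (intro cost_drop[OF YZ d(2) oW co(2,3)])
        then show False using nokill[of d] d \<open>d \<noteq> c\<close> by blast
      qed
      then have "E `` {o1} \<inter> Z \<subseteq> {c, o2}"
        using E_sym o irrefl_E unfolding Z_def by (auto simp: doubleton_eq_iff)
      moreover have "card (E `` {o1} - Z) \<le> 1"
      proof (rule ccontr)
        assume "\<not> card (E `` {o1} - Z) \<le> 1"
        with grow_branching[OF stZ co(3) oW live] potZ obtain Z' m' where
          "state Z' m'" "Z \<subset> Z'" "potential Z' m' \<ge> r" by fastforce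
        then show False using small[of Z' m'] XZ by auto
      qed
      moreover from live obtain z where z: "z \<in> E `` {o1}" "z \<in> W" "z \<notin> Z" by auto
      ultimately have "E `` {o1} - Z = {z}" by (intro card_seteq[symmetric]) auto
      then have "E `` {o1} \<subseteq> {c, o2, z}" using \<open>E `` {o1} \<inter> Z \<subseteq> {c, o2}\<close> by blast
      then show ?thesis using N_eq_insert2[OF oW] z oW by blast
    qed
    obtain a' where a': "E `` {a} = {c, b, a'}" "a' \<notin> Z" "a' \<in> W" "a \<in> W" using child[of a b] by auto
    obtain b' where b': "E `` {b} = {c, a, b'}" "b' \<notin> Z" "b' \<in> W" "b \<in> W" using child[of b a] by auto
    have "a' = b'"
    proof (rule ccontr)
      assume "a' \<noteq> b'"
      then have "cluster E W x u c A P a b a' b'"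
        unfolding cluster_def using nk Nc ab a' b' abY xX unfolding Z_def Y_def by auto
      then show False using no_cluster by blast
    qed
    define g where "g = a'"
    have g: "g \<in> W" "g \<notin> Z" "E `` {a} = {c, b, g}" "E `` {b} = {c, a, g}"
      using a' b' \<open>a' = b'\<close> unfolding g_def by auto
    have nk': "neck E W x u g (A \<union> {c, a, b}) {a, b}"
      by (rule neck.step[OF nk Nc ab a'(4) b'(4) g(1,3,4)])
        (use g(2) abY xX disj in \<open>auto simp: Z_def Y_def\<close>)
    \<comment> \<open>Degree 3 at the common exit would complete a forbidden necklace. By
      \<open>att\<close>, the larger degree also keeps \<open>g\<close> away from
      \<open>X\<close>.\<close>
    have g3: "card (E `` {g}) \<noteq> 3" using no_obstacle nk' unfolding no_obstacle_def by blast
    then have g4: "card (E `` {g}) \<ge> 4" using deg_W[OF g(1)] by simp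
    have gX: "g \<notin> X" using g(2) XZ by auto
    have gNX: "E `` {g} \<inter> X = {}" using att[OF g(1) gX] g3 E_sym by blast
    define Y' where "Y' = insert g Z"
    have gNY': "E `` {g} \<inter> Y' = {a, b}"
    proof -
      have "(v, g) \<notin> E" if "v \<in> insert c A" for v
        using that nf(8)[of v] Nc P g(2) xX unfolding Z_def Y_def by auto
      then have "E `` {g} \<inter> insert c A = {}" using E_sym by blast
      moreover have "{a, b} \<subseteq> E `` {g}" using g(3,4) E_sym by blast
      ultimately show ?thesis using gNX irrefl_E unfolding Y'_def Z_def Y_def by auto
    qed
    have stY': "state Y' (m + 1)"
      unfolding Y'_def by (rule state_attach[OF stZ, of a]) (use g in \<open>auto simp: Z_def\<close>)
    have diff: "Y' - Y = {a, b, g}" using abY g(2) unfolding Y'_def Z_def Y_def by auto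
    have dead: "cost Y' a = 2" "cost Y' b = 2" "cost Y' c = 2"
    proof -
      show "cost Y' a = 2"
        by (rule cost_dead[OF a'(4)]) (use g(3) in \<open>auto simp: Y'_def Z_def Y_def\<close>)
      show "cost Y' b = 2"
        by (rule cost_dead[OF b'(4)]) (use g(4) in \<open>auto simp: Y'_def Z_def Y_def\<close>)
      show "cost Y' c = 2"
        by (rule cost_dead[OF nf(2)]) (use Nc P in \<open>auto simp: Y'_def Z_def\<close>)
    qed
    have gab: "g \<noteq> a" "g \<noteq> b" using g(2) unfolding Z_def by auto
    \<comment> \<open>Entering \<open>g\<close> makes \<open>a\<close> and \<open>b\<close> dead: 6
      for the branching at \<open>c\<close>, minus 4 for the pair, minus 2 for \<open>g\<close> as a
      future dead vertex. This sums to 0, so the balance \<open>r - 1\<close> is reproduced with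
      \<open>g\<close> in place of \<open>c\<close>.\<close>
    have potY': "potential Y' (m + 1) + cost Y' g - 2 \<ge> r - 1"
    proof -
      have "Y \<subseteq> Y'" using YZ unfolding Y'_def by auto
      from potential_step[OF this state_finite[OF stY'] cY, of "{}" m "m + 1"]
      show ?thesis unfolding diff using potY dead ab gab by auto
    qed
    have Y'eq: "X \<union> (A \<union> {c, a, b}) \<union> {g} = Y'" unfolding Y'_def Z_def Y_def by auto
    have cardR: "card (E `` {g} - Y') = card (E `` {g}) - 2"
      using card_Diff_subset_Int[of "E `` {g}" Y'] gNY' ab by simp
    show False
    proof (cases "card (E `` {g} - Y') = 2")
      case True
      then obtain a2 b2 where R: "E `` {g} - Y' = {a2, b2}" "a2 \<noteq> b2" by (meson card_2_iff)
      have "V - (A \<union> {c, a, b}) \<subset> V - A" using a'(4) W_sub abY by blast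
      then have lt: "card (V - (A \<union> {c, a, b})) < card (V - A)"
        using finite_V by (intro psubset_card_mono) auto
      have "\<exists>Z m'. state Z m' \<and> X \<subset> Z \<and> potential Z m' \<ge> r"
      proof (rule less.hyps[OF lt nk' _ _ _ R(2)])
        show "insert g (A \<union> {c, a, b}) \<inter> X = {}" using disj abY gX by auto
        show "E `` {g} = {a, b} \<union> {a2, b2}" using R(1) gNY' by blast
        show "{a2, b2} \<inter> (X \<union> (A \<union> {c, a, b}) \<union> {g}) = {}" unfolding Y'eq using R(1) by blast
      qed (use stY' potY' Y'eq in simp_all)
      then show False using no by blast
    next
      case False
      then have "card (E `` {g} - Y') \<ge> 3" using cardR g4 by linarith
      moreover from this have "E `` {g} - Y' \<noteq> {}" by (metis card.empty not_numeral_le_zero)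
      moreover have "g \<in> Y'" unfolding Y'_def by simp
      ultimately obtain Z' m' where Z': "state Z' m'" "Y' \<subset> Z'"
          "potential Z' m' \<ge> r - 1 + 3 * int (card (E `` {g} - Y')) - 6"
        using expand_many[OF stY' _ g(1) _ potY'] by blast
      have "X \<subset> Z'" using Z'(2) XZ unfolding Y'_def by auto
      then show False using small[OF Z'(1)] Z'(3) \<open>card (E `` {g} - Y') \<ge> 3\<close> by linarith
    qed
  qed
qed

text \<open>If no growth keeps the potential, branching is impossible, so exits are single. A
  counted vertex next to \<open>X\<close> then has degree 3 and exactly two neighbours in
  \<open>X\<close>: more neighbours or a larger degree would pay for it, and a single one would
  start a chain.\<close>

lemma extend_state:
  assumes st: "state X m" and open_X: "\<exists>d\<in>X. \<not> E `` {d} \<inter> W \<subseteq> X"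
  shows "(\<exists>Z m'. state Z m' \<and> X \<subset> Z \<and> potential Z m' \<ge> potential X m) \<or>
    even (potential X m) \<and> (\<exists>Z m'. state Z m' \<and> X \<subset> Z \<and> potential Z m' \<ge> potential X m - 1)"
proof (rule ccontr)
  assume no: "\<not> ?thesis"
  have small: "potential Z m' < potential X m" if "state Z m'" "X \<subset> Z" for Z m'
    using that no by (meson not_less)
  have single: "single_exits X"
    unfolding single_exits_def
  proof (intro ballI impI)
    fix d assume d: "d \<in> X \<inter> W" "\<not> E `` {d} \<inter> W \<subseteq> X"
    show "card (E `` {d} - X) = 1"
    proof (rule ccontr)
      assume "card (E `` {d} - X) \<noteq> 1"
      moreover have "card (E `` {d} - X) \<noteq> 0" using d by auto
      ultimately have "card (E `` {d} - X) \<ge> 2" by linarith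
      with grow_branching[OF st, of d] d small show False by fastforce
    qed
  qed
  have attach: "state (insert z X) m" "potential (insert z X) m \<ge> potential X m + int (card (E `` {z} \<inter> X)) - cost (insert z X) z"
    if "z \<in> W" "z \<notin> X" "E `` {z} \<inter> X \<noteq> {}" for z
    using attach_step[OF st that] single_exitsD[OF single _ _ _ that(1,2)] by auto
  have le2: "card (E `` {z} \<inter> X) \<le> 2" if z: "z \<in> W" "z \<notin> X" "E `` {z} \<inter> X \<noteq> {}" for z
    using attach[OF z] small[OF attach(1)[OF z]] cost_W[OF z(1), of "insert z X"] z(2) by fastforce
  have split: "card (E `` {z} - insert z X) + card (E `` {z} \<inter> X) = card (E `` {z})" for z
  proof -
    have "E `` {z} - insert z X = E `` {z} - X" using irrefl_E by auto
    then show ?thesis using card_Int_Diff[OF finite_N, of "{z}" X] by simp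
  qed
  \<comment> \<open>With \<open>t\<close> neighbours in \<open>X\<close>, entering and expanding
    \<open>z\<close> changes the potential by at least \<open>t - 2 + 3 * (deg - t) - 6\<close>,
    which is not negative for \<open>deg \<ge> 4\<close> and \<open>t \<le> 2\<close>.\<close>
  have deg3: "card (E `` {z}) = 3" if z: "z \<in> W" "z \<notin> X" "E `` {z} \<inter> X \<noteq> {}" for z
  proof (rule ccontr)
    assume "card (E `` {z}) \<noteq> 3"
    then have z4: "card (E `` {z}) \<ge> 4" using deg_W[OF z(1)] by linarith
    let ?t = "card (E `` {z} \<inter> X)"
    have t: "?t \<ge> 1" using z(3) by (simp add: Suc_leI card_gt_0_iff)
    have "card (E `` {z} - insert z X) \<ge> 2" using split[of z] le2[OF z] z4 by linarith
    then have ne: "E `` {z} - insert z X \<noteq> {}" by (metis card.empty not_numeral_le_zero)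
    have "potential (insert z X) m + cost (insert z X) z - 2 \<ge> potential X m + int ?t - 2"
      using attach(2)[OF z] by simp
    from expand_many[OF attach(1)[OF z] _ z(1) ne this] obtain Z m' where
      Z: "state Z m'" "insert z X \<subset> Z"
        "potential Z m' \<ge> potential X m + int ?t - 2 + 3 * int (card (E `` {z} - insert z X)) - 6" by auto
    then have "potential Z m' \<ge> potential X m" using split[of z] z4 t le2[OF z] by linarith
    then show False using small[of Z m'] Z(1,2) by auto
  qed
  \<comment> \<open>A single neighbour in \<open>X\<close> would make \<open>z\<close> the entry of
    a chain that at first consists of \<open>z\<close> alone.\<close>
  have "card (E `` {z} \<inter> X) = 2" if z: "z \<in> W" "z \<notin> X" "E `` {z} \<inter> X \<noteq> {}" for z
  proof (rule ccontr)
    assume "card (E `` {z} \<inter> X) \<noteq> 2"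
    moreover have "card (E `` {z} \<inter> X) \<noteq> 0" using z(3) by simp
    ultimately have t1: "card (E `` {z} \<inter> X) = 1" using le2[OF z] by linarith
    then obtain x where x: "E `` {z} \<inter> X = {x}" by (meson card_1_singletonE)
    have "card (E `` {z} - insert z X) = 2" using split[of z] t1 deg3[OF z] by linarith
    then obtain a b where ab: "E `` {z} - insert z X = {a, b}" "a \<noteq> b" by (meson card_2_iff)
    have "E `` {z} = (E `` {z} \<inter> X) \<union> (E `` {z} - insert z X)" using irrefl_E by auto
    then have Nz: "E `` {z} = {x} \<union> {a, b}" using ab x by simp
    have "\<exists>Z m'. state Z m' \<and> X \<subset> Z \<and> potential Z m' \<ge> potential X m"
    proof (rule neck_extend[OF _ single _ neck.start[of z W x E] _ _ Nz ab(2)])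
      show "card (E `` {y}) = 3" if "y \<in> W" "y \<notin> X" "v \<in> X" "(v, y) \<in> E" for y v
        using deg3[OF that(1,2)] that(3,4) E_sym by blast
      show "x \<in> X" "(z, x) \<in> E" "x \<noteq> z" "z \<in> W" "insert z {} \<inter> X = {}" using x z by auto
      show "state (X \<union> {} \<union> {z}) m" using attach(1)[OF z] by simp
      show "{a, b} \<inter> (X \<union> {} \<union> {z}) = {}" using ab by blast
      show "potential X m - 1 \<le> potential (X \<union> {} \<union> {z}) m + cost (X \<union> {} \<union> {z}) z - 2"
        using attach(2)[OF z] t1 by simp
    qed
    then show False using no by blast
  qed
  then have "even (potential X m)"
    by (intro even_potential[OF state_V[OF st] single]) auto
  moreover obtain d z where dz: "d \<in> X" "(d, z) \<in> E" "z \<in> W" "z \<notin> X" using open_X by auto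
  then have ne: "E `` {z} \<inter> X \<noteq> {}" using E_sym by blast
  have "potential (insert z X) m \<ge> potential X m - 1"
    using attach(2)[OF dz(3,4) ne] \<open>\<And>z. _ \<Longrightarrow> _ \<Longrightarrow> _ \<Longrightarrow> card (E `` {z} \<inter> X) = 2\<close>[OF dz(3,4) ne]
      cost_W[OF dz(3), of "insert z X"] by linarith
  ultimately show False using no attach(1)[OF dz(3,4) ne] dz(4) by blast
qed

lemma closed_even:
  assumes "state X m" "\<forall>d\<in>X. E `` {d} \<inter> W \<subseteq> X"
  shows "potential X m = 2 * (3 * int m - int (card (X \<inter> W)))"
proof -
  have "cost X d = (if d \<in> W then 2 else 0)" if "d \<in> X" for d
  proof -
    have "E `` {d} \<inter> W - X = {}" using assms(2) that by auto
    then have "card (E `` {d} \<inter> W - X) = 0" by (simp only: card.empty)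
    then show ?thesis using assms(2) that unfolding cost_def by simp
  qed
  then have "(\<Sum>d\<in>X. cost X d) = (\<Sum>d\<in>X. if d \<in> W then 2 else 0)" by simp
  also have "\<dots> = 2 * int (card (X \<inter> W))"
    using state_finite[OF assms(1)] by (simp add: sum.If_cases)
  finally show ?thesis by (simp add: potential_def)
qed

lemma close_state:
  assumes "state X m"
  shows "\<exists>Z m'. state Z m' \<and> X \<subseteq> Z \<and> (\<forall>d\<in>Z. E `` {d} \<inter> W \<subseteq> Z) \<and> potential Z m' \<ge> potential X m"
  using assms
proof (induction "card (V - X)" arbitrary: X m rule: less_induct)
  case less
  have IH: "\<exists>Z' m''. state Z' m'' \<and> X \<subseteq> Z' \<and> (\<forall>d\<in>Z'. E `` {d} \<inter> W \<subseteq> Z') \<and> potential Z' m'' \<ge> potential Z m'"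
    if Z: "state Z m'" "X \<subset> Z" for Z m'
  proof -
    have "card (V - Z) < card (V - X)"
      by (rule psubset_card_mono) (use finite_V Z state_V[OF Z(1)] in auto)
    from less.hyps[OF this Z(1)] Z(2) show ?thesis by (meson order_trans psubset_imp_subset)
  qed
  show ?case
  proof (cases "\<forall>d\<in>X. E `` {d} \<inter> W \<subseteq> X")
    case False
    from extend_state[OF less.prems] False
    consider Z m' where "state Z m'" "X \<subset> Z" "potential Z m' \<ge> potential X m"
      | Z m' where "even (potential X m)" "state Z m'" "X \<subset> Z" "potential Z m' \<ge> potential X m - 1"
      by blast
    then show ?thesis
    proof cases
      case 1
      from IH[OF 1(1,2)] 1(3) show ?thesis by (meson order_trans)
    next
      case 2
      from IH[OF 2(2,3)] obtain Z' m'' where Z': "state Z' m''" "X \<subseteq> Z'"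
        "\<forall>d\<in>Z'. E `` {d} \<inter> W \<subseteq> Z'" "potential Z' m'' \<ge> potential Z m'" by blast
      have "potential Z' m'' \<ge> potential X m"
        using closed_even[OF Z'(1,3)] Z'(4) 2(1,4) by presburger
      with Z' show ?thesis by blast
    qed
  qed (use less.prems in blast)
qed

end

section \<open>Starts with potential at least -1\<close>

context irreducible
begin

text \<open>The threshold is -1 because the potential of a closed set is even: -1 is rounded up to
  0, that is, to \<open>card (X \<inter> W) \<le> 3 * m\<close>.\<close>

definition poor :: bool where
  "poor \<longleftrightarrow> (\<forall>X m. state X m \<longrightarrow> X \<noteq> {} \<longrightarrow> potential X m < - 1)"

lemma poorD: "poor \<Longrightarrow> state X m \<Longrightarrow> X \<noteq> {} \<Longrightarrow> potential X m < - 1"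
  by (simp add: poor_def)

text \<open>A star of degree \<open>d\<close> has potential at least
  \<open>6 * (d - 2) - 2 - 3 * d = 3 * d - 14\<close>, which is 1 for \<open>d = 5\<close> and -2
  for \<open>d = 4\<close>. In the latter case a neighbour that is cheaper or branches would gain
  the missing unit.\<close>

lemma star_start:
  assumes w: "w \<in> W" and w4: "card (E `` {w}) \<ge> 4"
    and poor: poor
  shows "card (E `` {w}) = 4" and "v \<in> E `` {w} \<Longrightarrow> v \<in> W \<and> (\<exists>z\<in>W. E `` {v} - insert w (E `` {w}) = {z})"
proof -
  note no = poorD[OF poor]
  let ?N = "E `` {w}" and ?Z = "insert w (E `` {w})" and ?d = "card (E `` {w})"
  have st: "state ?Z (?d - 2)" by (rule state_star[OF w])
  have "w \<notin> ?N" using irrefl_E by auto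
  then have "(\<Sum>d\<in>?Z. cost ?Z d) = cost ?Z w + (\<Sum>d\<in>?N. cost ?Z d)" by simp
  moreover have "cost ?Z w = 2" by (rule cost_dead[OF w]) auto
  ultimately have pot: "potential ?Z (?d - 2) = 6 * int ?d - 14 - (\<Sum>d\<in>?N. cost ?Z d)"
    unfolding potential_def using w4 by (simp add: of_nat_diff)
  have le: "(\<Sum>d\<in>?N. cost ?Z d) \<le> 3 * int ?d" by (rule sum_cost_children) auto
  show d4: "?d = 4" using no[OF st] pot le w4 by auto
  have c3: "cost ?Z v = 3" if v: "v \<in> ?N" for v
  proof (rule ccontr)
    assume "cost ?Z v \<noteq> 3"
    moreover have "cost ?Z v \<le> 3" using v by (intro cost_le3[of w]) auto
    moreover have "(\<Sum>d\<in>?N - {v}. cost ?Z d) \<le> 3 * int (card (?N - {v}))"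
      by (rule sum_cost_children) auto
    moreover have "card (?N - {v}) = 3" using v d4 by simp
    ultimately have "(\<Sum>d\<in>?N. cost ?Z d) \<le> 11" using sum.remove[OF finite_N v, of "cost ?Z"] by simp
    then show False using no[OF st] pot d4 by auto
  qed
  have pot2: "potential ?Z (?d - 2) \<ge> - 2" using pot le d4 by simp
  show "v \<in> W \<and> (\<exists>z\<in>W. E `` {v} - ?Z = {z})" if v: "v \<in> ?N"
  proof -
    have vW: "v \<in> W" using cost_free[of v w ?Z] c3[OF v] v E_V by force
    then have live: "\<not> E `` {v} \<inter> W \<subseteq> ?Z" using c3[OF v] cost_dead by fastforce
    have "card (E `` {v} - ?Z) \<le> 1"
    proof (rule ccontr)
      assume "\<not> card (E `` {v} - ?Z) \<le> 1"
      then obtain Z m' where "state Z m'" "?Z \<subset> Z" "potential Z m' \<ge> - 1"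
        using grow_branching[OF st _ vW live] v pot2 by fastforce
      then show False using no[of Z m'] by auto
    qed
    moreover obtain z where z: "z \<in> E `` {v} - ?Z" "z \<in> W" using live by auto
    ultimately have "E `` {v} - ?Z = {z}" by (intro card_seteq[symmetric]) auto
    then show ?thesis using vW z by blast
  qed
qed

text \<open>Such a chain could be prolonged forever. Its end has degree 4, as it is no obstacle and
  its star is poor. The two further neighbours have one exit each from that star, hence are
  adjacent, and their exits coincide since there is no cluster; this is the next diamond.\<close>

lemma neck_start:
  assumes poor: poor and f: "f \<notin> W"
    and nk: "neck E W f u c A P" and A: "A \<noteq> {}"
  shows False
  using nk A
proof (induction "card (V - A)" arbitrary: c A P rule: less_induct)
  case less
  note nk = less.prems(1)
  note nf = neck_facts[OF nk]
  have "\<exists>a b. P = {a, b} \<and> a \<noteq> b" using nk less.prems(2) by (cases rule: neck.cases) auto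
  then have cP: "card P = 2" by auto
  have PA: "P \<subseteq> A" using nf(7) less.prems(2) by blast
  have "card (E `` {c}) \<noteq> 3" using no_obstacle nk less.prems(2) unfolding no_obstacle_def by blast
  then have "card (E `` {c}) \<ge> 4" using deg_W[OF nf(2)] by linarith
  note star = star_start[OF nf(2) this poor]
  have "card (E `` {c} - P) = 2"
    using star(1) cP nf(5) finite_subset[OF nf(5)] by (simp add: card_Diff_subset)
  then obtain p r where pr: "E `` {c} - P = {p, r}" "p \<noteq> r" by (meson card_2_iff)
  then have Nc: "E `` {c} = P \<union> {p, r}" using nf(5) by blast
  have child: "\<exists>z. E `` {o1} = {c, o2, z} \<and> z \<in> W \<and> z \<notin> insert f (insert c A) \<and> z \<noteq> o2 \<and> o1 \<in> W \<and>
      o1 \<notin> insert f (insert c A)"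
    if o: "{o1, o2} = {p, r}" for o1 o2
  proof -
    have oP: "o1 \<in> E `` {c}" "o1 \<notin> P" using o pr by auto
    obtain z where z: "o1 \<in> W" "z \<in> W" "E `` {o1} - insert c (E `` {c}) = {z}" using star(2)[OF oP(1)] by auto
    have oA: "o1 \<notin> insert f (insert c A)" using nf(10)[of o1] oP z(1) f E_sym irrefl_E by blast
    have AN: "(v, o1) \<notin> E" if "v \<in> A" for v using nf(8)[OF that] oA by blast
    have "E `` {o1} \<subseteq> insert z (insert c (P \<union> {o1, o2}))" using z(3) Nc unfolding o by blast
    moreover have "E `` {o1} \<inter> P = {}" using AN PA E_sym by blast
    moreover have "o1 \<notin> E `` {o1}" using irrefl_E by blast
    ultimately have "E `` {o1} \<subseteq> {c, o2, z}" by blast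
    then have eq: "E `` {o1} = {c, o2, z}" "c \<noteq> z" "o2 \<noteq> z" using N_eq_insert2[OF z(1)] by auto
    then have "(z, o1) \<in> E" using E_sym by blast
    then have "z \<notin> A" using AN by blast
    then show ?thesis using eq z oA f by auto
  qed
  obtain p' where p': "E `` {p} = {c, r, p'}" "p' \<in> W" "p' \<notin> insert f (insert c A)" "p' \<noteq> r" "p \<in> W"
    "p \<notin> insert f (insert c A)" using child[of p r] by blast
  obtain r' where r': "E `` {r} = {c, p, r'}" "r' \<in> W" "r' \<notin> insert f (insert c A)" "r' \<noteq> p" "r \<in> W"
    "r \<notin> insert f (insert c A)" using child[of r p] by blast
  have "p' = r'"
  proof (rule ccontr)
    assume "p' \<noteq> r'"
    then have "cluster E W f u c A P p r p' r'"
      unfolding cluster_def using nk Nc pr(2) p' r' by auto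
    then show False using no_cluster by blast
  qed
  then have nk': "neck E W f u p' (A \<union> {c, p, r}) {p, r}"
    by (intro neck.step[OF nk Nc pr(2)]) (use p' r' in auto)
  have "V - (A \<union> {c, p, r}) \<subset> V - A" using nf(2,3) W_sub by blast
  then have "card (V - (A \<union> {c, p, r})) < card (V - A)" using finite_V by (intro psubset_card_mono) auto
  from less.hyps[OF this nk'] show False by simp
qed

text \<open>
  Starting from \<open>{f}\<close> the potential is \<open>-2\<close>, and one unit is to be gained. If neither growing from \<open>f\<close> nor
  a star around a vertex of degree at least 4 gains it, the neighbourhood of \<open>f\<close> is a blossom.
\<close>

lemma free_start:
  assumes f: "f \<in> V - W" and Nf: "E `` {f} = {w, v}" "w \<noteq> v" and wv: "w \<in> W" "v \<in> W"
  shows "\<exists>X m. state X m \<and> X \<noteq> {} \<and> potential X m \<ge> - 1"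
proof (rule ccontr)
  assume "\<not> ?thesis"
  then have poor: poor unfolding poor_def by (meson not_less)
  note no = poorD[OF poor]
  have st0: "state {f} 0" by (rule state_single[OF f])
  have "card (E `` {f} \<inter> W - {f}) = card {w, v}" by (rule arg_cong[where f = card]) (use Nf wv f in auto)
  then have p0: "potential {f} 0 = - 2" using f Nf(2) by (simp add: potential_def cost_def)
  \<comment> \<open>Entering \<open>y\<close> takes 1 off the charge of \<open>f\<close>, so with
    \<open>y\<close> charged as dead the balance is \<open>- 2 + 1 - 2\<close>. Three children would
    raise it to 0.\<close>
  have enter: "state {f, y} 0" "potential {f, y} 0 + cost {f, y} y - 2 \<ge> - 3" "card (E `` {y}) = 3"
    if y: "y \<in> {w, v}" for y
  proof -
    have yf: "y \<in> W" "y \<notin> {f}" "(f, y) \<in> E" using y wv f Nf by auto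
    then have "E `` {y} \<inter> {f} = {f}" using E_sym by blast
    then show st: "state {f, y} 0" and pot: "potential {f, y} 0 + cost {f, y} y - 2 \<ge> - 3"
      using attach_step[OF st0 yf(1,2)] f p0 by (simp_all add: insert_commute)
    show "card (E `` {y}) = 3"
    proof (rule ccontr)
      assume "card (E `` {y}) \<noteq> 3"
      then have "card (E `` {y}) \<ge> 4" using deg_W[OF yf(1)] by linarith
      moreover have "E `` {y} - {f, y} = E `` {y} - {f}" using irrefl_E by auto
      moreover have "card (E `` {y} - {f}) = card (E `` {y}) - 1" using yf(3) E_sym by simp
      ultimately have k: "card (E `` {y} - {f, y}) \<ge> 3" by simp
      then have "E `` {y} - {f, y} \<noteq> {}" by (metis card.empty not_numeral_le_zero)
      from expand_many[OF st _ yf(1) this pot] obtain Z m' where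
        "state Z m'" "{f, y} \<subset> Z" "potential Z m' \<ge> - 3 + 3 * int (card (E `` {y} - {f, y})) - 6" by auto
      then show False using no[of Z m'] k by auto
    qed
  qed
  define Y where "Y = {f, w}"
  have wf: "(f, w) \<in> E" "(w, f) \<in> E" "w \<noteq> f" using Nf E_sym irrefl_E by blast+
  have "card (E `` {w} - {f}) = 2" using enter(3)[of w] wf by simp
  then obtain a b where ab: "E `` {w} - {f} = {a, b}" "a \<noteq> b" by (meson card_2_iff)
  then have Nw: "E `` {w} = {f, a, b}" using wf by blast
  have abY: "a \<noteq> f" "b \<noteq> f" "a \<noteq> w" "b \<noteq> w" using ab irrefl_E by blast+
  have wab: "(w, a) \<in> E" "(w, b) \<in> E" using Nw by blast+
  then have abw: "(a, w) \<in> E" "(b, w) \<in> E" "a \<in> V" "b \<in> V" using E_sym E_V by blast+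
  have S: "{a, b} = E `` {w} - Y" using Nw abY unfolding Y_def by auto
  define Z where "Z = Y \<union> {a, b}"
  have Zeq: "Z = {f, w, a, b}" unfolding Z_def Y_def by auto
  have stY: "state Y 0" and pY: "potential Y 0 + cost Y w - 2 \<ge> - 3"
    using enter[of w] unfolding Y_def by auto
  have ex: "state Z 1" "potential Z 1 \<ge> 3 + int (card K) - cost Z a - cost Z b"
    if "K \<subseteq> {f}" "\<And>d. d \<in> K \<Longrightarrow> cost Z d + 1 \<le> cost Y d" for K
  proof -
    have K: "K \<subseteq> Y - {w}" using that(1) wf unfolding Y_def by auto
    have wY: "w \<in> Y" unfolding Y_def by simp
    note * = expand_step[OF stY wY wv(1) S _ K _ pY]
    show "state Z 1" "potential Z 1 \<ge> 3 + int (card K) - cost Z a - cost Z b"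
      using * that(2) ab(2) unfolding Z_def by auto
  qed
  have stZ: "state Z 1" by (rule ex(1)[of "{}"]) auto
  have sum5: "cost Z a + cost Z b \<ge> 5" using ex(2)[of "{}"] no[OF stZ] Zeq by auto
  have le3: "cost Z a \<le> 3" "cost Z b \<le> 3" using cost_le3[of w Z] Nw Zeq by auto
  have dead_w: "cost Z w = 2" by (rule cost_dead[OF wv(1)]) (use Nw Zeq in auto)
  \<comment> \<open>If \<open>v\<close> were a child of \<open>w\<close>, absorbing it would also
    lower the charge of \<open>f\<close>. With this extra unit both children must cost 3; then
    \<open>v\<close> has only \<open>f\<close>, \<open>w\<close> and one exit as neighbours, and the
    other child branches.\<close>
  have v_ab: "v \<notin> {a, b}"
  proof
    assume "v \<in> {a, b}"
    then obtain o2 where o2: "{v, o2} = {a, b}" by auto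
    have drop: "cost Z f + 1 \<le> cost Y f"
      by (rule cost_drop[of _ _ _ v]) (use Nf wv f o2 Zeq abY in \<open>auto simp: Y_def\<close>)
    have "cost Z a + cost Z b \<ge> 6" using ex(2)[of "{f}"] drop no[OF stZ] Zeq by auto
    then have c3: "cost Z v = 3" "cost Z o2 = 3" using le3 o2 by (auto simp: doubleton_eq_iff)
    have pZ: "potential Z 1 \<ge> - 2" using ex(2)[of "{f}"] drop le3 by auto
    have o2W: "o2 \<in> W" using cost_free[of o2 w Z] c3 Nw o2 E_V[of w o2] Zeq by (force simp: doubleton_eq_iff)
    have live: "\<not> E `` {o2} \<inter> W \<subseteq> Z" "\<not> E `` {v} \<inter> W \<subseteq> Z"
      using c3 cost_dead[OF o2W] cost_dead[OF wv(2)] by auto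
    then obtain z where z: "z \<in> E `` {v}" "z \<notin> Z" by auto
    have vN: "f \<in> E `` {v}" "w \<in> E `` {v}" using Nf Nw o2 E_sym by blast+
    have Nv: "E `` {v} = {f, w, z}"
    proof (rule card_subset_eq[symmetric])
      show "card {f, w, z} = card (E `` {v})" using enter(3)[of v] z wf Zeq by auto
    qed (use vN z in auto)
    have "E `` {o2} \<inter> Z \<subseteq> {w}"
    proof -
      have "(f, o2) \<notin> E" using Nf o2 ab abY by (auto simp: doubleton_eq_iff)
      moreover have "(v, o2) \<notin> E" using Nv z(2) Zeq abY o2 ab by (auto simp: doubleton_eq_iff)
      ultimately show ?thesis using E_sym irrefl_E o2 unfolding Zeq by (auto simp: doubleton_eq_iff)
    qed
    then have "E `` {o2} - {w} \<subseteq> E `` {o2} - Z" by auto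
    then have "card (E `` {o2} - {w}) \<le> card (E `` {o2} - Z)" by (intro card_mono) auto
    moreover have "card (E `` {o2} - {w}) \<ge> 2" using deg_W[OF o2W] by (simp add: card_Diff_singleton_if) arith
    ultimately have "card (E `` {o2} - Z) \<ge> 2" by linarith
    moreover have "o2 \<in> Z" using o2 Zeq by auto
    ultimately obtain Z' m' where "state Z' m'" "Z \<subset> Z'" "potential Z' m' \<ge> - 1"
      using grow_branching[OF stZ _ o2W live(1)] pZ by fastforce
    then show False using no[of Z' m'] by auto
  qed
  have fN: "(f, a) \<notin> E" "(f, b) \<notin> E" using Nf v_ab abY by auto
  have NZ: "E `` {o1} \<inter> Z \<subseteq> {w, o2}" if "{o1, o2} = {a, b}" for o1 o2
    using that fN irrefl_E E_sym unfolding Zeq by (auto simp: doubleton_eq_iff)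
  have branch: "card (E `` {x} - Z) \<le> 1" if x: "x \<in> Z" "x \<in> W" "cost Z x = 3" "potential Z 1 \<ge> - 2" for x
  proof (rule ccontr)
    assume "\<not> card (E `` {x} - Z) \<le> 1"
    moreover have "\<not> E `` {x} \<inter> W \<subseteq> Z" using cost_dead[of x Z] x by auto
    ultimately obtain Z' m' where "state Z' m'" "Z \<subset> Z'" "potential Z' m' \<ge> - 1"
      using grow_branching[OF stZ x(1,2)] x(4) by fastforce
    then show False using no[of Z' m'] by auto
  qed
  \<comment> \<open>A free child must cost exactly 2, which leaves a potential of at least -2. Its
    sibling then has at most one exit, so the two are adjacent; but this uses up a second edge of
    the free child, which can cost at most 1.\<close>
  have W1: "o1 \<in> W" if o: "{o1, o2} = {a, b}" for o1 o2
  proof (rule ccontr)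
    assume o1: "o1 \<notin> W"
    have oV: "o1 \<in> V" "(w, o1) \<in> E" "o1 \<in> Z" "o2 \<in> Z" "(w, o2) \<in> E" "o2 \<in> V" "(o1, w) \<in> E"
      using o wab abw unfolding Zeq by (auto simp: doubleton_eq_iff)
    have "cost Z o1 \<le> 2" using cost_free[of o1 w Z] o1 oV Zeq by auto
    then have c: "cost Z o1 = 2" "cost Z o2 = 3" using sum5 le3 o by (auto simp: doubleton_eq_iff)
    have pZ: "potential Z 1 \<ge> - 2" using ex(2)[of "{}"] c o by (auto simp: doubleton_eq_iff)
    have o2: "o2 \<in> W" using cost_free[of o2 w Z] c oV Zeq by auto
    have c1: "card (E `` {o2} - Z) \<le> 1" by (rule branch[OF oV(4) o2 c(2) pZ])
    have "card (E `` {o2}) = card (E `` {o2} \<inter> Z) + card (E `` {o2} - Z)" by (rule card_Int_Diff) simp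
    then have "card (E `` {o2} \<inter> Z) \<ge> 2" using deg_W[OF o2] c1 by linarith
    then have "E `` {o2} \<inter> Z = {w, o1}"
      using NZ[of o2 o1] o by (intro card_seteq) (auto simp: card_insert_if insert_commute)
    then have "(o1, o2) \<in> E" using E_sym by auto
    then have "card (E `` {o1} \<inter> W - Z) \<le> card (E `` {o1} - {w, o2})" using oV Zeq by (intro card_mono) auto
    also have "\<dots> = card (E `` {o1}) - 2"
      using \<open>(o1, o2) \<in> E\<close> oV abY o by (subst card_Diff_subset) (auto simp: doubleton_eq_iff)
    also have "\<dots> \<le> 1" using deg_free[of o1] o1 oV by simp
    finally show False using c(1) o1 by (simp add: cost_def)
  qed
  have aW: "a \<in> W" "b \<in> W" using W1[of a b] W1[of b a] by auto
  \<comment> \<open>Adjacent children form a triangle with \<open>w\<close>. In the star of a child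
    of degree at least 4 the exit of \<open>w\<close> would be \<open>f\<close>, which is not
    counted. So the triangle is a cluster or opens a chain of diamonds.\<close>
  have nab: "(a, b) \<notin> E"
  proof
    assume "(a, b) \<in> E"
    then have adj: "(a, b) \<in> E" "(b, a) \<in> E" using E_sym by auto
    have tri: "\<exists>z. E `` {o1} = {w, o2, z} \<and> z \<noteq> w \<and> z \<noteq> o2" if o: "{o1, o2} = {a, b}" for o1 o2
    proof -
      have o1: "o1 \<in> W" "o2 \<in> E `` {o1}" "w \<in> E `` {o1}" "o2 \<noteq> w"
        using aW o adj abw abY by (auto simp: doubleton_eq_iff)
      have "card (E `` {o1}) = 3"
      proof (rule ccontr)
        assume "card (E `` {o1}) \<noteq> 3"
        then have "card (E `` {o1}) \<ge> 4" using deg_W[OF o1(1)] by linarith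
        from star_start(2)[OF o1(1) this poor o1(3)] obtain z where
          "z \<in> W" "E `` {w} - insert o1 (E `` {o1}) = {z}" by auto
        then have "z \<in> E `` {w}" "z \<noteq> o1" "z \<noteq> o2" using o1(2) by blast+
        then have "z = f" using Nw o by auto
        then show False using \<open>z \<in> W\<close> f by blast
      qed
      then have "card (E `` {o1} - {w, o2}) = 1" using o1 by (subst card_Diff_subset) auto
      then obtain z where "E `` {o1} - {w, o2} = {z}" by (meson card_1_singletonE)
      then have "E `` {o1} = {w, o2, z} \<and> z \<noteq> w \<and> z \<noteq> o2" using o1(2,3) by blast
      then show ?thesis by blast
    qed
    obtain a' where a': "E `` {a} = {w, b, a'}" "a' \<noteq> w" "a' \<noteq> b" using tri[of a b] by auto
    obtain b' where b': "E `` {b} = {w, a, b'}" "b' \<noteq> w" "b' \<noteq> a" using tri[of b a] by auto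
    have nef: "a' \<noteq> f" "b' \<noteq> f" using fN E_sym a' b' by blast+
    have nk0: "neck E W f w w {} {f}" by (rule neck.start) (use wv wf in auto)
    have Nw': "E `` {w} = {f} \<union> {a, b}" using Nw by auto
    have "a' = b'"
    proof (rule ccontr)
      assume "a' \<noteq> b'"
      then have "cluster E W f w w {} {f} a b a' b'"
        unfolding cluster_def using nk0 Nw' a' b' nef ab(2) aW abY by auto
      then show False using no_cluster by blast
    qed
    have "a' \<in> W"
    proof (rule ccontr)
      assume "a' \<notin> W"
      then have "cost Z a = 2" "cost Z b = 2"
        using a' b' aW \<open>a' = b'\<close> by (auto intro!: cost_dead simp: Zeq)
      then show False using sum5 by simp
    qed
    then have "neck E W f w a' ({} \<union> {w, a, b}) {a, b}"
      by (intro neck.step[OF nk0 Nw' ab(2)]) (use a' b' \<open>a' = b'\<close> aW nef abY in auto)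
    from neck_start[OF poor _ this] f show False by auto
  qed
  have NZ': "E `` {o1} \<inter> Z = {w}" "E `` {o1} - Z = E `` {o1} - {w}" "card (E `` {o1} - Z) = card (E `` {o1}) - 1"
    if o: "{o1, o2} = {a, b}" for o1 o2
  proof -
    have "o2 \<notin> E `` {o1}" using nab o E_sym by (auto simp: doubleton_eq_iff)
    moreover have w1: "w \<in> E `` {o1}" using Nw o E_sym by blast
    ultimately show 1: "E `` {o1} \<inter> Z = {w}" using NZ[OF o] Zeq by blast
    then show "E `` {o1} - Z = E `` {o1} - {w}" by blast
    then show "card (E `` {o1} - Z) = card (E `` {o1}) - 1" using w1 by simp
  qed
  have c3': "cost Z o1 = 3" if o: "{o1, o2} = {a, b}" for o1 o2
  proof (rule ccontr)
    assume "cost Z o1 \<noteq> 3"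
    then have c: "cost Z o1 = 2" "cost Z o2 = 3" using sum5 le3 o by (auto simp: doubleton_eq_iff)
    have pZ: "potential Z 1 \<ge> - 2" using ex(2)[of "{}"] c o by (auto simp: doubleton_eq_iff)
    have o2: "o2 \<in> W" "o2 \<in> Z" using aW o Zeq by (auto simp: doubleton_eq_iff)
    have "card (E `` {o2} - Z) \<ge> 2" using NZ'(3)[of o2 o1] o deg_W[OF o2(1)] by (simp add: insert_commute)
    then show False using branch[OF o2(2,1) c(2) pZ] by simp
  qed
  have c3: "cost Z a = 3" "cost Z b = 3" using c3'[of a b] c3'[of b a] by auto
  have pZ: "potential Z 1 \<ge> - 3" using ex(2)[of "{}"] c3 by auto
  \<comment> \<open>Three exits gain \<open>3 * 3 - 5 = 4\<close>, enough even from -3.\<close>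
  have deg3: "card (E `` {o1}) = 3" if o: "{o1, o2} = {a, b}" for o1 o2
  proof (rule ccontr)
    assume "card (E `` {o1}) \<noteq> 3"
    moreover have o1: "o1 \<in> W" "o1 \<in> Z" "cost Z o1 = 3" using aW o Zeq c3 by (auto simp: doubleton_eq_iff)
    ultimately have "card (E `` {o1} - Z) \<ge> 3" using NZ'(3)[OF o] deg_W[of o1] by simp
    moreover have "\<not> E `` {o1} \<inter> W \<subseteq> Z" using cost_dead[of o1 Z] o1 by auto
    ultimately obtain Z' m' where "state Z' m'" "Z \<subset> Z'" "potential Z' m' \<ge> - 1"
      using grow_branching[OF stZ o1(2,1)] pZ by fastforce
    then show False using no[of Z' m'] by auto
  qed
  \<comment> \<open>Expanding \<open>o1\<close> leaves \<open>- 2 + 6 - 3 - 3\<close>. Again nothing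
    may be cheaper, and every live counted vertex of the enlarged set has one exit. As
    \<open>o2\<close> has two neighbours outside \<open>Z\<close>, it must share one of them,
    \<open>c\<close>, with \<open>o1\<close>.\<close>
  have half: "\<exists>c d e c' d'. E `` {o1} = {w, c, d} \<and> E `` {o2} = {w, c, e} \<and> E `` {c} = {o1, o2, d, c'} \<and>
      E `` {d} = {o1, c, d'} \<and> c \<in> W \<and> d \<in> W \<and> e \<in> W \<and> d' \<in> W \<and> {c, d} \<inter> Z = {} \<and> c \<noteq> d \<and>
      e \<notin> Z \<union> {c, d} \<and> d' \<notin> Z \<union> {c, d} \<and> v \<notin> {c, d} \<and> state (Z \<union> {c, d}) 2 \<and> potential (Z \<union> {c, d}) 2 \<ge> - 2 \<and>
      cost (Z \<union> {c, d}) o2 = 3 \<and> cost (Z \<union> {c, d}) c = 3 \<and> cost (Z \<union> {c, d}) d = 3"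
    if o: "{o1, o2} = {a, b}" for o1 o2
  proof -
    have o': "{o2, o1} = {a, b}" using o by auto
    have oo: "o1 \<in> W" "o1 \<in> Z" "cost Z o1 = 3" "o2 \<in> W" "o2 \<in> Z" "cost Z o2 = 3" "o1 \<noteq> o2" "o1 \<noteq> f" "o2 \<noteq> f"
        "o1 \<noteq> w" "o2 \<noteq> w"
      using aW o Zeq c3 ab(2) abY by (auto simp: doubleton_eq_iff)
    have Zo: "Z = {f, w, o1, o2}" using Zeq o by auto
    have "card (E `` {o1} - Z) = 2" using NZ'(3)[OF o] deg3[OF o] by simp
    then obtain c0 d0 where cd0: "E `` {o1} - Z = {c0, d0}" "c0 \<noteq> d0" by (meson card_2_iff)
    define U where "U = Z \<union> {c0, d0}"
    have ZU: "Z \<subseteq> U" unfolding U_def by auto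
    have eU: "state U 2" "potential U 2 \<ge> 4 + int (card K) - cost U c0 - cost U d0"
      if "K \<subseteq> Z - {o1}" "\<And>d. d \<in> K \<Longrightarrow> cost U d + 1 \<le> cost Z d" for K
    proof -
      have "- 2 \<le> potential Z 1 + cost Z o1 - 2" using pZ oo by simp
      from expand_step[OF stZ oo(2,1) cd0(1)[symmetric] _ that(1) _ this] that(2) cd0(2)
      show "state U 2" "potential U 2 \<ge> 4 + int (card K) - cost U c0 - cost U d0"
        unfolding U_def by (auto simp: numeral_2_eq_2)
    qed
    have stU: "state U 2" by (rule eU(1)[of "{}"]) auto
    have noU: "potential U 2 < - 1" by (rule no[OF stU]) (use Zo ZU in auto)
    have lecd: "cost U c0 \<le> 3" "cost U d0 \<le> 3" using cost_le3[of o1 U] cd0 oo ZU by auto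
    have ccd: "cost U c0 = 3" "cost U d0 = 3" using eU(2)[of "{}"] noU lecd by auto
    have pU: "potential U 2 \<ge> - 2" using eU(2)[of "{}"] ccd by simp
    have nokill: "\<not> cost U d + 1 \<le> cost Z d" if "d \<in> Z - {o1}" for d
      using eU(2)[of "{d}"] noU ccd that by auto
    have costo2: "cost U o2 = 3"
      using nokill[of o2] oo cost_W[OF oo(4), of U] by auto
    have liveU: "\<exists>z\<in>W. E `` {x} - U = {z}" if x: "x \<in> W" "x \<in> U" "cost U x = 3" for x
    proof -
      have live: "\<not> E `` {x} \<inter> W \<subseteq> U" using cost_dead[of x U] x by auto
      have "card (E `` {x} - U) \<le> 1"
      proof (rule ccontr)
        assume "\<not> card (E `` {x} - U) \<le> 1"
        then obtain Z' m' where "state Z' m'" "U \<subset> Z'" "potential Z' m' \<ge> - 1"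
          using grow_branching[OF stU x(2,1) live] pU by fastforce
        then show False using no[of Z' m'] by auto
      qed
      moreover obtain z where z: "z \<in> E `` {x} - U" "z \<in> W" using live by auto
      ultimately have "E `` {x} - U = {z}" by (intro card_seteq[symmetric]) auto
      then show ?thesis using z by blast
    qed
    obtain e where e: "e \<in> W" "E `` {o2} - U = {e}" using liveU[of o2] oo ZU costo2 by auto
    have "card (E `` {o2} - Z) = 2" using NZ'(3)[OF o'] deg3[OF o'] by simp
    moreover have "E `` {o2} - Z \<subseteq> {e} \<union> (E `` {o2} \<inter> {c0, d0})" using e unfolding U_def by auto
    ultimately have "E `` {o2} \<inter> {c0, d0} \<noteq> {}"
      by (metis One_nat_def Suc_1 Un_empty_right card_mono finite.emptyI finite.insertI is_singletonI is_singleton_altdef not_less_eq_eq order_refl)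
    then obtain c d where cd: "{c, d} = {c0, d0}" "c \<in> E `` {o2}" by auto
    have Ucd: "U = Z \<union> {c, d}" unfolding U_def using cd by auto
    have cd': "c \<noteq> d" "c \<notin> Z" "d \<notin> Z" "c \<in> E `` {o1}" "d \<in> E `` {o1}" "cost U c = 3" "cost U d = 3"
      using cd cd0 ccd by (auto simp: doubleton_eq_iff)
    have cdW: "c \<in> W" "d \<in> W"
      using cost_free[of c o1 U] cost_free[of d o1 U] cd' oo ZU E_V[of o1 c] E_V[of o1 d] by auto
    have No1: "E `` {o1} = {w, c, d}" using NZ'(1)[OF o] cd0(1) cd(1) by blast
    have "w \<in> E `` {o2}" "w \<in> Z" using NZ'(1)[OF o'] Zo by auto
    have No2: "E `` {o2} = {w, c, e}"
    proof (rule card_subset_eq[symmetric])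
      have "w \<noteq> c" "w \<noteq> e" "c \<noteq> e" using \<open>w \<in> Z\<close> cd' e ZU Ucd by auto
      then show "card {w, c, e} = card (E `` {o2})" using deg3[OF o'] by simp
    qed (use \<open>w \<in> E `` {o2}\<close> cd e in auto)
    have eU': "e \<notin> U" using e by auto
    have vcd: "v \<notin> {c, d}"
    proof
      assume "v \<in> {c, d}"
      then have "cost U f + 1 \<le> cost Z f"
        using Nf wv f cd' Ucd by (intro cost_drop[of _ _ _ v]) auto
      then show False using nokill[of f] oo Zo by auto
    qed
    have fcd: "(f, c) \<notin> E" "(f, d) \<notin> E" using vcd Nf cd' Zo by auto
    have wcd: "(w, c) \<notin> E" "(w, d) \<notin> E" using Nw cd' Zeq by auto
    obtain d' where d': "d' \<in> W" "E `` {d} - U = {d'}" using liveU[of d] cdW cd' Ucd by auto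
    obtain c' where c': "c' \<in> W" "E `` {c} - U = {c'}" using liveU[of c] cdW cd' Ucd by auto
    have "d \<noteq> e" using eU' Ucd by auto
    then have "(o2, d) \<notin> E" using No2 cd' \<open>w \<in> Z\<close> by auto
    then have "E `` {d} \<inter> U \<subseteq> {o1, c}"
      using fcd wcd E_sym irrefl_E unfolding Ucd Zo by auto
    then have "E `` {d} \<subseteq> {o1, c, d'}" using d' by auto
    then have Nd: "E `` {d} = {o1, c, d'}" using N_eq_insert2[OF cdW(2)] by auto
    have "E `` {c} \<inter> U \<subseteq> {o1, o2, d}" using fcd wcd E_sym irrefl_E unfolding Ucd Zo by auto
    then have "E `` {c} \<subseteq> {o1, o2, d, c'}" using c' by auto
    moreover have "(o1, c) \<in> E" "(o2, c) \<in> E" "(d, c) \<in> E" using No1 No2 Nd by blast+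
    then have "{o1, o2, d} \<subseteq> E `` {c}" using E_sym by blast
    moreover have "c' \<in> E `` {c}" using c'(2) by blast
    ultimately have Nc: "E `` {c} = {o1, o2, d, c'}" by blast
    show ?thesis
    proof (intro exI conjI)
      show "E `` {o1} = {w, c, d}" by (rule No1)
      show "E `` {o2} = {w, c, e}" by (rule No2)
      show "E `` {c} = {o1, o2, d, c'}" by (rule Nc)
      show "E `` {d} = {o1, c, d'}" by (rule Nd)
      show "{c, d} \<inter> Z = {}" using cd' by blast
      show "e \<notin> Z \<union> {c, d}" using eU' unfolding Ucd .
      show "d' \<notin> Z \<union> {c, d}" using d'(2) unfolding Ucd by blast
    qed (use cdW e(1) d'(1) cd' vcd stU pU costo2 in \<open>simp_all only: Ucd not_False_eq_True\<close>)
  qed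
  obtain c d e c' d' where H1: "E `` {a} = {w, c, d} \<and> E `` {b} = {w, c, e} \<and> E `` {c} = {a, b, d, c'} \<and>
      E `` {d} = {a, c, d'} \<and> c \<in> W \<and> d \<in> W \<and> e \<in> W \<and> d' \<in> W \<and> {c, d} \<inter> Z = {} \<and> c \<noteq> d \<and>
      e \<notin> Z \<union> {c, d} \<and> d' \<notin> Z \<union> {c, d} \<and> v \<notin> {c, d} \<and> state (Z \<union> {c, d}) 2 \<and> potential (Z \<union> {c, d}) 2 \<ge> - 2 \<and>
      cost (Z \<union> {c, d}) b = 3 \<and> cost (Z \<union> {c, d}) c = 3 \<and> cost (Z \<union> {c, d}) d = 3"
    using half[of a b] by (elim meta_impE exE) (rule refl, rule that)
  then have 1: "E `` {a} = {w, c, d}" "E `` {b} = {w, c, e}" "E `` {c} = {a, b, d, c'}"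
      "E `` {d} = {a, c, d'}" "c \<in> W" "d \<in> W" "e \<in> W" "d' \<in> W" "{c, d} \<inter> Z = {}" "c \<noteq> d"
      "e \<notin> Z \<union> {c, d}" "d' \<notin> Z \<union> {c, d}" "v \<notin> {c, d}"
    and st: "state (Z \<union> {c, d}) 2" and pot: "potential (Z \<union> {c, d}) 2 \<ge> - 2"
    and costs: "cost (Z \<union> {c, d}) b = 3" "cost (Z \<union> {c, d}) c = 3" "cost (Z \<union> {c, d}) d = 3"
    by - (elim conjE, assumption)+
  obtain c2 d2 e2 c2' e' where H2: "E `` {b} = {w, c2, d2} \<and> E `` {a} = {w, c2, e2} \<and> E `` {c2} = {b, a, d2, c2'} \<and>
      E `` {d2} = {b, c2, e'} \<and> c2 \<in> W \<and> d2 \<in> W \<and> e2 \<in> W \<and> e' \<in> W \<and> {c2, d2} \<inter> Z = {} \<and> c2 \<noteq> d2 \<and>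
      e2 \<notin> Z \<union> {c2, d2} \<and> e' \<notin> Z \<union> {c2, d2} \<and> v \<notin> {c2, d2} \<and> state (Z \<union> {c2, d2}) 2 \<and> potential (Z \<union> {c2, d2}) 2 \<ge> - 2 \<and>
      cost (Z \<union> {c2, d2}) a = 3 \<and> cost (Z \<union> {c2, d2}) c2 = 3 \<and> cost (Z \<union> {c2, d2}) d2 = 3"
    using half[of b a] by (elim meta_impE exE) (rule insert_commute, rule that)
  then have 2: "E `` {b} = {w, c2, d2}" "E `` {a} = {w, c2, e2}" "E `` {c2} = {b, a, d2, c2'}"
      "E `` {d2} = {b, c2, e'}" "{c2, d2} \<inter> Z = {}" "c2 \<noteq> d2" "e' \<in> W" "e' \<notin> Z \<union> {c2, d2}"
    by - (elim conjE, assumption)+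
  have wZ: "w \<in> Z" using Zeq by auto
  have "c2 \<in> {w, c, d}" "c2 \<in> {w, c, e}" "c2 \<noteq> w" using 1(1,2) 2(1,2,5) wZ by auto
  \<comment> \<open>The two applications of \<open>half\<close> describe the same neighbourhoods of
    \<open>a\<close> and \<open>b\<close>, so their shared vertex is the same and the private
    neighbour \<open>d2\<close> of \<open>b\<close> is \<open>e\<close>.\<close>
  then have c2: "c2 = c" using 1(11) by auto
  have "d2 \<in> {w, c, e}" "d2 \<noteq> w" using 1(2) 2(1,5) wZ by auto
  then have d2: "d2 = e" using 2(6) c2 by auto
  have Ne: "E `` {e} = {b, c, e'}" using 2(4) c2 d2 by simp
  have "e \<in> E `` {c}" using 2(3) c2 d2 by auto
  then have "e = c'" using 1(3,11) Zeq by auto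
  then have Nc: "E `` {c} = {a, b, d, e}" using 1(3) by simp
  define U where "U = Z \<union> {c, d}"
  have Ueq: "U = {f, w, a, b, c, d}" unfolding U_def Zeq by auto
  have stU: "state U 2" and pU: "potential U 2 \<ge> - 2" and costU: "cost U b = 3" "cost U c = 3" "cost U d = 3"
    using st pot costs unfolding U_def by auto
  have notU: "e \<notin> U" "d' \<notin> U" "e' \<notin> {f, w, a, b, c, e}"
    using 1(11,12) 2(8) c2 d2 unfolding U_def Zeq by auto
  have neq: "distinct [w, a, b, c, d, e]" using abY ab(2) 1(9,10) notU(1) unfolding Ueq Zeq by auto
  show False
  proof (cases "d' = e")
    case True
    then have "(e, d) \<in> E" using 1(4) E_sym by blast
    then have "d \<in> {b, c, e'}" using Ne by auto
    then have Ne': "E `` {e} = {b, c, d}" using Ne neq by auto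
    \<comment> \<open>Attaching \<open>e\<close> makes \<open>b\<close>, \<open>c\<close> and
      \<open>d\<close> dead at once: \<open>- 2 + 3 - 2 = - 1\<close>.\<close>
    have dead: "cost (insert e U) b = 2" "cost (insert e U) c = 2" "cost (insert e U) d = 2" "cost (insert e U) e = 2"
    proof -
      show "cost (insert e U) b = 2" by (rule cost_dead[OF aW(2)], unfold 1(2) Ueq) blast
      show "cost (insert e U) c = 2" by (rule cost_dead[OF 1(5)], unfold Nc Ueq) blast
      show "cost (insert e U) d = 2" by (rule cost_dead[OF 1(6)], unfold 1(4) Ueq True) blast
      show "cost (insert e U) e = 2" by (rule cost_dead[OF 1(7)], unfold Ne' Ueq) blast
    qed
    have stU': "state (insert e U) 2"
    proof (rule state_attach[OF stU _ _ notU(1)])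
      show "(b, e) \<in> E" using 1(2) by blast
    qed (simp add: Ueq)
    have diff: "insert e U - U = {e}" using notU by auto
    have bU: "b \<in> U" and K: "{c, d} \<subseteq> U - {b}" and cd: "c \<noteq> d" using neq Ueq by auto
    have drop: "cost (insert e U) x + 1 \<le> cost U x" if "x \<in> {c, d}" for x using that dead costU by auto
    from potential_step[OF subset_insertI state_finite[OF stU'] bU K drop, of 2 2]
    have "potential (insert e U) 2 \<ge> - 1" unfolding diff using dead costU pU cd by simp
    then show False using no[OF stU'] by auto
  next
    case False
    have "e' \<noteq> d"
    proof
      assume "e' = d"
      then have "(d, e) \<in> E" using Ne E_sym by blast
      then show False using 1(4,11) False Zeq by auto
    qed
    have bud: "bud E W f w a b c d e d' e'"
      unfolding bud_def
    proof (intro conjI)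
      show "{w, a, b, c, d, e} \<subseteq> W" using wv aW 1 by blast
      then have "f \<notin> {w, a, b, c, d, e}" using f by blast
      then show "{f, d', e'} \<inter> {w, a, b, c, d, e} = {}" using notU False \<open>e' \<noteq> d\<close> unfolding Ueq by blast
    qed (fact neq Nw 1 Nc Ne)+
    \<comment> \<open>\<open>f\<close> is free while \<open>d'\<close> and \<open>e'\<close> are
      counted, so only the alternative \<open>d' = e'\<close> of \<open>no_bud\<close> is
      left.\<close>
    have de: "d' = e'" using no_bud[OF bud] f 1(8) 2(7) by auto
    show False
    proof (cases "d' = v")
      case True
      \<comment> \<open>By \<open>enter\<close>, \<open>v\<close> has degree 3, so the bud closes to
        a forbidden blossom.\<close>
      then show False using no_obstacle bud de enter(3)[of v] 1(8) unfolding no_obstacle_def by blast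
    next
      case dv: False
      define Q where "Q = insert d' U"
      have stQ: "state Q 2" unfolding Q_def
      proof (rule state_attach[OF stU _ _ notU(2)])
        show "(d, d') \<in> E" using 1(4) by blast
      qed (simp add: Ueq)
      have deadd: "cost Q d = 2" by (rule cost_dead[OF 1(6)], unfold 1(4) Q_def Ueq) blast
      have diff: "Q - U = {d'}" and UQ: "U \<subseteq> Q" and dU: "d \<in> U" using notU unfolding Q_def Ueq by auto
      from potential_step[OF UQ state_finite[OF stQ] dU empty_subsetI, of 2 2]
      have pQ: "potential Q 2 + cost Q d' - 2 \<ge> - 3" unfolding diff using deadd costU pU by simp
      have "d' \<noteq> w" using notU Ueq by auto
      then have "(f, d') \<notin> E" "(w, d') \<notin> E" "(a, d') \<notin> E" "(b, d') \<notin> E" "(c, d') \<notin> E"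
        using Nf dv Nw 1(1,2) Nc notU(2) False unfolding Ueq by blast+
      then have "E `` {d'} \<inter> U \<subseteq> {d}" using E_sym unfolding Ueq by blast
      moreover have "E `` {d'} - Q = E `` {d'} - U" using irrefl_E unfolding Q_def by auto
      ultimately have "E `` {d'} - {d} \<subseteq> E `` {d'} - Q" by auto
      then have "card (E `` {d'} - {d}) \<le> card (E `` {d'} - Q)" by (intro card_mono) auto
      moreover have "card (E `` {d'} - {d}) \<ge> 2" using deg_W[OF 1(8)] by (simp add: card_Diff_singleton_if) arith
      ultimately have k: "card (E `` {d'} - Q) \<ge> 2" by linarith
      let ?S = "E `` {d'} - Q"
      have "(e, d') \<in> E" using Ne de by blast
      then have eS: "e \<in> ?S" using E_sym notU False unfolding Q_def by blast
      have QS: "{f, w, a, b, c, d, e, d'} \<subseteq> Q \<union> ?S" using eS unfolding Q_def Ueq by blast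
      have bce: "cost (Q \<union> ?S) b = 2" "cost (Q \<union> ?S) c = 2" "cost (Q \<union> ?S) e = 2"
      proof -
        show "cost (Q \<union> ?S) b = 2" by (rule cost_dead[OF aW(2)]) (use 1(2) QS in blast)
        show "cost (Q \<union> ?S) c = 2" by (rule cost_dead[OF 1(5)]) (use Nc QS in blast)
        show "cost (Q \<union> ?S) e = 2" by (rule cost_dead[OF 1(7)]) (use Ne de QS in blast)
      qed
      have eQ: "e \<notin> Q" using eS by blast
      have live: "cost Q b = 3" "cost Q c = 3"
      proof -
        show "cost Q b = 3" by (rule cost_live[OF aW(2)]) (use 1(2,7) eQ in blast)
        show "cost Q c = 3" by (rule cost_live[OF 1(5)]) (use Nc 1(7) eQ in blast)
      qed
      have bc: "b \<noteq> c" "{b, c} \<subseteq> Q - {d'}" using neq notU unfolding Q_def Ueq by auto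
      have dQ: "d' \<in> Q" and Sne: "?S \<noteq> {}" using eS unfolding Q_def by blast+
      have drop: "cost (Q \<union> ?S) x + 1 \<le> cost Q x" if "x \<in> {b, c}" for x using that bce live by auto
      note res = expand_step[OF stQ dQ 1(8) refl Sne bc(2) drop pQ]
      \<comment> \<open>With \<open>s\<close> children of \<open>d'\<close>:
        \<open>- 3 + 6 * (s - 1)\<close>, plus 2 for \<open>b\<close> and \<open>c\<close>, minus 2
        for the dead child \<open>e\<close> and at most 3 for each other one. This is
        \<open>3 * s - 6\<close>.\<close>
      have "(\<Sum>d\<in>?S. cost (Q \<union> ?S) d) = cost (Q \<union> ?S) e + (\<Sum>d\<in>?S - {e}. cost (Q \<union> ?S) d)"
        using eS by (intro sum.remove) auto
      also have "\<dots> \<le> 2 + 3 * int (card (?S - {e}))"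
        using sum_cost_children[of "?S - {e}" d' "Q \<union> ?S"] bce unfolding Q_def by auto
      also have "card (?S - {e}) = card ?S - 1" using eS by simp
      finally have "potential (Q \<union> ?S) (2 + card ?S - 1) \<ge> - 1" using res(2) bc(1) k by simp
      then show False using no[OF res(1)] eS by auto
    qed
  qed
qed

end

subsection \<open>Reductions and the weighted theorem\<close>

text \<open>\<open>k\<close> is the loss in three times the leaf count: 0 belongs to the summand 2
  and 2 to the summand 4/3.\<close>

definition rich :: "'a rel \<Rightarrow> 'a set \<Rightarrow> nat \<Rightarrow> bool" where
  "rich E W k \<longleftrightarrow> (\<exists>F. uforest F \<and> F \<subseteq> E \<and> card W \<le> 3 * excess W F + k)"

text \<open>
  Under the assumption \<open>low\<close> the bound holds without an error term, since growing can start at a free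
  vertex of degree at most 2.
\<close>

definition low :: "'a set \<Rightarrow> 'a rel \<Rightarrow> 'a set \<Rightarrow> bool" where
  "low V E W \<longleftrightarrow> (\<forall>w\<in>W. \<exists>f\<in>V - W. card (E `` {f}) \<le> 2 \<and> (w, f) \<in> E\<^sup>*)"

definition conn :: "'a set \<Rightarrow> 'a rel \<Rightarrow> bool" where
  "conn V E \<longleftrightarrow> (\<forall>u\<in>V. \<forall>v\<in>V. (u, v) \<in> E\<^sup>*)"

section \<open>Obstacles under contraction and deletion\<close>

lemma neck_W: "neck E W x u c A P \<Longrightarrow> c \<in> W \<and> A \<subseteq> W"
  by (induction rule: neck.induct) auto

text \<open>Contraction is the case where \<open>r\<close> collapses a set, deletion the case
  \<open>r = id\<close>. All vertices of an obstacle except its entry \<open>x\<close> or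
  \<open>t\<close> are counted and fixed by \<open>r\<close>; the entry may be a collapsed set, and
  injectivity on neighbourhoods picks out its preimage.\<close>

lemma no_obstacle_image:
  assumes G: "wgraph V E W" and no: "no_obstacle E W" and W': "W' \<subseteq> W"
    and img: "\<And>v. v \<in> W' \<Longrightarrow> E' `` {v} = r ` (E `` {v})"
    and inj: "\<And>v. v \<in> W' \<Longrightarrow> inj_on r (E `` {v})"
    and fixr: "\<And>n. r n \<in> W' \<Longrightarrow> r n = n" "\<And>n. n \<in> W' \<Longrightarrow> r n = n"
  shows "no_obstacle E' W'"
proof -
  interpret wgraph V E W by (rule G)
  have eqW: "S = T" if "r ` S = T" "T \<subseteq> W'" for S T
  proof -
    have "r n = n" if "n \<in> S" for n using that \<open>r ` S = T\<close> \<open>T \<subseteq> W'\<close> fixr(1) by blast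
    then have "r ` S = S" by auto
    with that show ?thesis by simp
  qed
  have eqN: "E `` {v} = T" if "E' `` {v} = T" "T \<subseteq> W'" "v \<in> W'" for v T
    using eqW[of "E `` {v}" T] img[OF that(3)] that by simp
  have eq1: "\<exists>t0. S = insert t0 T \<and> r t0 = t" if S: "r ` S = insert t T" "T \<subseteq> W'" "inj_on r S" for S T t
  proof -
    from S(1) obtain t0 where t0: "t0 \<in> S" "r t0 = t" by (metis imageE insertI1)
    have "T \<subseteq> S"
    proof
      fix n assume n: "n \<in> T"
      then obtain k where k: "k \<in> S" "r k = n" using S(1) by (metis imageE insertI2)
      then show "n \<in> S" using fixr(1)[of k] n S(2) by auto
    qed
    moreover have "n \<in> insert t0 T" if n: "n \<in> S" for n
    proof (cases "r n = t")
      case True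
      then show ?thesis using inj_onD[OF S(3)] n t0 by auto
    next
      case False
      then have "r n \<in> T" using n S(1) by blast
      then show ?thesis using fixr(1)[of n] S(2) by auto
    qed
    ultimately show ?thesis using t0 by blast
  qed
  have lift: "\<exists>y P0. neck E W y u c A P0 \<and> r y = x \<and> r ` P0 = P" if "neck E' W' x u c A P" for x u c A P
    using that
  proof (induction rule: neck.induct)
    case start
    then have "x \<in> E' `` {u}" by blast
    then obtain y where "(u, y) \<in> E" "r y = x" using img[OF start(1)] by auto
    then show ?case
      using neck.start[of u W y E] start W' irrefl_E[of u]
      by (intro exI[of _ y] exI[of _ "{y}"]) auto
  next
    case (step c A P a b g)
    from step.IH obtain y P0 where nk: "neck E W y u c A P0" and y: "r y = x" "r ` P0 = P" by blast
    have c: "c \<in> W'" "A \<subseteq> W'" using neck_W[OF step.hyps(1)] by auto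
    note P0 = neck_facts(5)[OF nk]
    have r: "r ` (E `` {c}) = P \<union> {a, b}" using img[OF c(1)] step.hyps(2) by simp
    have "E `` {c} = P0 \<union> {a, b}"
    proof (intro equalityI subsetI)
      fix n assume n: "n \<in> E `` {c}"
      then have "r n \<in> P \<union> {a, b}" using r by blast
      then consider "r n \<in> r ` P0" | "r n \<in> {a, b}" using y(2) by blast
      then show "n \<in> P0 \<union> {a, b}"
      proof cases
        case 1
        then show ?thesis using inj_on_image_mem_iff[OF inj[OF c(1)] n P0] by blast
      next
        case 2
        then show ?thesis using fixr(1)[of n] step.hyps(4,5) by auto
      qed
    next
      fix n assume "n \<in> P0 \<union> {a, b}"
      then show "n \<in> E `` {c}"
      proof
        assume n: "n \<in> {a, b}"
        then have "n \<in> r ` (E `` {c})" using r by blast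
        then obtain k where k: "k \<in> E `` {c}" "r k = n" by blast
        moreover have "n \<in> W'" using n step.hyps(4,5) by blast
        ultimately show ?thesis using fixr(1)[of k] by simp
      qed (use P0 in blast)
    qed
    moreover have "E `` {a} = {c, b, g}" "E `` {b} = {c, a, g}"
      using step.hyps(4-8) c by (intro eqN; simp)+
    moreover have "y \<notin> {a, b, g}"
    proof
      assume "y \<in> {a, b, g}"
      then have "x = y" using fixr(2)[of y] y step.hyps(4-6) by auto
      then show False using step.hyps(9) \<open>y \<in> {a, b, g}\<close> by blast
    qed
    ultimately have "neck E W y u g (A \<union> {c, a, b}) {a, b}"
      using step.hyps(3-6,9) W' by (intro neck.step[OF nk]) auto
    moreover have "r ` {a, b} = {a, b}" using fixr(2) step.hyps(4,5) by simp
    ultimately show ?case using y(1) by blast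
  qed
  have card_eq: "card (E' `` {v}) = card (E `` {v})" if "v \<in> W'" for v
    using img[OF that] inj[OF that] by (simp add: card_image)
  show ?thesis
    unfolding no_obstacle_def
  proof (intro conjI allI impI)
    fix x u c A P
    assume nk: "neck E' W' x u c A P" "A \<noteq> {}"
    then show "card (E' `` {c}) \<noteq> 3"
      using lift[OF nk(1)] neck_W[OF nk(1)] card_eq no unfolding no_obstacle_def by metis
  next
    fix t y a b c d e g
    assume b: "bud E' W' t y a b c d e g g" and g: "g \<in> W'"
    have sub: "{y, a, b, c, d, e} \<subseteq> W'" using b by (simp add: bud_def)
    have disj: "{t, g, g} \<inter> {y, a, b, c, d, e} = {}" using b unfolding bud_def by (elim conjE)
    have "r ` (E `` {y}) = insert t {a, b}" using img[of y] b unfolding bud_def by simp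
    then obtain t0 where t0: "E `` {y} = {t0, a, b}" "r t0 = t" using eq1[of "E `` {y}" t "{a, b}"] sub inj[of y] by auto
    have "E `` {a} = {y, c, d}" "E `` {b} = {y, c, e}" "E `` {c} = {a, b, d, e}" "E `` {d} = {a, c, g}"
      "E `` {e} = {b, c, g}"
      by (rule eqN; use b sub g in \<open>simp add: bud_def\<close>)+
    moreover have "t0 \<notin> {y, a, b, c, d, e}"
    proof
      assume t0X: "t0 \<in> {y, a, b, c, d, e}"
      with sub have "t0 \<in> W'" by (rule subsetD)
      then have "t0 = t" using fixr(2)[of t0] t0(2) by simp
      moreover have "t \<notin> {y, a, b, c, d, e}" using disj by blast
      ultimately show False using t0X by simp
    qed
    moreover have "{y, a, b, c, d, e} \<subseteq> W" using sub W' by (rule subset_trans)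
    moreover have "distinct [y, a, b, c, d, e]" using b by (simp add: bud_def)
    moreover have "g \<notin> {y, a, b, c, d, e}" using disj by blast
    ultimately have "bud E W t0 y a b c d e g g" using t0(1) unfolding bud_def by (intro conjI) simp_all
    then show "card (E' `` {g}) \<noteq> 3" using no g W' card_eq[OF g] unfolding no_obstacle_def by auto
  qed
qed

text \<open>
  By the last assumption, inside \<open>X\<close> a third of its size is gained
  whichever exit the forest uses.
\<close>

locale contraction = wgraph +
  fixes X :: "'a set" and x0 :: 'a
  assumes XW: "X \<subseteq> W" and x0X: "x0 \<in> X" and no: "no_obstacle E W"
    and exits_inj: "inj_on snd (E \<inter> X \<times> (- X))" and exits_ne: "E \<inter> X \<times> (- X) \<noteq> {}"
    and exits_card: "card (E \<inter> X \<times> (- X)) \<le> 3"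
    and inner: "(s, t) \<in> E \<Longrightarrow> s \<in> X \<Longrightarrow> t \<notin> X \<Longrightarrow> \<exists>T. uforest T \<and> T \<subseteq> E \<and> T \<subseteq> X \<times> X \<and>
      card X \<le> 3 * (\<Sum>v\<in>X. card (T `` {v} \<union> (if v = s then {t} else {})) - 2)"
begin

definition r :: "'a \<Rightarrow> 'a" where "r v = (if v \<in> X then x0 else v)"
definition E' :: "'a rel" where "E' = {(r a, r b) | a b. (a, b) \<in> E \<and> \<not> (a \<in> X \<and> b \<in> X)}"
definition V' :: "'a set" where "V' = V - X \<union> {x0}"
definition W' :: "'a set" where "W' = W - X"

lemma r_W': "r n \<in> W' \<Longrightarrow> r n = n" "n \<in> W' \<Longrightarrow> r n = n" "r a = v \<Longrightarrow> v \<notin> X \<Longrightarrow> a = v"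
  using x0X by (auto simp: r_def W'_def split: if_splits)

text \<open>Exit edges have different outer ends, so an outside vertex sees \<open>X\<close> at most
  once. Hence contraction creates no parallel edges and keeps the degree.\<close>

lemma N_outside:
  assumes "v \<notin> X" shows "E' `` {v} = r ` (E `` {v})" "inj_on r (E `` {v})"
proof -
  show "E' `` {v} = r ` (E `` {v})"
  proof (intro equalityI subsetI)
    fix q assume "q \<in> E' `` {v}"
    then obtain a b where ab: "(a, b) \<in> E" "r a = v" "r b = q" unfolding E'_def by auto
    then have "a = v" using r_W'(3) assms by blast
    with ab show "q \<in> r ` (E `` {v})" by (intro image_eqI[of _ _ b]) auto
  next
    fix q assume "q \<in> r ` (E `` {v})"
    then obtain b where b: "(v, b) \<in> E" "q = r b" by auto
    have "r v = v" using assms by (simp add: r_def)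
    with b assms show "q \<in> E' `` {v}" unfolding E'_def by force
  qed
  show "inj_on r (E `` {v})"
  proof (rule inj_onI)
    fix p q assume pq: "p \<in> E `` {v}" "q \<in> E `` {v}" "r p = r q"
    show "p = q"
    proof (cases "p \<in> X \<and> q \<in> X")
      case True
      then have "(p, v) \<in> E \<inter> X \<times> (- X)" "(q, v) \<in> E \<inter> X \<times> (- X)" using pq E_sym assms by auto
      from inj_onD[OF exits_inj _ this] show ?thesis by simp
    next
      case False
      then show ?thesis using pq(3) x0X by (auto simp: r_def split: if_splits)
    qed
  qed
qed

lemma N_x0: "E' `` {x0} = snd ` (E \<inter> X \<times> (- X))"
proof (intro equalityI subsetI)
  fix q assume "q \<in> E' `` {x0}"
  then obtain a b where ab: "(a, b) \<in> E" "r a = x0" "r b = q" "\<not> (a \<in> X \<and> b \<in> X)" unfolding E'_def by auto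
  then have "a \<in> X" using x0X by (auto simp: r_def split: if_splits)
  with ab have "b \<notin> X" "q = b" by (auto simp: r_def)
  with ab \<open>a \<in> X\<close> show "q \<in> snd ` (E \<inter> X \<times> (- X))" by force
next
  fix q assume "q \<in> snd ` (E \<inter> X \<times> (- X))"
  then obtain a where "(a, q) \<in> E" "a \<in> X" "q \<notin> X" by auto
  then have "r a = x0" "r q = q" by (auto simp: r_def)
  with \<open>(a, q) \<in> E\<close> \<open>q \<notin> X\<close> show "q \<in> E' `` {x0}" unfolding E'_def by force
qed

lemma wgraph': "wgraph V' E' W'"
proof
  have x0: "x0 \<notin> W'" using x0X by (simp add: W'_def)
  have card_out: "card (E' `` {v}) = card (E `` {v})" if "v \<notin> X" for v
    using N_outside[OF that] by (simp add: card_image)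
  show "finite V'" using finite_V by (simp add: V'_def)
  have "r a \<in> V'" if "a \<in> V" for a using that x0X by (auto simp: r_def V'_def)
  then show "E' \<subseteq> V' \<times> V'" using E_V unfolding E'_def by blast
  show "sym E'" unfolding sym_def E'_def using E_sym by blast
  show "(v, v) \<notin> E'" for v
    unfolding E'_def using x0X irrefl_E by (auto simp: r_def split: if_splits)
  show "W' \<subseteq> V'" using W_sub by (auto simp: W'_def V'_def)
  show "3 \<le> card (E' `` {w})" if "w \<in> W'" for w
    using that card_out[of w] deg_W[of w] by (auto simp: W'_def)
  show "card (E' `` {v}) \<le> 3" if "v \<in> V' - W'" for v
  proof (cases "v \<in> X")
    case True
    then have "v = x0" using that by (auto simp: V'_def)
    moreover have "card (E' `` {x0}) \<le> card (E \<inter> X \<times> (- X))"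
      unfolding N_x0 using finite_E by (intro card_image_le) auto
    ultimately show ?thesis using exits_card by simp
  next
    case False
    then have "v \<in> V - W" using that x0X by (auto simp: V'_def W'_def)
    then show ?thesis using card_out[OF False] deg_free[of v] by simp
  qed
qed

lemma no_obstacle': "no_obstacle E' W'"
  by (rule no_obstacle_image[OF wgraph_axioms no, of W' E' r])
    (use N_outside r_W' in \<open>auto simp: W'_def\<close>)

lemma path': "(a, b) \<in> E\<^sup>* \<Longrightarrow> (r a, r b) \<in> E'\<^sup>*"
proof (induction rule: rtrancl_induct)
  case (step y z)
  show ?case
  proof (cases "y \<in> X \<and> z \<in> X")
    case True
    then have "r y = r z" by (simp add: r_def)
    with step.IH show ?thesis by simp
  next
    case False
    then have "(r y, r z) \<in> E'" using step.hyps unfolding E'_def by blast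
    with step.IH show ?thesis by (rule rtrancl_into_rtrancl)
  qed
qed simp

lemma low': "low V E W \<Longrightarrow> low V' E' W'"
  unfolding low_def
proof
  fix w assume l: "\<forall>w\<in>W. \<exists>f\<in>V - W. card (E `` {f}) \<le> 2 \<and> (w, f) \<in> E\<^sup>*" and w: "w \<in> W'"
  then obtain f where f: "f \<in> V - W" "card (E `` {f}) \<le> 2" "(w, f) \<in> E\<^sup>*" unfolding W'_def by blast
  have fX: "f \<notin> X" using f(1) XW by blast
  have "r w = w" "r f = f" using w fX by (auto simp: r_def W'_def)
  with path'[OF f(3)] have "(w, f) \<in> E'\<^sup>*" by simp
  moreover have "card (E' `` {f}) \<le> 2" using N_outside[OF fX] f(2) by (simp add: card_image)
  ultimately show "\<exists>f\<in>V' - W'. card (E' `` {f}) \<le> 2 \<and> (w, f) \<in> E'\<^sup>*"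
    using f(1) fX unfolding V'_def W'_def by blast
qed

lemma conn': "conn V E \<Longrightarrow> conn V' E'"
  unfolding conn_def
proof (intro ballI)
  fix u v assume c: "\<forall>u\<in>V. \<forall>v\<in>V. (u, v) \<in> E\<^sup>*" and uv: "u \<in> V'" "v \<in> V'"
  have "u \<in> V" "v \<in> V" using uv x0X XW W_sub by (auto simp: V'_def)
  moreover have "r u = u" "r v = v" using uv by (auto simp: V'_def r_def)
  ultimately show "(u, v) \<in> E'\<^sup>*" using c path'[of u v] by simp
qed

text \<open>One edge is lifted for each edge of \<open>F'\<close>. Walks in the lifted forest map to
  walks in \<open>F'\<close>, with the edges of \<open>T\<close> collapsing to points, so no cycle
  is closed.\<close>

lemma lift_forest:
  assumes "uforest F'" "F' \<subseteq> E'" "uforest T" "T \<subseteq> E" "T \<subseteq> X \<times> X"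
  shows "\<exists>F. uforest F \<and> F \<subseteq> E \<and> T \<subseteq> F \<and> (\<forall>a b. (a, b) \<in> F \<longrightarrow> r a = r b \<or> (r a, r b) \<in> F') \<and>
    (\<forall>p q. (p, q) \<in> F' \<longrightarrow> (\<exists>a b. (a, b) \<in> F \<and> r a = p \<and> r b = q))"
  using assms(1,2)
proof (induction rule: uforest.induct)
  case empty
  have "r a = r b" if "(a, b) \<in> T" for a b using that assms(5) by (auto simp: r_def)
  then show ?case using assms(3,4) by blast
next
  case (edge F' p q)
  then obtain F where F: "uforest F" "F \<subseteq> E" "T \<subseteq> F" "\<And>a b. (a, b) \<in> F \<Longrightarrow> r a = r b \<or> (r a, r b) \<in> F'"
    "\<And>p q. (p, q) \<in> F' \<Longrightarrow> \<exists>a b. (a, b) \<in> F \<and> r a = p \<and> r b = q"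
    by (metis (no_types, lifting) insert_subset)
  have "(p, q) \<in> E'" using edge.prems by blast
  then obtain a b where ab: "(a, b) \<in> E" "r a = p" "r b = q" unfolding E'_def by blast
  have "(r x, r y) \<in> F'\<^sup>*" if "(x, y) \<in> F\<^sup>*" for x y
    using that
  proof (induction rule: rtrancl_induct)
    case (step y z)
    from F(4)[OF step.hyps(2)] show ?case
    proof
      assume "(r y, r z) \<in> F'"
      with step.IH show ?thesis by (rule rtrancl_into_rtrancl)
    qed (use step.IH in simp)
  qed simp
  then have "(a, b) \<notin> F\<^sup>*" using edge.hyps(2) ab by blast
  from uforest.edge[OF F(1) this] show ?case
  proof (intro exI[of _ "insert (a, b) (insert (b, a) F)"] conjI allI impI)
    show "insert (a, b) (insert (b, a) F) \<subseteq> E" using F(2) ab(1) E_sym by blast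
    show "T \<subseteq> insert (a, b) (insert (b, a) F)" using F(3) by blast
    show "r x = r y \<or> (r x, r y) \<in> insert (p, q) (insert (q, p) F')"
      if "(x, y) \<in> insert (a, b) (insert (b, a) F)" for x y
      using that F(4)[of x y] ab by auto
    show "\<exists>x y. (x, y) \<in> insert (a, b) (insert (b, a) F) \<and> r x = p' \<and> r y = q'"
      if "(p', q') \<in> insert (p, q) (insert (q, p) F')" for p' q'
      using that F(5)[of p' q'] ab by blast
  qed
qed

text \<open>A maximal forest does not leave \<open>x0\<close> isolated, so some exit edge
  \<open>st\<close> gets lifted, and \<open>inner\<close> is applied to this exit. Degrees outside
  \<open>X\<close> do not decrease under lifting.\<close>

lemma rich':
  assumes "rich E' W' k"
  shows "rich E W k"
proof -
  interpret G': wgraph V' E' W' by (rule wgraph')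
  obtain F0 where F0: "uforest F0" "F0 \<subseteq> E'" "card W' \<le> 3 * excess W' F0 + k"
    using assms unfolding rich_def by blast
  obtain F' where F': "uforest F'" "F0 \<subseteq> F'" "F' \<subseteq> E'" "E' \<subseteq> F'\<^sup>*"
    using uforest_extend[OF G'.finite_E G'.sym_E F0(1,2)] by blast
  have ex0: "excess W' F0 \<le> excess W' F'" using excess_mono[OF F'(2) uforest_finite[OF F'(1)]] .
  obtain t1 where t1: "(x0, t1) \<in> E'" using exits_ne N_x0 by blast
  then have "(x0, t1) \<in> F'\<^sup>*" "x0 \<noteq> t1" using F'(4) G'.irrefl_E by auto
  then obtain t where t: "(x0, t) \<in> F'" by (meson converse_rtranclE)
  then have "t \<in> snd ` (E \<inter> X \<times> (- X))" using F'(3) N_x0 by blast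
  then obtain s where s: "(s, t) \<in> E" "s \<in> X" "t \<notin> X" by auto
  obtain T where T: "uforest T" "T \<subseteq> E" "T \<subseteq> X \<times> X"
    "card X \<le> 3 * (\<Sum>v\<in>X. card (T `` {v} \<union> (if v = s then {t} else {})) - 2)"
    using inner[OF s] by blast
  obtain F where F: "uforest F" "F \<subseteq> E" "T \<subseteq> F"
    "\<And>p q. (p, q) \<in> F' \<Longrightarrow> \<exists>a b. (a, b) \<in> F \<and> r a = p \<and> r b = q"
    using lift_forest[OF F'(1,3) T(1-3)] by blast
  have fin: "finite (F `` {v})" for v using uforest_finite[OF F(1)] by (rule finite_Image)
  have "(s, t) \<in> F"
  proof -
    obtain a b where ab: "(a, b) \<in> F" "r a = x0" "r b = t" using F(4)[OF t] by blast
    then have "b = t" using r_W'(3) s(3) by blast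
    moreover have "a \<in> X" using ab(2) x0X by (auto simp: r_def split: if_splits)
    ultimately have "(a, t) \<in> E \<inter> X \<times> (- X)" using ab(1) F(2) s(3) by auto
    then have "a = s" using inj_onD[OF exits_inj, of "(a, t)" "(s, t)"] s by auto
    with ab \<open>b = t\<close> show ?thesis by simp
  qed
  then have inX: "card (T `` {v} \<union> (if v = s then {t} else {})) - 2 \<le> card (F `` {v}) - 2" for v
    using F(3) by (intro diff_le_mono card_mono[OF fin]) auto
  have outX: "card (F' `` {v}) - 2 \<le> card (F `` {v}) - 2" if v: "v \<in> W'" for v
  proof -
    have "F' `` {v} \<subseteq> r ` (F `` {v})"
    proof
      fix q assume "q \<in> F' `` {v}"
      then obtain a b where ab: "(a, b) \<in> F" "r a = v" "r b = q" using F(4)[of v q] by auto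
      then have "a = v" using r_W'(3)[of a v] v by (auto simp: W'_def)
      with ab show "q \<in> r ` (F `` {v})" by (intro image_eqI[of _ _ b]) auto
    qed
    then have "card (F' `` {v}) \<le> card (r ` (F `` {v}))" by (rule card_mono[rotated]) (use fin in auto)
    also have "\<dots> \<le> card (F `` {v})" by (rule card_image_le[OF fin])
    finally show ?thesis by simp
  qed
  have finX: "finite X" "finite W'" using finite_W XW finite_subset by (auto simp: W'_def)
  have WX: "W = W' \<union> X" "W' \<inter> X = {}" using XW by (auto simp: W'_def)
  have "excess W' F' \<le> (\<Sum>v\<in>W'. card (F `` {v}) - 2)" unfolding excess_def by (rule sum_mono) (rule outX)
  moreover have "card X \<le> 3 * (\<Sum>v\<in>X. card (F `` {v}) - 2)"
    using T(4) sum_mono[of X "\<lambda>v. card (T `` {v} \<union> (if v = s then {t} else {})) - 2" "\<lambda>v. card (F `` {v}) - 2"]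
      inX by fastforce
  moreover have "excess W F = (\<Sum>v\<in>W'. card (F `` {v}) - 2) + (\<Sum>v\<in>X. card (F `` {v}) - 2)"
  proof -
    have "excess W F = (\<Sum>v\<in>W' \<union> X. card (F `` {v}) - 2)"
      unfolding excess_def by (rule sum.cong[OF WX(1) refl])
    also have "\<dots> = (\<Sum>v\<in>W'. card (F `` {v}) - 2) + (\<Sum>v\<in>X. card (F `` {v}) - 2)"
      by (rule sum.union_disjoint[OF finX(2,1) WX(2)])
    finally show ?thesis .
  qed
  moreover have "card W = card W' + card X"
    using arg_cong[OF WX(1), of card] card_Un_disjoint[OF finX(2,1) WX(2)] by simp
  ultimately have "card W \<le> 3 * excess W F + k" using F0(3) ex0 by linarith
  then show ?thesis using F(1,2) unfolding rich_def by blast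
qed

end

section \<open>Forests inside chains, clusters and buds\<close>

context wgraph
begin

text \<open>Each diamond yields one unit for the three vertices \<open>c\<close>, \<open>a\<close>,
  \<open>b\<close>: \<open>a\<close> is joined to all of \<open>c\<close>, \<open>b\<close>,
  \<open>g\<close>. This leaves an edge at the end \<open>g\<close>, on which a closing triangle can
  build.\<close>

lemma neck_forest:
  assumes "neck E W x u c A P"
  shows "\<exists>T. uforest T \<and> T \<subseteq> E \<and> T \<subseteq> insert c A \<times> insert c A \<and>
    card A \<le> 3 * (\<Sum>v\<in>A. card (T `` {v}) - 2) \<and> (A \<noteq> {} \<longrightarrow> T `` {c} \<noteq> {})"
  using assms
proof (induction rule: neck.induct)
  case start
  show ?case by (rule exI[of _ "{}"]) (auto intro: uforest.empty)
next
  case (step c A P a b g)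
  from step.IH obtain T where T: "uforest T" "T \<subseteq> E" "T \<subseteq> insert c A \<times> insert c A"
    "card A \<le> 3 * (\<Sum>v\<in>A. card (T `` {v}) - 2)" by blast
  note nf = neck_facts[OF step.hyps(1)]
  let ?A = "A \<union> {c, a, b}"
  let ?T1 = "insert (c, a) (insert (a, c) T)"
  let ?T2 = "?T1 \<union> {a} \<times> {b, g} \<union> {b, g} \<times> {a}"
  have ne: "a \<notin> insert c A" "b \<notin> insert c A" "g \<notin> insert c A" "a \<noteq> b" "g \<noteq> a" "g \<noteq> b"
  proof -
    show "a \<notin> insert c A" "b \<notin> insert c A" "g \<notin> insert c A" using step.hyps(9) by blast+
    show "a \<noteq> b" by (rule step.hyps(3))
    have "g \<in> E `` {a}" "g \<in> E `` {b}" unfolding step.hyps(7,8) by simp_all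
    then show "g \<noteq> a" "g \<noteq> b" using irrefl_E by auto
  qed
  have ca: "(c, a) \<in> E" "(a, c) \<in> E" "(a, b) \<in> E" "(b, a) \<in> E" "(a, g) \<in> E" "(g, a) \<in> E"
    using step.hyps(2,7) E_sym by blast+
  have T1: "uforest ?T1" by (rule uforest_attach[OF T(1,3) ne(1)]) (use ne in auto)
  have T2: "uforest ?T2"
    by (rule uforest_attach_set[OF T1, of "insert a (insert c A)"]) (use T(3) ne in auto)
  have fin: "finite (?T2 `` {v})" for v using uforest_finite[OF T2] by (rule finite_Image)
  have finA: "finite A" using nf(1) finite_W finite_subset by blast
  have "T `` {a} = {}" using T(3) ne(1) by blast
  then have "?T2 `` {a} = {c, b, g}" using ne by auto
  moreover have "card {c, b, g} = 3" using ne by auto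
  ultimately have "card (?T2 `` {a}) = 3" by (simp only:)
  then have "(\<Sum>v\<in>A. card (T `` {v}) - 2) + 1 \<le> (\<Sum>v\<in>A. card (?T2 `` {v}) - 2) + (card (?T2 `` {a}) - 2)"
    by (intro add_mono sum_mono diff_le_mono card_mono[OF fin]) auto
  also have "\<dots> = (\<Sum>v\<in>insert a A. card (?T2 `` {v}) - 2)" using ne finA by simp
  also have "\<dots> \<le> (\<Sum>v\<in>?A. card (?T2 `` {v}) - 2)" using finA by (intro sum_mono2) auto
  finally have "(\<Sum>v\<in>A. card (T `` {v}) - 2) + 1 \<le> (\<Sum>v\<in>?A. card (?T2 `` {v}) - 2)" .
  moreover have "card ?A = card A + 3" using nf(3) ne finA by auto
  ultimately have "card ?A \<le> 3 * (\<Sum>v\<in>?A. card (?T2 `` {v}) - 2)" using T(4) by linarith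
  moreover have "?T2 \<subseteq> E" using T(2) ca by blast
  moreover have "?T2 \<subseteq> insert g ?A \<times> insert g ?A" using T(3) by blast
  moreover have "?T2 `` {g} \<noteq> {}" by blast
  ultimately show ?case using T2 by blast
qed

text \<open>A bare triangle is spanned by a star at the vertex \<open>s\<close> of the given exit,
  which thus gets degree 3. Behind diamonds, \<open>c\<close> already has an edge of the chain and
  reaches degree 3 through \<open>p\<close> and \<open>r\<close>, whatever the exit is.\<close>

lemma cluster_contraction:
  assumes no: "no_obstacle E W" and cl: "cluster E W x u c A P p r p' r'"
  shows "contraction V E W (A \<union> {c, p, r}) c"
proof -
  have nk: "neck E W x u c A P" and Nc: "E `` {c} = P \<union> {p, r}" and pr: "p \<noteq> r" "p \<in> W" "r \<in> W"
    and Np: "E `` {p} = {c, r, p'}" and Nr: "E `` {r} = {c, p, r'}" and p'r': "p' \<noteq> r'" "p' \<noteq> r" "r' \<noteq> p"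
    and disj: "{p, r, p', r'} \<inter> insert x (insert c A) = {}"
    using cl unfolding cluster_def by auto
  note nf = neck_facts[OF nk]
  let ?X = "A \<union> {c, p, r}"
  have p'p: "p' \<noteq> p" "r' \<noteq> r" using Np Nr irrefl_E by blast+
  have out: "E \<inter> ?X \<times> (- ?X) \<subseteq> {(u, x), (p, p'), (r, r')}"
  proof
    fix e assume "e \<in> E \<inter> ?X \<times> (- ?X)"
    then obtain s t where e: "e = (s, t)"
      and st: "(s, t) \<in> E" "t \<noteq> c" "t \<noteq> p" "t \<noteq> r" "t \<notin> A" "s = c \<or> s = p \<or> s = r \<or> s \<in> A" by blast
    consider "s = c" "A = {}" | "s = c" "A \<noteq> {}" | "s = p" | "s = r" | "s \<in> A" using st(6) by blast
    then have "s = u \<and> t = x \<or> s = p \<and> t = p' \<or> s = r \<and> t = r'"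
    proof cases
      case 1
      then show ?thesis using nf(6) Nc st by auto
    next
      case 2
      then have "t \<in> P \<union> {p, r}" "P \<subseteq> A" using nf(7) Nc st(1) by auto
      then show ?thesis using st by auto
    next
      case 3
      then have "t \<in> {c, r, p'}" using Np st(1) by auto
      then show ?thesis using 3 st by auto
    next
      case 4
      then have "t \<in> {c, p, r'}" using Nr st(1) by auto
      then show ?thesis using 4 st by auto
    next
      case 5
      then have "t \<in> insert x (insert c A)" using nf(8) st(1) by blast
      then have "t = x" using st by blast
      then show ?thesis using nf(9) 5 st(1) by blast
    qed
    then show "e \<in> {(u, x), (p, p'), (r, r')}" using e by blast
  qed
  have pp': "(p, p') \<in> E \<inter> ?X \<times> (- ?X)" using Np disj p'r' p'p by auto
  have finA: "finite A" using nf(1) finite_W finite_subset by blast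
  have pA: "p \<notin> A" "r \<notin> A" "p \<noteq> c" "r \<noteq> c" using disj by auto
  then have cX: "card ?X = card A + 3" using finA pr(1) nf(3) by auto
  show ?thesis
  proof unfold_locales
    show "?X \<subseteq> W" using nf(1,2) pr by blast
    show "c \<in> ?X" by simp
    show "no_obstacle E W" by (rule no)
    have "inj_on snd {(u, x), (p, p'), (r, r')}" using disj p'r'(1) by auto
    then show "inj_on snd (E \<inter> ?X \<times> (- ?X))" using out by (rule inj_on_subset)
    show "E \<inter> ?X \<times> (- ?X) \<noteq> {}" using pp' by blast
    have "card (E \<inter> ?X \<times> (- ?X)) \<le> card {(u, x), (p, p'), (r, r')}" by (rule card_mono[OF _ out]) simp
    also have "\<dots> \<le> 3" by (simp add: card_insert_if)
    finally show "card (E \<inter> ?X \<times> (- ?X)) \<le> 3" .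
    fix s t assume st: "(s, t) \<in> E" "s \<in> ?X" "t \<notin> ?X"
    show "\<exists>T. uforest T \<and> T \<subseteq> E \<and> T \<subseteq> ?X \<times> ?X \<and>
        card ?X \<le> 3 * (\<Sum>v\<in>?X. card (T `` {v} \<union> (if v = s then {t} else {})) - 2)"
    proof (cases "A = {}")
      case True
      let ?S = "?X - {s}"
      let ?T = "{} \<union> {s} \<times> ?S \<union> ?S \<times> {s}"
      have T: "uforest ?T"
        by (rule uforest_attach_set[where X = "{s}"]) (use finA in \<open>auto intro: uforest.empty\<close>)
      have "(c, p) \<in> E" "(c, r) \<in> E" "(p, r) \<in> E" using Nc Np by auto
      then have sub: "?T \<subseteq> E" using True st(2) E_sym by auto
      have "card ?S = 2" using st(2) cX True finA by (subst card_Diff_singleton) auto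
      moreover have "?T `` {s} \<union> {t} = insert t ?S" by auto
      moreover have "t \<notin> ?S" "finite ?S" using st(3) finA by auto
      ultimately have "card (?T `` {s} \<union> {t}) = 3" by simp
      then have "1 \<le> card (?T `` {s} \<union> (if s = s then {t} else {})) - 2" by simp
      also have "\<dots> \<le> (\<Sum>v\<in>?X. card (?T `` {v} \<union> (if v = s then {t} else {})) - 2)"
        using st(2) finA by (intro member_le_sum) auto
      finally have "card ?X \<le> 3 * (\<Sum>v\<in>?X. card (?T `` {v} \<union> (if v = s then {t} else {})) - 2)"
        using cX True by simp
      then show ?thesis using T sub st(2) by (intro exI[of _ ?T]) blast
    next
      case False
      obtain T where T: "uforest T" "T \<subseteq> E" "T \<subseteq> insert c A \<times> insert c A"
        "card A \<le> 3 * (\<Sum>v\<in>A. card (T `` {v}) - 2)" "T `` {c} \<noteq> {}"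
        using neck_forest[OF nk] False by blast
      let ?T = "T \<union> {c} \<times> {p, r} \<union> {p, r} \<times> {c}"
      have uT: "uforest ?T" by (rule uforest_attach_set[OF T(1,3)]) (use pA in auto)
      have finT: "finite (T `` {v})" for v using uforest_finite[OF T(1)] by (rule finite_Image)
      have fin: "finite (?T `` {v} \<union> (if v = s then {t} else {}))" for v
        using uforest_finite[OF uT] by (simp add: finite_Image)
      have "?T `` {c} = T `` {c} \<union> {p, r}" using pA by auto
      moreover have "T `` {c} \<inter> {p, r} = {}" using T(3) pA by auto
      ultimately have "card (?T `` {c}) = card (T `` {c}) + 2"
        using pr(1) finT by (simp add: card_Un_disjoint del: Un_insert_right)
      moreover have "card (T `` {c}) \<ge> 1" using T(5) finT by (simp add: Suc_leI card_gt_0_iff)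
      ultimately have "1 \<le> card (?T `` {c}) - 2" by simp
      also have "\<dots> \<le> card (?T `` {c} \<union> (if c = s then {t} else {})) - 2"
        by (intro diff_le_mono card_mono[OF fin]) auto
      finally have "(\<Sum>v\<in>A. card (T `` {v}) - 2) + 1 \<le>
          (\<Sum>v\<in>A. card (?T `` {v} \<union> (if v = s then {t} else {})) - 2) +
          (card (?T `` {c} \<union> (if c = s then {t} else {})) - 2)"
        by (intro add_mono sum_mono diff_le_mono card_mono[OF fin]) auto
      also have "\<dots> = (\<Sum>v\<in>insert c A. card (?T `` {v} \<union> (if v = s then {t} else {})) - 2)"
        using nf(3) finA by simp
      also have "\<dots> \<le> (\<Sum>v\<in>?X. card (?T `` {v} \<union> (if v = s then {t} else {})) - 2)"
        using finA by (intro sum_mono2) auto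
      finally have "card ?X \<le> 3 * (\<Sum>v\<in>?X. card (?T `` {v} \<union> (if v = s then {t} else {})) - 2)"
        using T(4) cX by linarith
      moreover have "?T \<subseteq> E" using T(2) Nc E_sym by blast
      moreover have "?T \<subseteq> ?X \<times> ?X" using T(3) by blast
      ultimately show ?thesis using uT by blast
    qed
  qed
qed

text \<open>The vertex \<open>c\<close> of degree 4 contributes 2, a third of the six vertices,
  without help from the exit.\<close>

lemma bud_contraction:
  assumes no: "no_obstacle E W" and b: "bud E W t y a b c d e d' e'"
    and ne: "d' \<noteq> e'" "t \<noteq> d'" "t \<noteq> e'"
  shows "contraction V E W {y, a, b, c, d, e} c"
proof -
  let ?X = "{y, a, b, c, d, e}"
  have sub: "?X \<subseteq> W" and dist: "distinct [y, a, b, c, d, e]" and Ny: "E `` {y} = {t, a, b}"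
    and Na: "E `` {a} = {y, c, d}" and Nb: "E `` {b} = {y, c, e}" and Nc: "E `` {c} = {a, b, d, e}"
    and Nd: "E `` {d} = {a, c, d'}" and Ne: "E `` {e} = {b, c, e'}" and disj: "{t, d', e'} \<inter> ?X = {}"
    using b unfolding bud_def by - (elim conjE, assumption)+
  have out: "E \<inter> ?X \<times> (- ?X) \<subseteq> {(y, t), (d, d'), (e, e')}"
  proof
    fix z assume "z \<in> E \<inter> ?X \<times> (- ?X)"
    then obtain s v where z: "z = (s, v)" and st: "(s, v) \<in> E" "s \<in> ?X" "v \<notin> ?X" by blast
    have v: "v \<in> E `` {s}" using st(1) by simp
    from st(2) consider "s = y" | "s = a" | "s = b" | "s = c" | "s = d" | "s = e" by blast
    then show "z \<in> {(y, t), (d, d'), (e, e')}"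
    proof cases
      case 1
      then show ?thesis using v st(3) z unfolding 1 Ny by blast
    next
      case 2
      then show ?thesis using v st(3) z unfolding 2 Na by blast
    next
      case 3
      then show ?thesis using v st(3) z unfolding 3 Nb by blast
    next
      case 4
      then show ?thesis using v st(3) z unfolding 4 Nc by blast
    next
      case 5
      then show ?thesis using v st(3) z unfolding 5 Nd by blast
    next
      case 6
      then show ?thesis using v st(3) z unfolding 6 Ne by blast
    qed
  qed
  let ?B = "{} \<union> {c} \<times> {a, b, d, e} \<union> {a, b, d, e} \<times> {c}"
  let ?T = "insert (a, y) (insert (y, a) ?B)"
  have T0: "uforest ?B"
    by (rule uforest_attach_set[where X = "{c}"]) (use dist in \<open>auto intro: uforest.empty\<close>)
  have T: "uforest ?T"
    by (rule uforest_attach[where X = "{c, a, b, d, e}" and z = y and v = a]) (use T0 dist in simp_all, blast)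
  have edges: "(a, y) \<in> E" "(c, a) \<in> E" "(c, b) \<in> E" "(c, d) \<in> E" "(c, e) \<in> E" using Na Nc by blast+
  then have edges': "(y, a) \<in> E" "(a, c) \<in> E" "(b, c) \<in> E" "(d, c) \<in> E" "(e, c) \<in> E" using E_sym by blast+
  have TE: "?T \<subseteq> E" using edges edges' by auto
  show ?thesis
  proof unfold_locales
    show "?X \<subseteq> W" by (rule sub)
    show "c \<in> ?X" by simp
    show "no_obstacle E W" by (rule no)
    have "inj_on snd {(y, t), (d, d'), (e, e')}" using ne by auto
    then show "inj_on snd (E \<inter> ?X \<times> (- ?X))" using out by (rule inj_on_subset)
    have "(y, t) \<in> E \<inter> ?X \<times> (- ?X)" using Ny disj by blast
    then show "E \<inter> ?X \<times> (- ?X) \<noteq> {}" by blast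
    have "card (E \<inter> ?X \<times> (- ?X)) \<le> card {(y, t), (d, d'), (e, e')}" by (rule card_mono[OF _ out]) simp
    also have "\<dots> \<le> 3" by (simp add: card_insert_if)
    finally show "card (E \<inter> ?X \<times> (- ?X)) \<le> 3" .
    fix s v assume "(s, v) \<in> E" "s \<in> ?X" "v \<notin> ?X"
    let ?f = "\<lambda>x. card (?T `` {x} \<union> (if x = s then {v} else {})) - 2"
    have "card {a, b, d, e} = 4" using dist by auto
    moreover have "card {a, b, d, e} \<le> card (?T `` {c} \<union> (if c = s then {v} else {}))"
      using uforest_finite[OF T] by (intro card_mono) (auto simp: finite_Image)
    ultimately have "2 \<le> ?f c" by linarith
    also have "\<dots> \<le> sum ?f ?X" by (rule member_le_sum) auto
    finally have "card ?X \<le> 3 * sum ?f ?X" using dist by simp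
    then show "\<exists>T. uforest T \<and> T \<subseteq> E \<and> T \<subseteq> ?X \<times> ?X \<and>
        card ?X \<le> 3 * (\<Sum>x\<in>?X. card (T `` {x} \<union> (if x = s then {v} else {})) - 2)"
      using T TE by (intro exI[of _ ?T] conjI) auto
  qed
qed

end

section \<open>Deletion of a closed set and the induction\<close>

context wgraph
begin

text \<open>A counted vertex outside \<open>Z\<close> has no neighbour in \<open>Z\<close>, so
  deletion takes edges from free vertices only, and their degree drops to at most 2. A walk that
  would enter \<open>Z\<close> stops at such a vertex; hence the rest satisfies \<open>low\<close>
  and adds no further loss.\<close>

lemma remove_closed:
  assumes no: "no_obstacle E W" and st: "state Z m" and closed: "\<forall>d\<in>Z. E `` {d} \<inter> W \<subseteq> Z"
    and bound: "card (Z \<inter> W) \<le> 3 * m + k"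
    and reach: "\<And>w. w \<in> W - Z \<Longrightarrow>
      (\<exists>f\<in>V - W. card (E `` {f}) \<le> 2 \<and> (w, f) \<in> E\<^sup>*) \<or> (\<exists>z\<in>Z. (w, z) \<in> E\<^sup>*)"
    and IH: "\<And>E2 W2. wgraph (V - Z) E2 W2 \<Longrightarrow> no_obstacle E2 W2 \<Longrightarrow> low (V - Z) E2 W2 \<Longrightarrow> rich E2 W2 0"
  shows "rich E W k"
proof -
  define V2 where "V2 = V - Z"
  define E2 where "E2 = E \<inter> V2 \<times> V2"
  define W2 where "W2 = W - Z"
  have NW: "E2 `` {v} = E `` {v}" if v: "v \<in> W2" for v
  proof -
    have "n \<notin> Z" if "(v, n) \<in> E" for n
      using closed E_sym[OF that] v unfolding W2_def by blast
    then show ?thesis using E_V v unfolding E2_def V2_def W2_def by blast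
  qed
  have sub: "E2 `` {v} \<subseteq> E `` {v}" for v unfolding E2_def by blast
  have G2: "wgraph V2 E2 W2"
  proof
    show "finite V2" using finite_V by (simp add: V2_def)
    show "E2 \<subseteq> V2 \<times> V2" "(v, v) \<notin> E2" for v using irrefl_E by (auto simp: E2_def)
    show "sym E2" unfolding sym_def E2_def using E_sym by blast
    show "W2 \<subseteq> V2" using W_sub by (auto simp: W2_def V2_def)
    show "3 \<le> card (E2 `` {w})" if "w \<in> W2" for w
      using NW[OF that] deg_W[of w] that by (simp add: W2_def)
    show "card (E2 `` {v}) \<le> 3" if v: "v \<in> V2 - W2" for v
    proof -
      have "card (E2 `` {v}) \<le> card (E `` {v})" by (rule card_mono[OF finite_N sub])
      also have "\<dots> \<le> 3" using deg_free[of v] v by (auto simp: V2_def W2_def)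
      finally show ?thesis .
    qed
  qed
  have no2: "no_obstacle E2 W2"
    by (rule no_obstacle_image[OF wgraph_axioms no, of W2 E2 id]) (use NW in \<open>auto simp: W2_def\<close>)
  have walk: "(v, y) \<in> E2\<^sup>* \<and> y \<in> V2 \<or> (\<exists>f\<in>V2 - W2. card (E2 `` {f}) \<le> 2 \<and> (v, f) \<in> E2\<^sup>*)"
    if v: "v \<in> V2" and "(v, y) \<in> E\<^sup>*" for v y
    using that(2)
  proof (induction rule: rtrancl_induct)
    case base
    then show ?case using v by simp
  next
    case (step y z)
    show ?case
    proof (cases "(v, y) \<in> E2\<^sup>* \<and> y \<in> V2")
      case True
      show ?thesis
      proof (cases "z \<in> Z")
        case zZ: True
        have "y \<notin> W" using closed E_sym[OF step.hyps(2)] zZ True unfolding V2_def by blast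
        have "card (E2 `` {y}) \<le> card (E `` {y} - {z})"
          by (rule card_mono) (use zZ in \<open>auto simp: E2_def V2_def\<close>)
        also have "\<dots> = card (E `` {y}) - 1" using step.hyps(2) by simp
        also have "\<dots> \<le> 2" using deg_free[of y] True \<open>y \<notin> W\<close> by (auto simp: V2_def)
        finally show ?thesis using True \<open>y \<notin> W\<close> unfolding W2_def by blast
      next
        case False
        then have "(y, z) \<in> E2" "z \<in> V2" using step.hyps(2) True E_V unfolding E2_def V2_def by blast+
        then show ?thesis using True by (meson rtrancl_into_rtrancl)
      qed
    qed (use step.IH in blast)
  qed
  have low2: "low V2 E2 W2"
    unfolding low_def
  proof
    fix w assume w: "w \<in> W2"
    then have wV: "w \<in> V2" using W_sub by (auto simp: W2_def V2_def)
    from reach[of w] w consider f where "f \<in> V - W" "card (E `` {f}) \<le> 2" "(w, f) \<in> E\<^sup>*"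
      | z where "z \<in> Z" "(w, z) \<in> E\<^sup>*" unfolding W2_def by blast
    then show "\<exists>f\<in>V2 - W2. card (E2 `` {f}) \<le> 2 \<and> (w, f) \<in> E2\<^sup>*"
    proof cases
      case 1
      have "card (E2 `` {f}) \<le> 2" using card_mono[OF finite_N sub, of f] 1(2) by linarith
      then show ?thesis using walk[OF wV 1(3)] 1(1) unfolding W2_def by blast
    next
      case 2
      then show ?thesis using walk[OF wV 2(2)] unfolding V2_def by blast
    qed
  qed
  obtain F2 where F2: "uforest F2" "F2 \<subseteq> E2" "card W2 \<le> 3 * excess W2 F2"
    using IH[OF G2[unfolded V2_def] no2 low2[unfolded V2_def]] unfolding rich_def by auto
  obtain F1 where F1: "uforest F1" "F1 \<subseteq> E" "F1 \<subseteq> Z \<times> Z" "m \<le> excess W F1"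
    using st unfolding state_def by blast
  have F2V: "F2 \<subseteq> V2 \<times> V2" using F2(2) unfolding E2_def by blast
  have F: "uforest (F1 \<union> F2)" by (rule uforest_Un[OF F1(1) F2(1) F1(3) F2V]) (auto simp: V2_def)
  have "excess W2 F2 = (\<Sum>v\<in>W. if v \<in> Z then 0 else card (F2 `` {v}) - 2)"
    unfolding excess_def W2_def using finite_W by (intro sum.mono_neutral_cong_left) auto
  then have "excess W F1 + excess W2 F2 =
      (\<Sum>v\<in>W. card (F1 `` {v}) - 2 + (if v \<in> Z then 0 else card (F2 `` {v}) - 2))"
    unfolding excess_def by (simp add: sum.distrib)
  also have "\<dots> \<le> excess W (F1 \<union> F2)"
    unfolding excess_def
  proof (rule sum_mono)
    fix v
    have fin: "finite ((F1 \<union> F2) `` {v})" using uforest_finite[OF F] by (rule finite_Image)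
    have "card (F1 `` {v}) \<le> card ((F1 \<union> F2) `` {v})" "card (F2 `` {v}) \<le> card ((F1 \<union> F2) `` {v})"
      by (rule card_mono[OF fin]; blast)+
    moreover have "F1 `` {v} = {}" if "v \<notin> Z" using F1(3) that by blast
    ultimately show "card (F1 `` {v}) - 2 + (if v \<in> Z then 0 else card (F2 `` {v}) - 2)
        \<le> card ((F1 \<union> F2) `` {v}) - 2" by auto
  qed
  finally have "excess W F1 + excess W2 F2 \<le> excess W (F1 \<union> F2)" .
  moreover have "card W = card (Z \<inter> W) + card W2"
    unfolding W2_def using card_Int_Diff[OF finite_W, of Z] by (simp add: Int_commute)
  ultimately have "card W \<le> 3 * excess W (F1 \<union> F2) + k" using bound F1(4) F2(3) by linarith
  moreover have "F1 \<union> F2 \<subseteq> E" using F1(2) F2(2) unfolding E2_def by blast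
  ultimately show ?thesis using F unfolding rich_def by blast
qed

end

lemma (in irreducible) low_state:
  assumes f: "f \<in> V - W" and f2: "card (E `` {f}) \<le> 2"
  shows "\<exists>X m. state X m \<and> X \<noteq> {} \<and> potential X m \<ge> - 1"
proof (cases "card (E `` {f} \<inter> W) \<le> 1")
  case True
  have "card (E `` {f} \<inter> W - {f}) \<le> card (E `` {f} \<inter> W)" by (rule card_mono) auto
  then have "potential {f} 0 \<ge> - 1" using f True by (simp add: potential_def cost_def)
  then show ?thesis using state_single[OF f] by blast
next
  case False
  moreover have "card (E `` {f} \<inter> W) \<le> card (E `` {f})" by (rule card_mono) auto
  ultimately have c2: "card (E `` {f}) = 2" "card (E `` {f} \<inter> W) = card (E `` {f})" using f2 by linarith+
  then have "E `` {f} \<inter> W = E `` {f}" by (intro card_subset_eq) auto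
  moreover obtain w v where "E `` {f} = {w, v}" "w \<noteq> v" using c2(1) by (meson card_2_iff)
  ultimately show ?thesis using free_start[OF f, of w v] by blast
qed

text \<open>Contraction keeps connectedness but deletion need not, and the rest after a deletion
  satisfies \<open>low\<close>. The connected case thus falls back on the \<open>low\<close> case,
  and both share one induction on the number of vertices.\<close>

theorem weighted_theorem:
  assumes "wgraph V E W" "no_obstacle E W"
  shows "(low V E W \<longrightarrow> rich E W 0) \<and> (conn V E \<longrightarrow> rich E W 2)"
  using assms
proof (induction "card V" arbitrary: V E W rule: less_induct)
  case less
  interpret wgraph V E W by (rule less.prems(1))
  note no = less.prems(2)
  have contr: ?case if "contraction V E W X x0" and X: "\<exists>x\<in>X. x \<noteq> x0" for X x0
  proof -
    interpret contraction V E W X x0 by fact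
    have "V' \<subset> V" unfolding V'_def using X XW W_sub x0X by blast
    then have "card V' < card V" using finite_V by (rule psubset_card_mono[rotated])
    from less.hyps[OF this wgraph' no_obstacle'] show ?thesis using low' conn' rich' by blast
  qed
  show ?case
  proof (cases "\<exists>x u c A P p r p' r'. cluster E W x u c A P p r p' r'")
    case True
    then obtain x u c A P p r p' r' where cl: "cluster E W x u c A P p r p' r'" by blast
    then have "p \<noteq> c" unfolding cluster_def by blast
    then show ?thesis by (intro contr[OF cluster_contraction[OF no cl]]) blast
  next
    case no_cl: False
    show ?thesis
    proof (cases "\<exists>t y a b c d e d' e'. bud E W t y a b c d e d' e' \<and> d' \<noteq> e' \<and> t \<noteq> d' \<and> t \<noteq> e'")
      case True
      then obtain t y a b c d e d' e' where b: "bud E W t y a b c d e d' e'" "d' \<noteq> e'" "t \<noteq> d'" "t \<noteq> e'" by blast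
      then have "y \<noteq> c" unfolding bud_def by simp
      then show ?thesis by (intro contr[OF bud_contraction[OF no b]]) blast
    next
      case no_bd: False
      interpret irreducible V E W
        by unfold_locales (use no_cl no_bd no in blast)+
      \<comment> \<open>The final potential is twice an integer, so \<open>- 1 - 2 * k\<close> is
        rounded up to \<open>- 2 * k\<close>.\<close>
      have finish: "rich E W k"
        if st: "state X m" "X \<noteq> {}" and pot: "potential X m \<ge> - 1 - 2 * int k"
          and reach: "\<And>w z. w \<in> W \<Longrightarrow> z \<in> V \<Longrightarrow>
            (\<exists>f\<in>V - W. card (E `` {f}) \<le> 2 \<and> (w, f) \<in> E\<^sup>*) \<or> (w, z) \<in> E\<^sup>*" for X m k
      proof -
        from close_state[OF st(1)] obtain Z m' where Z: "state Z m'" "X \<subseteq> Z"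
          "\<forall>d\<in>Z. E `` {d} \<inter> W \<subseteq> Z" "potential Z m' \<ge> potential X m" by blast
        have "- 1 - 2 * int k \<le> potential Z m'" using pot Z(4) by (rule order_trans)
        then have "- 1 - 2 * int k \<le> 2 * (3 * int m' - int (card (Z \<inter> W)))"
          unfolding closed_even[OF Z(1,3)] .
        then have "3 * int m' - int (card (Z \<inter> W)) + int k \<ge> 0" by presburger
        then have bound: "card (Z \<inter> W) \<le> 3 * m' + k" by linarith
        obtain z where z: "z \<in> Z" "z \<in> V" using Z(2) st(2) state_V[OF Z(1)] by blast
        have "card (V - Z) < card V" by (rule psubset_card_mono) (use finite_V z in auto)
        note IH = less.hyps[OF this]
        show ?thesis
          by (rule remove_closed[OF no Z(1,3) bound]) (use reach[OF _ z(2)] z(1) IH in blast)+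
      qed
      show ?thesis
      proof (cases "W = {}")
        case True
        then have "rich E W k" for k
          unfolding rich_def by (intro exI[of _ "{}"]) (simp add: uforest.empty)
        then show ?thesis by blast
      next
        case False
        then obtain w where w: "w \<in> W" by blast
        have "rich E W 0" if low: "low V E W"
        proof -
          obtain f where f: "f \<in> V - W" "card (E `` {f}) \<le> 2" using low w unfolding low_def by blast
          obtain X m where X: "state X m" "X \<noteq> {}" "potential X m \<ge> - 1" using low_state[OF f] by blast
          show ?thesis by (rule finish[OF X(1,2)]) (use X(3) low in \<open>auto simp: low_def\<close>)
        qed
        \<comment> \<open>A star of degree \<open>d\<close> starts at \<open>3 * d - 14\<close>, at
          least -5, which is \<open>- 1 - 2 * 2\<close>.\<close>
        moreover have "rich E W 2" if c: "conn V E"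
        proof -
          let ?N = "E `` {w}"
          have "w \<notin> ?N" using irrefl_E by auto
          then have "(\<Sum>d\<in>insert w ?N. cost (insert w ?N) d) = cost (insert w ?N) w + (\<Sum>d\<in>?N. cost (insert w ?N) d)"
            by simp
          moreover have "cost (insert w ?N) w = 2" by (rule cost_dead[OF w]) auto
          moreover have "(\<Sum>d\<in>?N. cost (insert w ?N) d) \<le> 3 * int (card ?N)" by (rule sum_cost_children) auto
          ultimately have "potential (insert w ?N) (card ?N - 2) \<ge> - 5"
            unfolding potential_def using deg_W[OF w] by (simp add: of_nat_diff)
          then show ?thesis
            by (intro finish[OF state_star[OF w]]) (use c W_sub in \<open>auto simp: conn_def\<close>)
        qed
        ultimately show ?thesis by blast
      qed
    qed
  qed
qed

subsection \<open>Copies of necklaces and blossoms\<close>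

lemma mk_symmetric_pair:
  assumes "sym (parcs G)"
  shows "mk_symmetric (with_proj G) = \<lparr>pverts = pverts G, parcs = parcs G\<rparr>"
proof -
  have "(\<Union>e\<in>parcs G. {(fst e, snd e), (snd e, fst e)}) = parcs G"
    using assms by (auto dest: symD)
  then show ?thesis by (simp add: mk_symmetric_def)
qed

lemma connected_pair_iff:
  assumes "sym (parcs G)" "parcs G \<subseteq> pverts G \<times> pverts G"
  shows "Digraph_Component.connected (with_proj G) \<longleftrightarrow> pverts G \<noteq> {} \<and> conn (pverts G) (parcs G)"
proof -
  have "(u, v) \<in> rtrancl_on (pverts G) (parcs G) \<longleftrightarrow> (u, v) \<in> (parcs G)\<^sup>*" if "u \<in> pverts G" "v \<in> pverts G" for u v
  proof
    show "(u, v) \<in> rtrancl_on (pverts G) (parcs G) \<Longrightarrow> (u, v) \<in> (parcs G)\<^sup>*"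
      by (rule rtrancl_on_rtranclI)
    show "(u, v) \<in> (parcs G)\<^sup>* \<Longrightarrow> (u, v) \<in> rtrancl_on (pverts G) (parcs G)"
      by (rule rtrancl_consistent_rtrancl_on) (use that assms(2) in auto)
  qed
  then show ?thesis
    unfolding Digraph_Component.connected_def strongly_connected_def conn_def reachable_def mk_symmetric_pair[OF assms(1)]
    by auto
qed

lemma pair_graphI:
  assumes "finite V" "F \<subseteq> V \<times> V" "sym F" "\<And>v. (v, v) \<notin> F"
  shows "pair_graph \<lparr>pverts = V, parcs = F\<rparr>"
proof -
  have "finite F" using assms(1,2) by (meson finite_SigmaI finite_subset)
  moreover have "symmetric (with_proj \<lparr>pverts = V, parcs = F\<rparr>)" using assms(3) by (simp add: symmetric_def)
  ultimately show ?thesis using assms(1,2,4) by unfold_locales auto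
qed

lemma pair_graphD:
  assumes "pair_graph G"
  shows "finite (pverts G)" "parcs G \<subseteq> pverts G \<times> pverts G" "sym (parcs G)" "(v, v) \<notin> parcs G"
proof -
  interpret pair_graph G by fact
  show "finite (pverts G)" by (rule pair_finite_verts)
  show "parcs G \<subseteq> pverts G \<times> pverts G" using in_arcsD1 in_arcsD2 by auto
  show "sym (parcs G)" using pair_sym_arcs by (simp add: symmetric_def)
  show "(v, v) \<notin> parcs G" using pair_no_loops[of "(v, v)"] by auto
qed

lemma vdegree_image: "vdegree G v = card (parcs G `` {v})"
  by (simp add: vdegree_eq Image_singleton)

text \<open>By \<open>deg\<close>, precisely the degree-2 vertices of \<open>N\<close> have a
  further edge in \<open>G\<close>, and only one; therefore terminals and ends coincide.\<close>

lemma obstacle_copy: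
  assumes N: "pair_graph N" and G: "pair_graph G" and inj: "inj_on h (pverts N)"
    and sub: "h ` pverts N \<subseteq> pverts G" and arcs: "\<And>i j. (i, j) \<in> parcs N \<Longrightarrow> (h i, h j) \<in> parcs G"
    and deg: "\<And>i. i \<in> pverts N \<Longrightarrow> card (parcs G `` {h i}) = (if vdegree N i = 2 then 3 else vdegree N i)"
  shows "\<exists>H. Digraph_Component.subgraph (with_proj H) (with_proj G) \<and> digraph_iso (with_proj N) (with_proj H) \<and>
    terminals G H = ends H \<and> (\<forall>c \<in> ends H. vdegree G c = 3)"
proof -
  interpret N: pair_graph N by (rule N)
  interpret G: pair_graph G by (rule G)
  define H where "H = \<lparr>pverts = h ` pverts N, parcs = map_prod h h ` parcs N\<rparr>"
  have Nsub: "parcs N \<subseteq> pverts N \<times> pverts N" by (rule pair_graphD[OF N])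
  have wfH: "wf_digraph (with_proj H)"
    by unfold_locales (use Nsub in \<open>auto simp: H_def\<close>)
  have injp: "inj_on (map_prod h h) (parcs N)"
    using inj Nsub by (intro inj_on_subset[OF map_prod_inj_on[OF inj inj]])
  let ?f = "\<lparr>iso_verts = h, iso_arcs = map_prod h h, iso_head = snd, iso_tail = fst\<rparr>"
  have "pre_digraph.digraph_isomorphism (with_proj N) ?f"
    unfolding pre_digraph.digraph_isomorphism_def using N.wf_digraph_axioms inj injp by auto
  moreover have "with_proj H = app_iso ?f (with_proj N)"
    by (simp add: app_iso_def H_def with_proj_def)
  ultimately have iso: "digraph_iso (with_proj N) (with_proj H)" unfolding digraph_iso_def by blast
  have subgraph: "Digraph_Component.subgraph (with_proj H) (with_proj G)"
    unfolding subgraph_def compatible_def using wfH G.wf_digraph_axioms sub arcs by (auto simp: H_def)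
  have degH: "vdegree H (h i) = vdegree N i" if i: "i \<in> pverts N" for i
  proof -
    have "parcs H `` {h i} = h ` (parcs N `` {i})"
    proof (intro equalityI subsetI)
      fix q assume "q \<in> parcs H `` {h i}"
      then obtain j k where jk: "(j, k) \<in> parcs N" "h j = h i" "h k = q" unfolding H_def by auto
      then have "j = i" using inj_onD[OF inj jk(2)] i Nsub by auto
      with jk show "q \<in> h ` (parcs N `` {i})" by (intro image_eqI[of _ _ k]) auto
    next
      fix q assume "q \<in> h ` (parcs N `` {i})"
      then obtain k where "(i, k) \<in> parcs N" "q = h k" by auto
      then show "q \<in> parcs H `` {h i}" unfolding H_def by force
    qed
    moreover have "inj_on h (parcs N `` {i})" using Nsub by (intro inj_on_subset[OF inj]) auto
    ultimately show ?thesis by (simp add: vdegree_image card_image)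
  qed
  have degG: "vdegree G (h i) = (if vdegree N i = 2 then 3 else vdegree N i)" if "i \<in> pverts N" for i
    using deg[OF that] by (simp add: vdegree_image)
  have "terminals G H = ends H"
    unfolding terminals_def ends_def using degH degG by (auto simp: H_def split: if_splits)
  moreover have "\<forall>c \<in> ends H. vdegree G c = 3"
    unfolding ends_def using degH degG by (auto simp: H_def)
  ultimately show ?thesis using iso subgraph by blast
qed

text \<open>\<open>k\<close> counts the diamonds. A junction has two neighbours in each of its
  diamonds, while the first vertex has \<open>x\<close> in place of one pair; \<open>card P\<close>
  records this difference at the current end.\<close>

lemma (in wgraph) neck_embedding:
  assumes "neck E W x u c A P"
  shows "\<exists>k h. inj_on h {..3 * k} \<and> h ` {..3 * k} = insert c A \<and> h (3 * k) = c \<and>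
    (\<forall>i j. (i, j) \<in> parcs (necklace k) \<longrightarrow> (h i, h j) \<in> E) \<and> (k = 0 \<longleftrightarrow> A = {}) \<and>
    (\<forall>i<3 * k. card (E `` {h i}) = (if i = 0 then 3 else if i mod 3 = 0 then 4 else 3)) \<and>
    card P = (if k = 0 then 1 else 2)"
  using assms
proof (induction rule: neck.induct)
  case start
  \<comment> \<open>For \<open>k = 0\<close> the interval \<open>{..3 * k}\<close> is
    \<open>{0}\<close> although \<open>necklace 0\<close> has no vertex, which gives the induction
    its one-vertex start.\<close>
  show ?case by (rule exI[of _ 0], rule exI[of _ "\<lambda>_. u"]) auto
next
  case (step c A P a b g)
  from step.IH obtain k h where h: "inj_on h {..3 * k}" "h ` {..3 * k} = insert c A" "h (3 * k) = c"
    "\<And>i j. (i, j) \<in> parcs (necklace k) \<Longrightarrow> (h i, h j) \<in> E" "k = 0 \<longleftrightarrow> A = {}"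
    "\<And>i. i < 3 * k \<Longrightarrow> card (E `` {h i}) = (if i = 0 then 3 else if i mod 3 = 0 then 4 else 3)"
    "card P = (if k = 0 then 1 else 2)" by blast
  note nf = neck_facts[OF step.hyps(1)]
  have ne: "a \<notin> insert c A" "b \<notin> insert c A" "g \<notin> insert c A" "a \<noteq> x" "b \<noteq> x" "a \<noteq> b"
    using step.hyps(3,9) by blast+
  have "g \<in> E `` {a}" "g \<in> E `` {b}" unfolding step.hyps(7,8) by simp_all
  then have gab: "g \<noteq> a" "g \<noteq> b" using irrefl_E by auto
  define h' where "h' = h(3*k+1 := a, 3*k+2 := b, 3*k+3 := g)"
  have h'h: "h' i = h i" if "i \<le> 3 * k" for i using that by (simp add: h'_def)
  have h'v: "h' (3*k+1) = a" "h' (3*k+2) = b" "h' (3*k+3) = g" by (simp_all add: h'_def)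
  have set: "{..3 * Suc k} = insert (3*k+3) (insert (3*k+2) (insert (3*k+1) {..3*k}))" by auto
  have img: "h' ` {..3 * k} = insert c A" unfolding h(2)[symmetric] by (rule image_cong) (use h'h in auto)
  have "inj_on h' {..3 * k}" using h(1) h'h by (subst inj_on_cong) auto
  then have inj: "inj_on h' {..3 * Suc k}"
    unfolding set using h'v img ne gab by (simp add: inj_on_insert image_iff[symmetric])
  have P_ab: "P \<inter> {a, b} = {}"
    using nf(6,7) ne by (cases "A = {}") auto
  have "finite P" by (rule finite_subset[OF nf(5) finite_N])
  then have cP: "card (E `` {c}) = card P + 2"
    unfolding step.hyps(2) using ne(6) P_ab by (subst card_Un_disjoint) auto
  have deg: "card (E `` {h' i}) = (if i = 0 then 3 else if i mod 3 = 0 then 4 else 3)" if i: "i < 3 * Suc k" for i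
  proof -
    have "i < 3 * k \<or> i = 3 * k \<or> i = 3 * k + 1 \<or> i = 3 * k + 2" using i by presburger
    then consider "i < 3 * k" | "i = 3 * k" | "i = 3 * k + 1" | "i = 3 * k + 2" by blast
    then show ?thesis
    proof cases
      case 1
      then show ?thesis using h(6) h'h[of i] by simp
    next
      case 2
      then show ?thesis using cP h(3,7) h'h[of i] by auto
    next
      case 3
      have "card (E `` {a}) = 3" unfolding step.hyps(7) using ne gab by auto
      moreover have "i mod 3 \<noteq> 0" using 3 by presburger
      ultimately show ?thesis using 3 h'v by simp
    next
      case 4
      have "card (E `` {b}) = 3" unfolding step.hyps(8) using ne gab by auto
      moreover have "i mod 3 \<noteq> 0" using 4 by presburger
      ultimately show ?thesis using 4 h'v by simp
    qed
  qed
  have "h' (3 * k) = c" using h'h[of "3 * k"] h(3) by simp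
  have ca: "(c, a) \<in> E" "(c, b) \<in> E" "(a, b) \<in> E" "(a, g) \<in> E" "(b, g) \<in> E"
    using step.hyps(2,7,8) by blast+
  then have ca': "(a, c) \<in> E" "(b, c) \<in> E" "(b, a) \<in> E" "(g, a) \<in> E" "(g, b) \<in> E" using E_sym by blast+
  have arcs: "(h' i, h' j) \<in> E" if ij: "(i, j) \<in> parcs (necklace (Suc k))" for i j
  proof (cases "(i, j) \<in> parcs (necklace k)")
    case True
    then show ?thesis using parcs_necklace_le[OF True] h(4) h'h by simp
  next
    case False
    then have "(i, j) \<in> parcs (diamond k)" using ij by simp
    then show ?thesis
      using ca ca' h'v \<open>h' (3 * k) = c\<close> unfolding diamond_def symcl_def by auto
  qed
  show ?case
  proof (intro exI conjI)
    show "inj_on h' {..3 * Suc k}" by (rule inj)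
    show "h' ` {..3 * Suc k} = insert g (A \<union> {c, a, b})" unfolding set using img h'v by auto
    show "h' (3 * Suc k) = g" using h'v by (simp add: algebra_simps)
    show "\<forall>i j. (i, j) \<in> parcs (necklace (Suc k)) \<longrightarrow> (h' i, h' j) \<in> E" using arcs by blast
    show "Suc k = 0 \<longleftrightarrow> A \<union> {c, a, b} = {}" by simp
    show "card {a, b} = (if Suc k = 0 then 1 else 2)" using ne by simp
    show "\<forall>i<3 * Suc k. card (E `` {h' i}) = (if i = 0 then 3 else if i mod 3 = 0 then 4 else 3)"
      using deg by blast
  qed
qed

lemma no_obstacle_graph:
  assumes G: "pair_graph G" and W: "W \<subseteq> pverts G" and wg: "wgraph (pverts G) (parcs G) W"
    and nk: "\<not> (\<exists>H. two_necklace G H)" and bl: "\<not> (\<exists>H. two_blossom G H)"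
  shows "no_obstacle (parcs G) W"
proof -
  interpret wgraph "pverts G" "parcs G" W by (rule wg)
  show ?thesis
    unfolding no_obstacle_def
  proof (intro conjI allI impI notI)
    fix x u c A P
    assume n: "neck (parcs G) W x u c A P" "A \<noteq> {}" "card (parcs G `` {c}) = 3"
    note nf = neck_facts[OF n(1)]
    obtain k h where h: "inj_on h {..3 * k}" "h ` {..3 * k} = insert c A" "h (3 * k) = c"
      "\<And>i j. (i, j) \<in> parcs (necklace k) \<Longrightarrow> (h i, h j) \<in> parcs G" "k = 0 \<longleftrightarrow> A = {}"
      "\<And>i. i < 3 * k \<Longrightarrow> card (parcs G `` {h i}) = (if i = 0 then 3 else if i mod 3 = 0 then 4 else 3)"
      using neck_embedding[OF n(1)] by blast
    have k: "k \<ge> 1" using h(5) n(2) by simp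
    note pv = pverts_necklace[OF k]
    have "\<exists>H. Digraph_Component.subgraph (with_proj H) (with_proj G) \<and>
        digraph_iso (with_proj (necklace k)) (with_proj H) \<and>
        terminals G H = ends H \<and> (\<forall>c \<in> ends H. vdegree G c = 3)"
    proof (rule obstacle_copy[OF pair_graph_necklace G])
      show "inj_on h (pverts (necklace k))" unfolding pv by (rule h(1))
      show "h ` pverts (necklace k) \<subseteq> pverts G" unfolding pv h(2) using nf(1,2) W by blast
      show "(h i, h j) \<in> parcs G" if "(i, j) \<in> parcs (necklace k)" for i j using h(4)[OF that] .
      show "card (parcs G `` {h i}) = (if vdegree (necklace k) i = 2 then 3 else vdegree (necklace k) i)"
        if "i \<in> pverts (necklace k)" for i
        using that n(3) h(3,6) k unfolding pv by (cases "i = 3 * k") (auto simp: vdegree_necklace)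
    qed
    then show False using nk k unfolding two_necklace_def by blast
  next
    fix t y a b c d e g
    assume b: "bud (parcs G) W t y a b c d e g g" and g: "g \<in> W" "card (parcs G `` {g}) = 3"
    have sub: "{y, a, b, c, d, e} \<subseteq> W" and dist: "distinct [y, a, b, c, d, e]"
      and N: "parcs G `` {y} = {t, a, b}" "parcs G `` {a} = {y, c, d}" "parcs G `` {b} = {y, c, e}"
        "parcs G `` {c} = {a, b, d, e}" "parcs G `` {d} = {a, c, g}" "parcs G `` {e} = {b, c, g}"
      and disj: "{t, g, g} \<inter> {y, a, b, c, d, e} = {}"
      using b unfolding bud_def by - (elim conjE, assumption)+
    define h where "h v = (case v of Vb \<Rightarrow> c | Vx1 \<Rightarrow> a | Vy1 \<Rightarrow> d | Vx2 \<Rightarrow> b | Vy2 \<Rightarrow> e | Vc1 \<Rightarrow> y | Vc2 \<Rightarrow> g)" for v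
    have hs: "h Vb = c" "h Vx1 = a" "h Vy1 = d" "h Vx2 = b" "h Vy2 = e" "h Vc1 = y" "h Vc2 = g"
      by (simp_all add: h_def)
    have dist': "distinct [y, a, b, c, d, e, g]" "t \<notin> {a, b}" using dist disj by auto
    have A: "(c, a) \<in> parcs G" "(c, d) \<in> parcs G" "(c, b) \<in> parcs G" "(c, e) \<in> parcs G" "(a, d) \<in> parcs G"
      "(b, e) \<in> parcs G" "(y, a) \<in> parcs G" "(y, b) \<in> parcs G" "(d, g) \<in> parcs G" "(e, g) \<in> parcs G"
      by (simp_all only: Image_singleton_iff[symmetric] N insert_iff simp_thms)
    note A' = A[THEN E_sym]
    have "\<exists>H. Digraph_Component.subgraph (with_proj H) (with_proj G) \<and>
        digraph_iso (with_proj blossom) (with_proj H) \<and>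
        terminals G H = ends H \<and> (\<forall>c \<in> ends H. vdegree G c = 3)"
    proof (rule obstacle_copy[OF pair_graph_blossom G])
      show "inj_on h (pverts blossom)"
      proof (rule inj_onI)
        fix v w show "h v = h w \<Longrightarrow> v = w" using dist'(1) by (cases v; cases w) (simp_all add: hs)
      qed
      have "h v \<in> W" for v using sub g(1) by (cases v) (simp_all add: hs)
      then show "h ` pverts blossom \<subseteq> pverts G" using W by blast
      show "(h i, h j) \<in> parcs G" if "(i, j) \<in> parcs blossom" for i j
        using that A A' unfolding blossom_def symcl_def by (auto simp: hs)
      show "card (parcs G `` {h i}) = (if vdegree blossom i = 2 then 3 else vdegree blossom i)" for i
        using dist' g(2) by (cases i) (simp_all add: hs N vdegree_blossom)
    qed
    then show False using bl unfolding two_blossom_def by blast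
  qed
qed

subsection \<open>Spanning trees\<close>

lemma pcas_verts:
  "pcas u p v \<Longrightarrow> last (pawalk_verts u p) = v \<and>
     (\<forall>e\<in>set p. fst e \<in> set (pawalk_verts u p) \<and> snd e \<in> set (pawalk_verts u p))"
proof (induction p arbitrary: u)
  case (Cons e p)
  have "pawalk_verts (snd e) p \<noteq> []" "snd e \<in> set (pawalk_verts (snd e) p)"
    using Cons.prems by (cases p; auto)+
  with Cons show ?case by auto
qed simp

lemma pcas_rtrancl: "pcas u p v \<Longrightarrow> set p \<subseteq> R \<Longrightarrow> (u, v) \<in> R\<^sup>*"
proof (induction p arbitrary: u)
  case (Cons e p)
  then have "(u, snd e) \<in> R" "(snd e, v) \<in> R\<^sup>*" by auto
  then show ?case by (rule converse_rtrancl_into_rtrancl)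
qed simp

text \<open>The rest of a cycle through the edge \<open>uw\<close> is a walk from \<open>w\<close>
  to \<open>u\<close>. For length at least 3 it avoids this edge in both directions, against
  \<open>uforest_bridge\<close>.\<close>

lemma uforest_acyclic:
  assumes F: "uforest F" and c: "pre_digraph.cycle (with_proj \<lparr>pverts = V, parcs = F\<rparr>) p"
  shows "length p < 3"
proof (rule ccontr)
  assume len: "\<not> length p < 3"
  from c obtain u where u: "set p \<subseteq> F" "pcas u p u" "distinct (tl (pawalk_verts u p))"
    unfolding pre_digraph.cycle_def pre_digraph.awalk_def cas_with_proj_eq awalk_verts_with_proj_eq by auto
  from len obtain e1 p1 where p1: "p = e1 # p1" by (cases p) auto
  with len obtain e2 p2 where p2: "p1 = e2 # p2" by (cases p1) auto
  with len p1 have "p2 \<noteq> []" by auto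
  moreover have "e1 = (u, snd e1)" "e2 = (snd e1, snd e2)" using u(2) p1 p2 by (auto simp: prod_eq_iff)
  ultimately obtain w x fs where p: "p = (u, w) # (w, x) # fs" "fs \<noteq> []" using p1 p2 by metis
  have fs: "pcas x fs u" and dist: "distinct (w # pawalk_verts x fs)"
    using u(2,3) unfolding p(1) by auto
  note pv = pcas_verts[OF fs]
  obtain f gs where f: "fs = f # gs" "fst f = x" using p(2) fs by (cases fs) auto
  have "u \<in> set (pawalk_verts (snd f) gs)"
    using pv f by (cases gs) (auto split: if_splits)
  then have ux: "u \<noteq> x" "u \<noteq> w" using dist f by auto
  have "set ((w, x) # fs) \<subseteq> F - {(w, u), (u, w)}"
  proof
    fix e assume e: "e \<in> set ((w, x) # fs)"
    have "e \<in> F" using e u(1) p(1) by auto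
    moreover have "e \<notin> {(w, u), (u, w)}"
      using e ux pv dist by auto
    ultimately show "e \<in> F - {(w, u), (u, w)}" by blast
  qed
  moreover have "pcas w ((w, x) # fs) u" using fs by simp
  ultimately have "(w, u) \<in> (F - {(w, u), (u, w)})\<^sup>*" by (intro pcas_rtrancl)
  moreover have "(w, u) \<in> F" using u(1) p(1) uforest_sym[OF F] by (auto dest: symD)
  ultimately show False using uforest_bridge[OF F] by blast
qed

lemma uforest_spanning_tree:
  assumes G: "pair_graph G" and F: "uforest F" "F \<subseteq> parcs G" and c: "conn (pverts G) F"
    and ne: "pverts G \<noteq> {}"
  shows "undirected_spanning_tree \<lparr>pverts = pverts G, parcs = F\<rparr> G"
proof -
  note GD = pair_graphD[OF G]
  let ?T = "\<lparr>pverts = pverts G, parcs = F\<rparr>"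
  interpret G: pair_graph G by (rule G)
  have sub: "F \<subseteq> pverts G \<times> pverts G" using F(2) GD(2) by (rule subset_trans)
  have T: "pair_graph ?T"
    by (rule pair_graphI[OF GD(1) sub uforest_sym[OF F(1)] uforest_irrefl[OF F(1)]])
  interpret T: pair_graph ?T by (rule T)
  have "Digraph_Component.connected (with_proj ?T)"
    using connected_pair_iff[of ?T] uforest_sym[OF F(1)] sub c ne by simp
  moreover have "\<not> (\<exists>p. pre_digraph.cycle (with_proj ?T) p \<and> length p \<ge> 3)"
    using uforest_acyclic[OF F(1)] by (meson not_less)
  moreover have "Digraph_Component.spanning (with_proj ?T) (with_proj G)"
    unfolding spanning_def subgraph_def compatible_def
    using F(2) G.wf_digraph_axioms T.wf_digraph_axioms by simp
  ultimately show ?thesis unfolding undirected_spanning_tree_def undirected_tree_def using T by blast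
qed

theorem theorem1:
  fixes G :: "'a pair_pre_digraph"
  assumes simple: "pair_graph G"
    and conn: "Digraph_Component.connected (with_proj G)"
    and card_ge2: "card (pverts G) \<ge> 2"
    and no_2_necklace: "\<not> (\<exists>H. two_necklace G H)"
    and no_2_blossom: "\<not> (\<exists>H. two_blossom G H)"
  shows "\<exists>T. undirected_spanning_tree T G \<and>
    real (num_leaves T) \<ge> real (num_deg_ge3 G) / 3 + (if min_degree G \<ge> 3 then 4/3 else 2)"
proof -
  note GD = pair_graphD[OF simple]
  define V where "V = pverts G"
  define E where "E = parcs G"
  define W where "W = {v \<in> V. vdegree G v \<ge> 3}"
  have V: "finite V" "V \<noteq> {}" using GD(1) card_ge2 unfolding V_def by auto
  have WV: "W \<subseteq> V" unfolding W_def by blast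
  have wg: "wgraph V E W"
    by unfold_locales (use GD in \<open>auto simp: V_def E_def W_def vdegree_image\<close>)
  interpret wgraph V E W by (rule wg)
  have no: "no_obstacle E W"
    using no_obstacle_graph[OF simple _ _ no_2_necklace no_2_blossom, of W] WV wg unfolding V_def E_def by blast
  have c: "conn V E" using connected_pair_iff[OF GD(3,2)] conn unfolding V_def E_def by blast
  \<comment> \<open>A loss of 2 in three times the leaf count is 2/3, the difference between 2 and
    4/3.\<close>
  define k :: nat where "k = (if min_degree G \<ge> 3 then 2 else 0)"
  have "rich E W k"
  proof (cases "min_degree G \<ge> 3")
    case True
    then show ?thesis using weighted_theorem[OF wg no] c by (simp add: k_def)
  next
    case False
    \<comment> \<open>A vertex of minimum degree is free here and, by connectedness, witnesses
      \<open>low\<close> for every counted vertex.\<close>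
    have "min_degree G \<in> vdegree G ` V"
      unfolding min_degree_def V_def[symmetric] by (rule Min_in) (use V in auto)
    then obtain f where f: "f \<in> V" "vdegree G f = min_degree G" by auto
    then have "f \<in> V - W" "card (E `` {f}) \<le> 2"
      using False by (auto simp: W_def E_def vdegree_image)
    then have "low V E W" using c WV f(1) unfolding low_def conn_def by blast
    then show ?thesis using weighted_theorem[OF wg no] False by (simp add: k_def)
  qed
  then obtain F0 where F0: "uforest F0" "F0 \<subseteq> E" "card W \<le> 3 * excess W F0 + k"
    unfolding rich_def by blast
  obtain F where F: "uforest F" "F0 \<subseteq> F" "F \<subseteq> E" "E \<subseteq> F\<^sup>*"
    using uforest_extend[OF finite_E sym_E F0(1,2)] by blast
  have "E\<^sup>* \<subseteq> F\<^sup>*" using F(4) by (rule rtrancl_subset_rtrancl)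
  then have cF: "conn V F" using c unfolding conn_def by blast
  let ?T = "\<lparr>pverts = pverts G, parcs = F\<rparr>"
  have tree: "undirected_spanning_tree ?T G"
    by (rule uforest_spanning_tree[OF simple F(1)]) (use F(3) cF V in \<open>auto simp: E_def V_def\<close>)
  have "F `` {v} \<noteq> {}" if v: "v \<in> V" for v
  proof -
    have "V \<noteq> {v}" using card_ge2 unfolding V_def by auto
    then obtain u where "u \<in> V" "u \<noteq> v" using v by blast
    then have "(v, u) \<in> F\<^sup>*" using cF v unfolding conn_def by blast
    then show ?thesis by (cases rule: converse_rtranclE) (use \<open>u \<noteq> v\<close> in auto)
  qed
  moreover have "F \<subseteq> V \<times> V" using F(3) E_sub by (rule subset_trans)
  ultimately have "excess W F + 2 \<le> card {v \<in> V. card (F `` {v}) = 1}"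
    using uforest_leaves[OF F(1) _ V WV] by blast
  then have "excess W F + 2 \<le> num_leaves ?T"
    by (simp add: num_leaves_def vdegree_image V_def)
  moreover have "excess W F0 \<le> excess W F" using excess_mono[OF F(2) uforest_finite[OF F(1)]] .
  moreover have "num_deg_ge3 G = card W" by (simp add: num_deg_ge3_def W_def V_def)
  ultimately have "num_deg_ge3 G + 6 \<le> 3 * num_leaves ?T + k" using F0(3) by linarith
  then have "real (num_deg_ge3 G + 6) \<le> real (3 * num_leaves ?T + k)" by (simp only: of_nat_le_iff)
  then have "real (num_deg_ge3 G) + 6 \<le> 3 * real (num_leaves ?T) + real k" by simp
  then have "real (num_leaves ?T) \<ge> real (num_deg_ge3 G) / 3 + (if min_degree G \<ge> 3 then 4/3 else 2)"
    unfolding k_def by (simp split: if_splits)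
  with tree show ?thesis by blast
qed

end
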